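(* Let $\mathcal{C}\hookrightarrow\mathcal{D}$ be a full embedding of a small non-empty category $\mathcal{C}$ into a category $\mathcal{D}$ containing a $\mathcal{C}$-ultrahomogeneous and $\mathcal{C}$-universal object $u$. Suppose that the following two properties are satisfied: (a) For any objects $a,b\in\mathcal{C}$ and arrows $\xi:a\to u$ and $\chi:b\to u$ in $\mathcal{D}$ there exist an object $c$ of $\mathcal{C}$, arrows $f:a\to c$ and $g:b\to c$ in $\mathcal{C}$ and an arrow $\epsilon:c\to u$ in $\mathcal{D}$ such that $\epsilon\circ f=\xi$ and $\epsilon\circ g=\chi$. (b) For any arrows $f,g:a\to b$ in $\mathcal{C}$ and any arrow $\chi:b\to u$ in $\mathcal{D}$, $\chi\circ f=\chi\circ g$ implies $f=g$. Then $\mathcal{C}$ satisfies the amalgamation and joint embedding properties, the sets $\mathcal{I}_{\chi}:=\{f:u\cong u\mid f\circ\chi=\chi\}$ (for arrows $\chi:c\to u$ in $\mathcal{D}$ with $c\in\mathcal{C}$) define an algebraic base for the group $Aut_{\mathcal{D}}(u)$ of automorphisms of $u$ in $\mathcal{D}$, and there is a functor $F:\mathcal{C}^{\mathrm{op}}\to\mathbf{Cont}(Aut_{\mathcal{D}}(u))$, taking values in the subcategory of transitive $Aut_{\mathcal{D}}(u)$-actions, which sends every object $c$ of $\mathcal{C}$ to the set $\mathrm{Hom}_{\mathcal{D}}(c,u)$ with the obvious action of $Aut_{\mathcal{D}}(u)$, and any arrow $f:d\to c$ of $\mathcal{C}$ to the $Aut_{\mathcal{D}}(u)$-equivariant map $-\circ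 f:\mathrm{Hom}_{\mathcal{D}}(c,u)\to\mathrm{Hom}_{\mathcal{D}}(d,u)$. Moreover, the following conditions are equivalent: (i) All the arrows of $\mathcal{C}$ are strict monomorphisms. (ii) The functor $F$ is full and faithful and induces an equivalence $\mathbf{Sh}(\mathcal{C}^{\mathrm{op}},J_{at})\simeq\mathbf{Cont}(Aut_{\mathcal{D}}(u))$.
   Context: For a full embedding $\mathcal{C}\hookrightarrow\mathcal{D}$, an object $u$ of $\mathcal{D}$ is $\mathcal{C}$-universal if every $a\in\mathcal{C}$ admits an arrow $a\to u$ in $\mathcal{D}$; it is $\mathcal{C}$-ultrahomogeneous if for every $j:a\to b$ in $\mathcal{C}$ and $\chi_1:a\to u$, $\chi_2:b\to u$ in $\mathcal{D}$ there is an automorphism $\check{j}$ of $u$ in $\mathcal{D}$ with $\check{j}\circ\chi_1=\chi_2\circ j$. Amalgamation property: for all $f:a\to b$, $g:a\to c$ in $\mathcal{C}$ there are $f':b\to d$, $g':c\to d$ in $\mathcal{C}$ with $f'\circ f=g'\circ g$. Joint embedding property: any two objects $a,b$ of $\mathcal{C}$ admit arrows in $\mathcal{C}$ to a common object. An arrow $f:d\to c$ of $\mathcal{C}$ is a strict monomorphism if any arrow $g:e\to c$ of $\mathcal{C}$ such that $h\circ g=k\circ g$ whenever $h\circ f=k\circ f$ (for arrows $h,k$ of $\mathcal{C}$) factors uniquely through $f$. $J_{at}$ is the atomic topology on $\mathcal{C}^{\mathrm{op}}$ (covering sieves are exactly the non-empty ones). An algebraic base for a group $G$ is a (non-empty)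 collection of subgroups such that the intersection of any two members contains a member, and every conjugate of a member is a member; it generates a unique group topology having it as a neighbourhood basis of the identity, and $Aut_{\mathcal{D}}(u)$ carries the topology so generated by the $\mathcal{I}_{\chi}$. For a topological group $G$, $\mathbf{Cont}(G)$ is the topos of continuous left $G$-actions on discrete sets and equivariant maps. *)

theory Defs
  imports
    "HOL-Algebra.Group_Action"
    "HOL-Analysis.Product_Topology"
    "HOL-Library.Equipollence"
begin

section \<open>Categories and functors\<close>

record ('o, 'a) cat =
  Obj :: "'o set"
  Arr :: "'a set"
  Dom :: "'a \<Rightarrow> 'o"
  Cod :: "'a \<Rightarrow> 'o"
  Ident :: "'o \<Rightarrow> 'a"
  Comp :: "'a \<Rightarrow> 'a \<Rightarrow> 'a"  (infixr \<open>\<cdot>\<index>\<close> 75)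

definition hom_set :: "('o, 'a) cat \<Rightarrow> 'o \<Rightarrow> 'o \<Rightarrow> 'a set" where
  "hom_set C a b = {f \<in> Arr C. Dom C f = a \<and> Cod C f = b}"

locale category =
  fixes C :: "('o, 'a) cat" (structure)
  assumes Dom_in: "f \<in> Arr C \<Longrightarrow> Dom C f \<in> Obj C"
    and Cod_in: "f \<in> Arr C \<Longrightarrow> Cod C f \<in> Obj C"
    and Ident_in: "a \<in> Obj C \<Longrightarrow> Ident C a \<in> hom_set C a a"
    and Comp_in: "\<lbrakk>f \<in> hom_set C a b; g \<in> hom_set C b c\<rbrakk> \<Longrightarrow> g \<cdot> f \<in> hom_set C a c"
    and Comp_Ident: "f \<in> hom_set C a b \<Longrightarrow> f \<cdot> Ident C a = f"
    and Ident_Comp: "f \<in> hom_set C a b \<Longrightarrow> Ident C b \<cdot> f = f"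
    and Comp_assoc: "\<lbrakk>f \<in> hom_set C a b; g \<in> hom_set C b c; h \<in> hom_set C c d\<rbrakk>
          \<Longrightarrow> (h \<cdot> g) \<cdot> f = h \<cdot> (g \<cdot> f)"

definition op_cat :: "('o, 'a) cat \<Rightarrow> ('o, 'a) cat" where
  "op_cat C = \<lparr>Obj = Obj C, Arr = Arr C, Dom = Cod C, Cod = Dom C,
               Ident = Ident C, Comp = (\<lambda>g f. f \<cdot>\<^bsub>C\<^esub> g)\<rparr>"

definition full_subcat :: "('o, 'a) cat \<Rightarrow> 'o set \<Rightarrow> ('o, 'a) cat" where
  "full_subcat C S = \<lparr>Obj = Obj C \<inter> S, Arr = {f \<in> Arr C. Dom C f \<in> S \<and> Cod C f \<in> S},
                      Dom = Dom C, Cod = Cod C, Ident = Ident C, Comp = Comp C\<rparr>"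

definition inverse_arrows :: "('o, 'a) cat \<Rightarrow> 'a \<Rightarrow> 'a \<Rightarrow> bool" where
  "inverse_arrows C f g \<longleftrightarrow> f \<in> Arr C \<and> g \<in> hom_set C (Cod C f) (Dom C f) \<and>
     g \<cdot>\<^bsub>C\<^esub> f = Ident C (Dom C f) \<and> f \<cdot>\<^bsub>C\<^esub> g = Ident C (Cod C f)"

definition isomorphism :: "('o, 'a) cat \<Rightarrow> 'a \<Rightarrow> bool" where
  "isomorphism C f \<longleftrightarrow> (\<exists>g. inverse_arrows C f g)"

definition Aut_group :: "('o, 'a) cat \<Rightarrow> 'o \<Rightarrow> 'a monoid" where
  "Aut_group C u = \<lparr>carrier = {f \<in> hom_set C u u. isomorphism C f},
                    mult = Comp C, one = Ident C u\<rparr>"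

record ('o1, 'a1, 'o2, 'a2) cfunctor =
  Fobj :: "'o1 \<Rightarrow> 'o2"
  Farr :: "'a1 \<Rightarrow> 'a2"

locale cat_functor = dom: category A + cod: category B
  for A :: "('o1, 'a1) cat" and B :: "('o2, 'a2) cat" +
  fixes F :: "('o1, 'a1, 'o2, 'a2) cfunctor"
  assumes Fobj_in: "a \<in> Obj A \<Longrightarrow> Fobj F a \<in> Obj B"
    and Farr_in: "f \<in> hom_set A a b \<Longrightarrow> Farr F f \<in> hom_set B (Fobj F a) (Fobj F b)"
    and Farr_Ident: "a \<in> Obj A \<Longrightarrow> Farr F (Ident A a) = Ident B (Fobj F a)"
    and Farr_Comp: "\<lbrakk>f \<in> hom_set A a b; g \<in> hom_set A b c\<rbrakk>
          \<Longrightarrow> Farr F (g \<cdot>\<^bsub>A\<^esub> f) = Farr F g \<cdot>\<^bsub>B\<^esub> Farr F f"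

definition full_functor ::
  "('o1, 'a1) cat \<Rightarrow> ('o2, 'a2) cat \<Rightarrow> ('o1, 'a1, 'o2, 'a2) cfunctor \<Rightarrow> bool" where
  "full_functor A B F \<longleftrightarrow> (\<forall>a\<in>Obj A. \<forall>b\<in>Obj A.
     \<forall>g\<in>hom_set B (Fobj F a) (Fobj F b). \<exists>f\<in>hom_set A a b. Farr F f = g)"

definition faithful_functor ::
  "('o1, 'a1) cat \<Rightarrow> ('o1, 'a1, 'o2, 'a2) cfunctor \<Rightarrow> bool" where
  "faithful_functor A F \<longleftrightarrow> (\<forall>a\<in>Obj A. \<forall>b\<in>Obj A. inj_on (Farr F) (hom_set A a b))"

text \<open>
  Injectivity on objects is not required, so both the inclusion of a full subcategory and any
  other fully faithful functor qualify.
\<close>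
definition full_embedding ::
  "('o1, 'a1) cat \<Rightarrow> ('o2, 'a2) cat \<Rightarrow> ('o1, 'a1, 'o2, 'a2) cfunctor \<Rightarrow> bool" where
  "full_embedding A B F \<longleftrightarrow> cat_functor A B F \<and> full_functor A B F \<and> faithful_functor A F"

definition natural_transformation ::
  "('o1, 'a1) cat \<Rightarrow> ('o2, 'a2) cat \<Rightarrow> ('o1, 'a1, 'o2, 'a2) cfunctor \<Rightarrow>
   ('o1, 'a1, 'o2, 'a2) cfunctor \<Rightarrow> ('o1 \<Rightarrow> 'a2) \<Rightarrow> bool" where
  "natural_transformation A B F G \<tau> \<longleftrightarrow>
     (\<forall>a\<in>Obj A. \<tau> a \<in> hom_set B (Fobj F a) (Fobj G a)) \<and>
     (\<forall>f\<in>Arr A. \<tau> (Cod A f) \<cdot>\<^bsub>B\<^esub> Farr F f = Farr G f \<cdot>\<^bsub>B\<^esub> \<tau> (Dom A f))"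

definition naturally_isomorphic ::
  "('o1, 'a1) cat \<Rightarrow> ('o2, 'a2) cat \<Rightarrow> ('o1, 'a1, 'o2, 'a2) cfunctor \<Rightarrow>
   ('o1, 'a1, 'o2, 'a2) cfunctor \<Rightarrow> bool" where
  "naturally_isomorphic A B F G \<longleftrightarrow>
     (\<exists>\<tau>. natural_transformation A B F G \<tau> \<and> (\<forall>a\<in>Obj A. isomorphism B (\<tau> a)))"

definition id_functor :: "('o, 'a, 'o, 'a) cfunctor" where
  "id_functor = \<lparr>Fobj = id, Farr = id\<rparr>"

definition comp_functor ::
  "('o2, 'a2, 'o3, 'a3) cfunctor \<Rightarrow> ('o1, 'a1, 'o2, 'a2) cfunctor \<Rightarrow>
   ('o1, 'a1, 'o3, 'a3) cfunctor" where
  "comp_functor G F = \<lparr>Fobj = Fobj G \<circ> Fobj F, Farr = Farr G \<circ> Farr F\<rparr>"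

definition equivalence_functor ::
  "('o1, 'a1) cat \<Rightarrow> ('o2, 'a2) cat \<Rightarrow> ('o1, 'a1, 'o2, 'a2) cfunctor \<Rightarrow> bool" where
  "equivalence_functor A B F \<longleftrightarrow> cat_functor A B F \<and>
     (\<exists>G. cat_functor B A G \<and>
          naturally_isomorphic A A (comp_functor G F) id_functor \<and>
          naturally_isomorphic B B (comp_functor F G) id_functor)"


section \<open>Properties of categories and of objects relative to an embedding\<close>

definition amalgamation_property :: "('o, 'a) cat \<Rightarrow> bool" where
  "amalgamation_property C \<longleftrightarrow>
     (\<forall>a\<in>Obj C. \<forall>b\<in>Obj C. \<forall>c\<in>Obj C. \<forall>f\<in>hom_set C a b. \<forall>g\<in>hom_set C a c.
        \<exists>d\<in>Obj C. \<exists>f'\<in>hom_set C b d. \<exists>g'\<in>hom_set C c d. f' \<cdot>\<^bsub>C\<^esub> f = g' \<cdot>\<^bsub>C\<^esub> g)"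

definition joint_embedding_property :: "('o, 'a) cat \<Rightarrow> bool" where
  "joint_embedding_property C \<longleftrightarrow>
     (\<forall>a\<in>Obj C. \<forall>b\<in>Obj C. \<exists>c\<in>Obj C. hom_set C a c \<noteq> {} \<and> hom_set C b c \<noteq> {})"

definition strict_monomorphism :: "('o, 'a) cat \<Rightarrow> 'a \<Rightarrow> bool" where
  "strict_monomorphism C f \<longleftrightarrow> f \<in> Arr C \<and>
     (\<forall>e\<in>Obj C. \<forall>g\<in>hom_set C e (Cod C f).
        (\<forall>x\<in>Obj C. \<forall>h\<in>hom_set C (Cod C f) x. \<forall>k\<in>hom_set C (Cod C f) x.
           h \<cdot>\<^bsub>C\<^esub> f = k \<cdot>\<^bsub>C\<^esub> f \<longrightarrow> h \<cdot>\<^bsub>C\<^esub> g = k \<cdot>\<^bsub>C\<^esub> g) \<longrightarrow>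
        (\<exists>!m. m \<in> hom_set C e (Dom C f) \<and> f \<cdot>\<^bsub>C\<^esub> m = g))"

definition universal_object ::
  "('o1, 'a1) cat \<Rightarrow> ('o2, 'a2) cat \<Rightarrow> ('o1, 'a1, 'o2, 'a2) cfunctor \<Rightarrow> 'o2 \<Rightarrow> bool" where
  "universal_object C D \<iota> u \<longleftrightarrow> (\<forall>a\<in>Obj C. hom_set D (Fobj \<iota> a) u \<noteq> {})"

definition ultrahomogeneous_object ::
  "('o1, 'a1) cat \<Rightarrow> ('o2, 'a2) cat \<Rightarrow> ('o1, 'a1, 'o2, 'a2) cfunctor \<Rightarrow> 'o2 \<Rightarrow> bool" where
  "ultrahomogeneous_object C D \<iota> u \<longleftrightarrow>
     (\<forall>a\<in>Obj C. \<forall>b\<in>Obj C. \<forall>j\<in>hom_set C a b.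
        \<forall>\<chi>1\<in>hom_set D (Fobj \<iota> a) u. \<forall>\<chi>2\<in>hom_set D (Fobj \<iota> b) u.
          \<exists>k\<in>carrier (Aut_group D u). k \<cdot>\<^bsub>D\<^esub> \<chi>1 = \<chi>2 \<cdot>\<^bsub>D\<^esub> Farr \<iota> j)"


section \<open>Smallness\<close>

text \<open>
  HOL has no class of all sets.  A type \<open>'v\<close> plays its part: its elements are the possible
  elements of sets, and a set is small if it has fewer elements than \<open>'v\<close> (limitation of size).
  We require that \<open>'v\<close> is infinite and that a small union of small sets is small, that is, that
  the cardinality of \<open>'v\<close> is regular.  Replacement and subsets are then automatic.  If the
  cardinality of \<open>'v\<close> is inaccessible, the small subsets of \<open>'v\<close> are the sets of a Grothendieck
  universe; if it is the successor of an infinite cardinal \<open>\<kappa>\<close>, they are the sets of at most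
  \<open>\<kappa>\<close> elements.  Closure under power sets is not demanded, so that such types exist in HOL.
\<close>
definition set_universe :: "'v itself \<Rightarrow> bool" where
  "set_universe _ \<longleftrightarrow> infinite (UNIV :: 'v set) \<and>
     (\<forall>\<A> :: 'v set set. \<A> \<prec> (UNIV :: 'v set) \<and> (\<forall>A\<in>\<A>. A \<prec> (UNIV :: 'v set))
        \<longrightarrow> \<Union>\<A> \<prec> (UNIV :: 'v set))"

definition small :: "'v itself \<Rightarrow> 'x set \<Rightarrow> bool" where
  "small _ A \<longleftrightarrow> A \<prec> (UNIV :: 'v set)"

definition small_category :: "'v itself \<Rightarrow> ('o, 'a) cat \<Rightarrow> bool" where
  "small_category v C \<longleftrightarrow> category C \<and> small v (Obj C) \<and> small v (Arr C)"

definition locally_small_category :: "'v itself \<Rightarrow> ('o, 'a) cat \<Rightarrow> bool" where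
  "locally_small_category v D \<longleftrightarrow> category D \<and>
     (\<forall>a\<in>Obj D. \<forall>b\<in>Obj D. small v (hom_set D a b))"


section \<open>Sets, functor categories and sheaves\<close>

text \<open>Maps between structured objects, tagged with their domain and codomain.\<close>
datatype ('o, 'm) tagged_map = TMap (tdom: 'o) (tmap: 'm) (tcod: 'o)

definition Set_cat :: "('v set, ('v set, 'v \<Rightarrow> 'v) tagged_map) cat" where
  "Set_cat = \<lparr>Obj = {X. small TYPE('v) X},
     Arr = {TMap X f Y | X f Y. small TYPE('v) X \<and> small TYPE('v) Y \<and> f \<in> X \<rightarrow>\<^sub>E Y},
     Dom = tdom, Cod = tcod,
     Ident = (\<lambda>X. TMap X (\<lambda>x\<in>X. x) X),
     Comp = (\<lambda>g f. TMap (tdom f) (compose (tdom f) (tmap g) (tmap f)) (tcod g))\<rparr>"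

text \<open>
  Functors and transformations are extensional, so that they are equal in the functor category
  as soon as they agree on the objects and arrows of \<open>A\<close>.
\<close>
definition functor_cat ::
  "('o1, 'a1) cat \<Rightarrow> ('o2, 'a2) cat \<Rightarrow>
   (('o1, 'a1, 'o2, 'a2) cfunctor, (('o1, 'a1, 'o2, 'a2) cfunctor, 'o1 \<Rightarrow> 'a2) tagged_map) cat" where
  "functor_cat A B =
     (let Ob = {F. cat_functor A B F \<and> Fobj F \<in> extensional (Obj A) \<and> Farr F \<in> extensional (Arr A)}
      in \<lparr>Obj = Ob,
          Arr = {TMap F \<tau> G | F \<tau> G. F \<in> Ob \<and> G \<in> Ob \<and> natural_transformation A B F G \<tau> \<and>
                                     \<tau> \<in> extensional (Obj A)},
          Dom = tdom, Cod = tcod,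
          Ident = (\<lambda>F. TMap F (\<lambda>a\<in>Obj A. Ident B (Fobj F a)) F),
          Comp = (\<lambda>\<sigma> \<tau>. TMap (tdom \<tau>) (\<lambda>a\<in>Obj A. tmap \<sigma> a \<cdot>\<^bsub>B\<^esub> tmap \<tau> a) (tcod \<sigma>))\<rparr>)"

type_synonym ('o, 'a, 'v) presheaf =
  "('o, 'a, 'v set, ('v set, 'v \<Rightarrow> 'v) tagged_map) cfunctor"

definition sieve :: "('o, 'a) cat \<Rightarrow> 'o \<Rightarrow> 'a set \<Rightarrow> bool" where
  "sieve S c R \<longleftrightarrow> R \<subseteq> {f \<in> Arr S. Cod S f = c} \<and>
     (\<forall>f\<in>R. \<forall>g\<in>Arr S. Cod S g = Dom S f \<longrightarrow> f \<cdot>\<^bsub>S\<^esub> g \<in> R)"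

definition atomic_topology :: "('o, 'a) cat \<Rightarrow> 'o \<Rightarrow> 'a set set" where
  "atomic_topology S c = {R. sieve S c R \<and> R \<noteq> {}}"

definition matching_family ::
  "('o, 'a) cat \<Rightarrow> ('o, 'a, 'v) presheaf \<Rightarrow> 'a set \<Rightarrow> ('a \<Rightarrow> 'v) \<Rightarrow> bool" where
  "matching_family S P R x \<longleftrightarrow> (\<forall>f\<in>R. x f \<in> Fobj P (Dom S f)) \<and>
     (\<forall>f\<in>R. \<forall>g\<in>Arr S. Cod S g = Dom S f \<longrightarrow> tmap (Farr P g) (x f) = x (f \<cdot>\<^bsub>S\<^esub> g))"

text \<open>The sheaf condition for a presheaf, i.e. a functor from \<open>op_cat S\<close> to sets.\<close>
definition is_sheaf ::
  "('o, 'a) cat \<Rightarrow> ('o \<Rightarrow> 'a set set) \<Rightarrow> ('o, 'a, 'v) presheaf \<Rightarrow> bool" where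
  "is_sheaf S J P \<longleftrightarrow> (\<forall>c\<in>Obj S. \<forall>R\<in>J c. \<forall>x. matching_family S P R x \<longrightarrow>
     (\<exists>!y. y \<in> Fobj P c \<and> (\<forall>f\<in>R. tmap (Farr P f) y = x f)))"

definition Sh ::
  "('o, 'a) cat \<Rightarrow> ('o \<Rightarrow> 'a set set) \<Rightarrow>
   (('o, 'a, 'v) presheaf, (('o, 'a, 'v) presheaf, 'o \<Rightarrow> ('v set, 'v \<Rightarrow> 'v) tagged_map) tagged_map) cat"
  where "Sh S J = full_subcat (functor_cat (op_cat S) Set_cat) {P. is_sheaf S J P}"


section \<open>Topological groups and continuous actions\<close>

definition topological_group :: "('g, 'm) monoid_scheme \<Rightarrow> 'g topology \<Rightarrow> bool" where
  "topological_group G T \<longleftrightarrow> group G \<and> topspace T = carrier G \<and>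
     continuous_map (prod_topology T T) T (\<lambda>(x, y). x \<otimes>\<^bsub>G\<^esub> y) \<and>
     continuous_map T T (\<lambda>x. inv\<^bsub>G\<^esub> x)"

definition neighbourhood_basis :: "'g topology \<Rightarrow> 'g \<Rightarrow> 'g set set \<Rightarrow> bool" where
  "neighbourhood_basis T x \<B> \<longleftrightarrow>
     (\<forall>N\<in>\<B>. \<exists>U. openin T U \<and> x \<in> U \<and> U \<subseteq> N) \<and>
     (\<forall>U. openin T U \<and> x \<in> U \<longrightarrow> (\<exists>N\<in>\<B>. N \<subseteq> U))"

definition algebraic_base :: "('g, 'm) monoid_scheme \<Rightarrow> 'g set set \<Rightarrow> bool" where
  "algebraic_base G \<B> \<longleftrightarrow> \<B> \<noteq> {} \<and> (\<forall>H\<in>\<B>. subgroup H G) \<and>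
     (\<forall>H\<in>\<B>. \<forall>K\<in>\<B>. \<exists>L\<in>\<B>. L \<subseteq> H \<inter> K) \<and>
     (\<forall>H\<in>\<B>. \<forall>g\<in>carrier G. g <#\<^bsub>G\<^esub> H #>\<^bsub>G\<^esub> inv\<^bsub>G\<^esub> g \<in> \<B>)"

definition generated_topology :: "('g, 'm) monoid_scheme \<Rightarrow> 'g set set \<Rightarrow> 'g topology" where
  "generated_topology G \<B> =
     topology (\<lambda>U. U \<subseteq> carrier G \<and> (\<forall>g\<in>U. \<exists>H\<in>\<B>. g <#\<^bsub>G\<^esub> H \<subseteq> U))"

text \<open>
  For an algebraic base, \<open>generated_topology\<close> is the one and only group topology having the base
  as a neighbourhood basis of the identity.
\<close>

context
  fixes G (structure) and \<B>
  assumes G: "group G" and base: "algebraic_base G \<B>"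
begin

interpretation group G by (rule G)

lemma base_subgroup: "H \<in> \<B> \<Longrightarrow> subgroup H G"
  using base by (auto simp: algebraic_base_def)

lemma base_conjugate:
  assumes "H \<in> \<B>" "g \<in> carrier G"
  shows "\<exists>K\<in>\<B>. \<forall>k\<in>K. \<exists>h\<in>H. k = g \<otimes> h \<otimes> inv g"
proof
  show "g <# H #> inv g \<in> \<B>"
    using base assms by (auto simp: algebraic_base_def)
  show "\<forall>k\<in>g <# H #> inv g. \<exists>h\<in>H. k = g \<otimes> h \<otimes> inv g"
    by (auto simp: l_coset_def r_coset_def)
qed

lemma openin_generated_topology:
  "openin (generated_topology G \<B>) U \<longleftrightarrow> U \<subseteq> carrier G \<and> (\<forall>g\<in>U. \<exists>H\<in>\<B>. g <# H \<subseteq> U)"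
proof -
  have "istopology (\<lambda>U. U \<subseteq> carrier G \<and> (\<forall>g\<in>U. \<exists>H\<in>\<B>. g <# H \<subseteq> U))"
    unfolding istopology_def
  proof (rule conjI; intro allI impI)
    fix S T
    assume S: "S \<subseteq> carrier G \<and> (\<forall>g\<in>S. \<exists>H\<in>\<B>. g <# H \<subseteq> S)"
      and T: "T \<subseteq> carrier G \<and> (\<forall>g\<in>T. \<exists>H\<in>\<B>. g <# H \<subseteq> T)"
    show "S \<inter> T \<subseteq> carrier G \<and> (\<forall>g\<in>S \<inter> T. \<exists>H\<in>\<B>. g <# H \<subseteq> S \<inter> T)"
    proof (intro conjI ballI)
      fix g assume "g \<in> S \<inter> T"
      then obtain H K where HK: "H \<in> \<B>" "g <# H \<subseteq> S" "K \<in> \<B>" "g <# K \<subseteq> T"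
        using S T by blast
      then obtain L where L: "L \<in> \<B>" "L \<subseteq> H \<inter> K"
        using base unfolding algebraic_base_def by meson
      then have "g <# L \<subseteq> S \<inter> T"
        using HK unfolding l_coset_def by blast
      then show "\<exists>H\<in>\<B>. g <# H \<subseteq> S \<inter> T"
        using L by blast
    qed (use S in blast)
  next
    fix \<K>
    assume *: "\<forall>K\<in>\<K>. K \<subseteq> carrier G \<and> (\<forall>g\<in>K. \<exists>H\<in>\<B>. g <# H \<subseteq> K)"
    have "\<exists>H\<in>\<B>. g <# H \<subseteq> \<Union>\<K>" if "g \<in> \<Union>\<K>" for g
      using * that by (meson Union_iff Union_upper dual_order.trans)
    then show "\<Union>\<K> \<subseteq> carrier G \<and> (\<forall>g\<in>\<Union>\<K>. \<exists>H\<in>\<B>. g <# H \<subseteq> \<Union>\<K>)"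
      using * by blast
  qed
  then show ?thesis
    by (simp add: generated_topology_def topology_inverse')
qed

lemma openin_coset:
  assumes "H \<in> \<B>" "g \<in> carrier G"
  shows "openin (generated_topology G \<B>) (g <# H)" "g \<in> g <# H"
proof -
  have H: "subgroup H G" using base_subgroup assms by blast
  note Hc = subgroup.subset[OF H]
  have "x <# H \<subseteq> g <# H" if x: "x \<in> g <# H" for x
  proof
    fix y assume "y \<in> x <# H"
    then obtain h k where hk: "h \<in> H" "k \<in> H" "y = g \<otimes> h \<otimes> k"
      using x by (auto simp: l_coset_def)
    then have "y = g \<otimes> (h \<otimes> k)" "h \<otimes> k \<in> H"
      using Hc assms(2) subgroup.m_closed[OF H] by (auto simp: m_assoc subset_iff)
    then show "y \<in> g <# H" by (auto simp: l_coset_def)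
  qed
  then show "openin (generated_topology G \<B>) (g <# H)"
    using assms Hc l_coset_subset_G by (auto simp: openin_generated_topology)
  have "g \<otimes> \<one> = g" "\<one> \<in> H" using assms(2) subgroup.one_closed[OF H] by auto
  then show "g \<in> g <# H" unfolding l_coset_def by force
qed

lemma topspace_generated_topology: "topspace (generated_topology G \<B>) = carrier G"
proof -
  obtain H where H: "H \<in> \<B>"
    using base by (auto simp: algebraic_base_def)
  then have "openin (generated_topology G \<B>) (carrier G)"
    using base_subgroup[OF H, THEN subgroup.subset] l_coset_subset_G
    unfolding openin_generated_topology by blast
  then show ?thesis
    using openin_generated_topology by (metis openin_subset openin_topspace subset_antisym)
qed

lemma topological_group_generated: "topological_group G (generated_topology G \<B>)"
  unfolding topological_group_def
proof (intro conjI)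
  let ?T = "generated_topology G \<B>"
  show "continuous_map (prod_topology ?T ?T) ?T (\<lambda>(x, y). x \<otimes> y)"
    unfolding continuous_map
  proof (intro conjI allI impI)
    fix U assume U: "openin ?T U"
    show "openin (prod_topology ?T ?T)
            {z \<in> topspace (prod_topology ?T ?T). (case z of (x, y) \<Rightarrow> x \<otimes> y) \<in> U}"
      unfolding openin_prod_topology_alt
    proof (intro allI impI)
      fix x y
      assume "(x, y) \<in> {z \<in> topspace (prod_topology ?T ?T). (case z of (x, y) \<Rightarrow> x \<otimes> y) \<in> U}"
      then have xy: "x \<in> carrier G" "y \<in> carrier G" "x \<otimes> y \<in> U"
        by (auto simp: topspace_generated_topology)
      then obtain H where H: "H \<in> \<B>" "(x \<otimes> y) <# H \<subseteq> U"
        using U by (auto simp: openin_generated_topology)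
      then obtain K where K: "K \<in> \<B>" "\<forall>k\<in>K. \<exists>h\<in>H. k = y \<otimes> h \<otimes> inv y"
        using base_conjugate xy by blast
      have sub: "subgroup H G" using H base_subgroup by blast
      have "x' \<otimes> y' \<in> U" if in': "x' \<in> x <# K" "y' \<in> y <# H" for x' y'
      proof -
        obtain k h where "k \<in> K" "h \<in> H" "x' = x \<otimes> k" "y' = y \<otimes> h"
          using in' by (auto simp: l_coset_def)
        moreover obtain h' where "h' \<in> H" "k = y \<otimes> h' \<otimes> inv y"
          using K \<open>k \<in> K\<close> by blast
        ultimately have "x' \<otimes> y' = (x \<otimes> y) \<otimes> (h' \<otimes> h)" "h' \<otimes> h \<in> H"
          using xy subgroup.mem_carrier[OF sub] subgroup.m_closed[OF sub]
          by (simp_all add: m_assoc inv_solve_left)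
             (metis inv_closed l_inv l_one m_assoc m_closed)
        then have "x' \<otimes> y' \<in> (x \<otimes> y) <# H"
          by (auto simp: l_coset_def)
        then show ?thesis using H by blast
      qed
      moreover have "x <# K \<subseteq> carrier G" "y <# H \<subseteq> carrier G"
        using openin_coset(1) K H xy openin_generated_topology by blast+
      ultimately show "\<exists>V W. openin ?T V \<and> openin ?T W \<and> x \<in> V \<and> y \<in> W \<and> V \<times> W \<subseteq>
          {z \<in> topspace (prod_topology ?T ?T). (case z of (x, y) \<Rightarrow> x \<otimes> y) \<in> U}"
        using openin_coset[OF K(1) xy(1)] openin_coset[OF H(1) xy(2)]
        by (intro exI[of _ "x <# K"] exI[of _ "y <# H"])
           (auto simp: topspace_generated_topology)
    qed
  qed (auto simp: topspace_generated_topology)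
  show "continuous_map ?T ?T (\<lambda>x. inv x)"
    unfolding continuous_map
  proof (intro conjI allI impI)
    fix U assume U: "openin ?T U"
    show "openin ?T {x \<in> topspace ?T. inv x \<in> U}"
      unfolding openin_generated_topology
    proof (intro conjI ballI)
      fix x assume "x \<in> {x \<in> topspace ?T. inv x \<in> U}"
      then have x: "x \<in> carrier G" "inv x \<in> U"
        by (auto simp: topspace_generated_topology)
      then obtain H where H: "H \<in> \<B>" "inv x <# H \<subseteq> U"
        using U by (auto simp: openin_generated_topology)
      then obtain K where K: "K \<in> \<B>" "\<forall>k\<in>K. \<exists>h\<in>H. k = inv x \<otimes> h \<otimes> inv (inv x)"
        using base_conjugate x by (meson inv_closed)
      have sub: "subgroup H G" using H base_subgroup by blast
      have "inv y \<in> U" if y: "y \<in> x <# K" for y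
      proof -
        obtain h where h: "h \<in> H" "y = x \<otimes> (inv x \<otimes> h \<otimes> x)"
          using y K x by (auto simp: l_coset_def)
        then have "y = h \<otimes> x"
          using x subgroup.mem_carrier[OF sub] by (metis inv_closed l_one m_assoc m_closed r_inv)
        then have "inv y = inv x \<otimes> inv h" "inv h \<in> H"
          using h x subgroup.mem_carrier[OF sub] subgroup.m_inv_closed[OF sub]
          by (auto simp: inv_mult_group)
        then show ?thesis using H by (auto simp: l_coset_def)
      qed
      moreover have "x <# K \<subseteq> carrier G"
        using openin_coset(1) K x openin_generated_topology by blast
      ultimately show "\<exists>H\<in>\<B>. x <# H \<subseteq> {x \<in> topspace ?T. inv x \<in> U}"
        using K by (auto simp: topspace_generated_topology)
    qed (auto simp: topspace_generated_topology)
  qed (auto simp: topspace_generated_topology)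
qed (rule G, rule topspace_generated_topology)

lemma neighbourhood_basis_generated: "neighbourhood_basis (generated_topology G \<B>) \<one> \<B>"
proof -
  have one: "\<one> <# H = H" if "H \<in> \<B>" for H
    using base_subgroup[OF that, THEN subgroup.subset] by (rule lcos_mult_one)
  show ?thesis
    unfolding neighbourhood_basis_def
  proof (intro conjI ballI allI impI)
    show "\<exists>U. openin (generated_topology G \<B>) U \<and> \<one> \<in> U \<and> U \<subseteq> N" if "N \<in> \<B>" for N
      using openin_coset[OF that one_closed] one[OF that] by auto
    show "\<exists>N\<in>\<B>. N \<subseteq> U" if "openin (generated_topology G \<B>) U \<and> \<one> \<in> U" for U
    proof -
      obtain H where "H \<in> \<B>" "\<one> <# H \<subseteq> U"
        using \<open>openin (generated_topology G \<B>) U \<and> \<one> \<in> U\<close>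
        unfolding openin_generated_topology by blast
      then show ?thesis using one by auto
    qed
  qed
qed

lemma generated_topology_unique:
  assumes T: "topological_group G T" "neighbourhood_basis T \<one> \<B>"
  shows "T = generated_topology G \<B>"
proof -
  have top: "topspace T = carrier G"
    and mult: "continuous_map (prod_topology T T) T (\<lambda>(x, y). x \<otimes> y)"
    using T(1) by (auto simp: topological_group_def)
  have trans: "openin T {x \<in> carrier G. g \<otimes> x \<in> U}" if "openin T U" "g \<in> carrier G" for U g
  proof -
    have "continuous_map T (prod_topology T T) (\<lambda>x. (g, x))"
      using that top by (auto simp: continuous_map_pairwise o_def)
    then have "continuous_map T T (\<lambda>x. g \<otimes> x)"
      using continuous_map_compose[OF _ mult] by (fastforce simp: o_def)
    then show ?thesis using that(1) top by (auto simp: continuous_map)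
  qed
  have "openin T U \<longleftrightarrow> openin (generated_topology G \<B>) U" for U
  proof
    assume U: "openin T U"
    have Uc: "U \<subseteq> carrier G" using U top openin_subset by blast
    have "\<exists>H\<in>\<B>. g <# H \<subseteq> U" if g: "g \<in> U" for g
    proof -
      have "\<one> \<in> {x \<in> carrier G. g \<otimes> x \<in> U}" using g Uc by auto
      then obtain H where "H \<in> \<B>" "H \<subseteq> {x \<in> carrier G. g \<otimes> x \<in> U}"
        using T(2) trans[OF U] g Uc unfolding neighbourhood_basis_def by (meson subsetD)
      then show ?thesis by (auto simp: l_coset_def)
    qed
    then show "openin (generated_topology G \<B>) U"
      using Uc by (auto simp: openin_generated_topology)
  next
    assume U: "openin (generated_topology G \<B>) U"
    show "openin T U"
    proof (subst openin_subopen, intro ballI)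
      fix g assume g: "g \<in> U"
      then obtain H where H: "H \<in> \<B>" "g <# H \<subseteq> U" and gc: "g \<in> carrier G"
        using U unfolding openin_generated_topology by blast
      obtain V where V: "openin T V" "\<one> \<in> V" "V \<subseteq> H"
        using T(2) H(1) unfolding neighbourhood_basis_def by meson
      let ?W = "{x \<in> carrier G. inv g \<otimes> x \<in> V}"
      have "?W \<subseteq> U"
      proof
        fix x assume x: "x \<in> ?W"
        then have "x = g \<otimes> (inv g \<otimes> x)" using gc by (simp add: m_assoc[symmetric])
        then have "x \<in> g <# H" using x V(3) unfolding l_coset_def by blast
        then show "x \<in> U" using H(2) by blast
      qed
      moreover have "openin T ?W" "g \<in> ?W"
        using trans[OF V(1)] gc V(2) by auto
      ultimately show "\<exists>W. openin T W \<and> g \<in> W \<and> W \<subseteq> U" by blast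
    qed
  qed
  then show ?thesis unfolding topology_eq by blast
qed

end

record ('g, 'v) gset =
  Pts :: "'v set"
  Act :: "'g \<Rightarrow> 'v \<Rightarrow> 'v"

definition transitive_gset :: "('g, 'm) monoid_scheme \<Rightarrow> ('g, 'v) gset \<Rightarrow> bool" where
  "transitive_gset G X \<longleftrightarrow> Pts X \<noteq> {} \<and> transitive_action G (Pts X) (Act X)"

definition continuous_gset ::
  "('g, 'm) monoid_scheme \<Rightarrow> 'g topology \<Rightarrow> ('g, 'v) gset \<Rightarrow> bool" where
  "continuous_gset G T X \<longleftrightarrow> group_action G (Pts X) (Act X) \<and> Act X \<in> extensional (carrier G) \<and>
     continuous_map (prod_topology T (discrete_topology (Pts X))) (discrete_topology (Pts X))
       (\<lambda>(g, x). Act X g x)"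

definition equivariant_maps ::
  "('g, 'm) monoid_scheme \<Rightarrow> ('g, 'v) gset \<Rightarrow> ('g, 'v) gset \<Rightarrow> ('v \<Rightarrow> 'v) set" where
  "equivariant_maps G X Y = {f \<in> Pts X \<rightarrow>\<^sub>E Pts Y.
     \<forall>g\<in>carrier G. \<forall>x\<in>Pts X. f (Act X g x) = Act Y g (f x)}"

definition Cont ::
  "('g, 'm) monoid_scheme \<Rightarrow> 'g topology \<Rightarrow>
   (('g, 'v) gset, (('g, 'v) gset, 'v \<Rightarrow> 'v) tagged_map) cat" where
  "Cont G T =
     (let Ob = {X. small TYPE('v) (Pts X) \<and> continuous_gset G T X}
      in \<lparr>Obj = Ob,
          Arr = {TMap X f Y | X f Y. X \<in> Ob \<and> Y \<in> Ob \<and> f \<in> equivariant_maps G X Y},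
          Dom = tdom, Cod = tcod,
          Ident = (\<lambda>X. TMap X (\<lambda>x\<in>Pts X. x) X),
          Comp = (\<lambda>g f. TMap (tdom f) (compose (Pts (tdom f)) (tmap g) (tmap f)) (tcod g))\<rparr>)"


section \<open>The automorphism group of \<open>u\<close> and the functor \<open>Hom(-, u)\<close>\<close>

definition fixing_subgroup :: "('o, 'a) cat \<Rightarrow> 'o \<Rightarrow> 'a \<Rightarrow> 'a set" where
  "fixing_subgroup D u \<chi> = {f \<in> carrier (Aut_group D u). f \<cdot>\<^bsub>D\<^esub> \<chi> = \<chi>}"

definition fixing_subgroups ::
  "('o1, 'a1) cat \<Rightarrow> ('o2, 'a2) cat \<Rightarrow> ('o1, 'a1, 'o2, 'a2) cfunctor \<Rightarrow> 'o2 \<Rightarrow> 'a2 set set" where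
  "fixing_subgroups C D \<iota> u =
     {fixing_subgroup D u \<chi> | c \<chi>. c \<in> Obj C \<and> \<chi> \<in> hom_set D (Fobj \<iota> c) u}"

definition Cont_Aut ::
  "('o1, 'a1) cat \<Rightarrow> ('o2, 'v) cat \<Rightarrow> ('o1, 'a1, 'o2, 'v) cfunctor \<Rightarrow> 'o2 \<Rightarrow>
   (('v, 'v) gset, (('v, 'v) gset, 'v \<Rightarrow> 'v) tagged_map) cat" where
  "Cont_Aut C D \<iota> u =
     Cont (Aut_group D u) (generated_topology (Aut_group D u) (fixing_subgroups C D \<iota> u))"

text \<open>
  The arrows of \<open>D\<close> are elements of the universe type, so that \<open>Hom(c, u)\<close> itself, and not a copy
  of it, is an object of \<open>Cont\<close>.
\<close>
definition hom_gset :: "('o, 'v) cat \<Rightarrow> 'o \<Rightarrow> 'o \<Rightarrow> ('v, 'v) gset" where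
  "hom_gset D u c = \<lparr>Pts = hom_set D c u,
     Act = (\<lambda>g\<in>carrier (Aut_group D u). \<lambda>\<chi>\<in>hom_set D c u. g \<cdot>\<^bsub>D\<^esub> \<chi>)\<rparr>"

text \<open>
  Used as a functor on \<open>op_cat C\<close>: an arrow \<open>f\<close> from \<open>d\<close> to \<open>c\<close> in \<open>C\<close> is sent to the map
  \<open>\<chi> \<mapsto> \<chi> \<circ> f\<close> from \<open>Hom(c, u)\<close> to \<open>Hom(d, u)\<close>.
\<close>
definition hom_functor ::
  "('o1, 'a1) cat \<Rightarrow> ('o2, 'v) cat \<Rightarrow> ('o1, 'a1, 'o2, 'v) cfunctor \<Rightarrow> 'o2 \<Rightarrow>
   ('o1, 'a1, ('v, 'v) gset, (('v, 'v) gset, 'v \<Rightarrow> 'v) tagged_map) cfunctor" where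
  "hom_functor C D \<iota> u = \<lparr>
     Fobj = (\<lambda>c. hom_gset D u (Fobj \<iota> c)),
     Farr = (\<lambda>f. TMap (hom_gset D u (Fobj \<iota> (Cod C f)))
                      (\<lambda>\<chi>\<in>hom_set D (Fobj \<iota> (Cod C f)) u. \<chi> \<cdot>\<^bsub>D\<^esub> Farr \<iota> f)
                      (hom_gset D u (Fobj \<iota> (Dom C f))))\<rparr>"

text \<open>
  A functor \<open>F\<close> from a site \<open>(S, J)\<close> to a topos \<open>E\<close> induces the functor sending \<open>X\<close> to
  \<open>Hom\<^sub>E(F(-), X)\<close>; when \<open>F\<close> is flat and \<open>J\<close>-continuous, this is the direct image, from \<open>E\<close> to
  \<open>Sh(S, J)\<close>, of the geometric morphism corresponding to \<open>F\<close> (Diaconescu), whose inverse image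
  extends \<open>F\<close>.  As the arrows of \<open>E\<close> are not themselves elements of the type \<open>'v\<close> in which
  presheaves take their values, \<open>N\<close> is described up to the natural bijection \<open>\<beta>\<close>, which
  determines it up to isomorphism.
\<close>
definition induced_by ::
  "('o, 'a) cat \<Rightarrow> ('p, 'b) cat \<Rightarrow> ('o, 'a, 'p, 'b) cfunctor \<Rightarrow>
   ('p, 'b, ('o, 'a, 'v) presheaf,
     (('o, 'a, 'v) presheaf, 'o \<Rightarrow> ('v set, 'v \<Rightarrow> 'v) tagged_map) tagged_map) cfunctor \<Rightarrow> bool" where
  "induced_by S E F N \<longleftrightarrow> (\<exists>\<beta>.
     (\<forall>X\<in>Obj E. \<forall>c\<in>Obj S.
        bij_betw (\<beta> X c) (hom_set E (Fobj F c) X) (Fobj (Fobj N X) c)) \<and>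
     (\<forall>X\<in>Obj E. \<forall>f\<in>Arr S. \<forall>m\<in>hom_set E (Fobj F (Cod S f)) X.
        \<beta> X (Dom S f) (m \<cdot>\<^bsub>E\<^esub> Farr F f) = tmap (Farr (Fobj N X) f) (\<beta> X (Cod S f) m)) \<and>
     (\<forall>h\<in>Arr E. \<forall>c\<in>Obj S. \<forall>m\<in>hom_set E (Fobj F c) (Dom E h).
        \<beta> (Cod E h) c (h \<cdot>\<^bsub>E\<^esub> m) = tmap (tmap (Farr N h) c) (\<beta> (Dom E h) c m)))"

definition induces_sheaf_equivalence ::
  "'v itself \<Rightarrow> ('o, 'a) cat \<Rightarrow> ('o \<Rightarrow> 'a set set) \<Rightarrow> ('p, 'b) cat \<Rightarrow>
   ('o, 'a, 'p, 'b) cfunctor \<Rightarrow> bool" where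
  "induces_sheaf_equivalence _ S J E F \<longleftrightarrow>
     (\<exists>N :: ('p, 'b, ('o, 'a, 'v) presheaf,
         (('o, 'a, 'v) presheaf, 'o \<Rightarrow> ('v set, 'v \<Rightarrow> 'v) tagged_map) tagged_map) cfunctor.
        equivalence_functor E (Sh S J) N \<and> induced_by S E F N)"

end

theory Submission
  imports Defs
begin

text \<open>
  Write \<open>H c\<close> for \<open>Hom\<^sub>D(c, u)\<close>, a transitive continuous action of \<open>G = Aut\<^sub>D(u)\<close>.  Properties (a) and
  (b) say that any two points of such actions come from a common stage \<open>\<epsilon> : d \<rightarrow> u\<close>, in an
  essentially unique way.  Every point of a continuous action is fixed by some \<open>\<I>\<^sub>\<chi>\<close>, hence lies in
  the image of an equivariant map from some \<open>H c\<close>; this makes the nerve \<open>X \<mapsto> Hom\<^sub>G(H(-), X)\<close>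
  fully faithful.  It takes values in atomic sheaves because the maps \<open>H f\<close> are surjective and
  \<open>\<chi> \<circ> f = \<sigma> \<circ> \<chi> \<circ> f\<close> can be tested in \<open>C\<close>, and a sheaf \<open>P\<close> is recovered from the colimit of
  the \<open>P c\<close> over all \<open>\<chi> : c \<rightarrow> u\<close>.  So the equivalence of (ii) holds without assuming (i), and \<open>F\<close>
  is always faithful by (b); the content of the equivalence of (i) and (ii) is that \<open>F\<close> is full
  exactly when all arrows are strict monomorphisms.
\<close>

section \<open>Categories and functors\<close>

text \<open>The site is \<open>op_cat C\<close>: presheaves on it are covariant functors on
  \<open>C\<close>, and a sieve on \<open>c\<close> consists of arrows out of \<open>c\<close>,
  closed under composition with further arrows. In these terms strictness of an arrow
  \<open>f\<close> and the atomic sheaf condition at \<open>f\<close> have the same form: all arrows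
  are strict exactly when every functor Hom_C(e, -) satisfies that condition, that is, when the
  atomic topology is subcanonical. Hence the proofs that arrows are strict and that nerves are
  sheaves run in parallel. The recurring tool translates between automorphisms and parallel pairs of
  \<open>C\<close>. By (a), an automorphism \<open>s\<close> and an arrow \<open>\<chi>\<close> into
  \<open>u\<close> yield \<open>h\<close>, \<open>k\<close> and \<open>\<epsilon>\<close> with s
  \<chi> = \<epsilon> h and \<chi> = \<epsilon> k; by ultrahomogeneity, any parallel pair acts on a
  given arrow into \<open>u\<close> as a pair of automorphisms does. The obstacle is size. Arrows of
  \<open>Cont\<close> are tagged maps and not elements of \<open>'v\<close>, so the values of the
  nerve have to be coded in \<open>'v\<close>, and so has the colimit attached to a sheaf.\<close>

lemma (in category) hom_objects:
  assumes "f \<in> hom_set C a b"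
  shows "a \<in> Obj C" "b \<in> Obj C" "f \<in> Arr C"
  using assms Dom_in Cod_in by (auto simp: hom_set_def)

lemma (in category) arr_hom: "f \<in> Arr C \<Longrightarrow> f \<in> hom_set C (Dom C f) (Cod C f)"
  by (simp add: hom_set_def)

section \<open>Opposite categories, full subcategories and equivalences\<close>

lemma op_cat_simps [simp]:
  "Obj (op_cat C) = Obj C" "Arr (op_cat C) = Arr C" "Dom (op_cat C) = Cod C"
  "Cod (op_cat C) = Dom C" "Ident (op_cat C) = Ident C" "g \<cdot>\<^bsub>op_cat C\<^esub> f = f \<cdot>\<^bsub>C\<^esub> g"
  by (simp_all add: op_cat_def)

lemma op_cat_op_cat [simp]: "op_cat (op_cat C) = C"
  by (simp add: op_cat_def)

lemma hom_set_op_cat [simp]: "hom_set (op_cat C) a b = hom_set C b a"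
  by (auto simp: hom_set_def)

lemma (in category) category_op_cat: "category (op_cat C)"
  by unfold_locales
    (auto simp: Dom_in Cod_in Ident_in Comp_Ident Ident_Comp intro: Comp_in Comp_assoc[symmetric])

lemma full_subcat_simps [simp]:
  "Obj (full_subcat C S) = Obj C \<inter> S" "Dom (full_subcat C S) = Dom C"
  "Cod (full_subcat C S) = Cod C" "Ident (full_subcat C S) = Ident C"
  "Comp (full_subcat C S) = Comp C"
  "f \<in> Arr (full_subcat C S) \<longleftrightarrow> f \<in> Arr C \<and> Dom C f \<in> S \<and> Cod C f \<in> S"
  by (simp_all add: full_subcat_def)

lemma hom_set_full_subcat:
  "hom_set (full_subcat C S) a b = (if a \<in> S \<and> b \<in> S then hom_set C a b else {})"
  by (auto simp: hom_set_def full_subcat_def)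

lemma (in category) category_full_subcat: "category (full_subcat C S)"
  by unfold_locales
    (auto simp: hom_set_full_subcat Ident_in Comp_Ident Ident_Comp Dom_in Cod_in
          split: if_splits intro: Comp_in Comp_assoc)

lemma cat_functor_full_subcat:
  assumes "cat_functor A B F" "\<And>a. a \<in> Obj A \<Longrightarrow> Fobj F a \<in> S"
  shows "cat_functor A (full_subcat B S) F"
proof -
  interpret F: cat_functor A B F by fact
  show ?thesis
    by (intro cat_functor.intro F.dom.category_axioms F.cod.category_full_subcat,
        unfold_locales)
      (auto simp: hom_set_full_subcat assms(2) F.Fobj_in F.Farr_in F.Farr_Ident F.Farr_Comp
            dest: F.dom.hom_objects)
qed

lemma inverse_arrows_full_subcat:
  assumes "inverse_arrows C f g" "Dom C f \<in> S" "Cod C f \<in> S"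
  shows "inverse_arrows (full_subcat C S) f g"
  using assms by (auto simp: inverse_arrows_def hom_set_full_subcat)

text \<open>The quasi-inverse comes from choice: \<open>o' b\<close> is an object of
  \<open>A\<close> with an isomorphism \<open>\<epsilon> b\<close> onto \<open>b\<close>, and an
  arrow \<open>h\<close> is conjugated by these isomorphisms to \<open>h' h\<close>, which lies over
  a unique arrow of \<open>A\<close>. Laws in \<open>A\<close> are checked after applying
  \<open>F\<close>, which is enough by faithfulness.\<close>

lemma equivalence_functorI:
  assumes F: "cat_functor A B F" and full: "full_functor A B F" and faithful: "faithful_functor A F"
    and surj: "\<And>b. b \<in> Obj B \<Longrightarrow> \<exists>a\<in>Obj A. \<exists>f\<in>hom_set B (Fobj F a) b. isomorphism B f"
  shows "equivalence_functor A B F"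
proof -
  interpret F: cat_functor A B F by fact
  have "\<forall>b\<in>Obj B. \<exists>a f g. a \<in> Obj A \<and> f \<in> hom_set B (Fobj F a) b \<and> inverse_arrows B f g"
    using surj unfolding isomorphism_def by meson
  then obtain o' \<epsilon> \<delta> where *: "\<And>b. b \<in> Obj B \<Longrightarrow>
      o' b \<in> Obj A \<and> \<epsilon> b \<in> hom_set B (Fobj F (o' b)) b \<and> inverse_arrows B (\<epsilon> b) (\<delta> b)"
    by metis
  have o: "o' b \<in> Obj A" and e: "\<epsilon> b \<in> hom_set B (Fobj F (o' b)) b"
    and d: "\<delta> b \<in> hom_set B b (Fobj F (o' b))"
    and de: "\<delta> b \<cdot>\<^bsub>B\<^esub> \<epsilon> b = Ident B (Fobj F (o' b))" and ed: "\<epsilon> b \<cdot>\<^bsub>B\<^esub> \<delta> b = Ident B b"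
    if "b \<in> Obj B" for b
    using *[OF that] by (auto simp: inverse_arrows_def hom_set_def)
  define lift where "lift a a' g = (SOME f. f \<in> hom_set A a a' \<and> Farr F f = g)" for a a' g
  have lift: "lift a a' g \<in> hom_set A a a'" "Farr F (lift a a' g) = g"
    if "a \<in> Obj A" "a' \<in> Obj A" "g \<in> hom_set B (Fobj F a) (Fobj F a')" for a a' g
  proof -
    have "\<exists>f. f \<in> hom_set A a a' \<and> Farr F f = g"
      using full that unfolding full_functor_def by blast
    from someI_ex[OF this] show "lift a a' g \<in> hom_set A a a'" "Farr F (lift a a' g) = g"
      by (auto simp: lift_def)
  qed
  have eq: "f = g" if "f \<in> hom_set A a a'" "g \<in> hom_set A a a'" "Farr F f = Farr F g" for a a' f g
    using faithful that F.dom.hom_objects[OF that(1)]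
    unfolding faithful_functor_def inj_on_def by blast
  note [intro] = F.cod.Comp_in F.dom.Comp_in
  define h' where "h' h = \<delta> (Cod B h) \<cdot>\<^bsub>B\<^esub> h \<cdot>\<^bsub>B\<^esub> \<epsilon> (Dom B h)" for h
  define G where "G = \<lparr>Fobj = o', Farr = (\<lambda>h. lift (o' (Dom B h)) (o' (Cod B h)) (h' h))\<rparr>"
  have h': "h' h = \<delta> b' \<cdot>\<^bsub>B\<^esub> h \<cdot>\<^bsub>B\<^esub> \<epsilon> b" "h' h \<in> hom_set B (Fobj F (o' b)) (Fobj F (o' b'))"
    if h: "h \<in> hom_set B b b'" for h b b'
  proof -
    show "h' h = \<delta> b' \<cdot>\<^bsub>B\<^esub> h \<cdot>\<^bsub>B\<^esub> \<epsilon> b" using h by (simp add: h'_def hom_set_def)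
    then show "h' h \<in> hom_set B (Fobj F (o' b)) (Fobj F (o' b'))"
      using h d e F.cod.hom_objects[OF h] by auto
  qed
  have G: "Farr G h \<in> hom_set A (o' b) (o' b')" "Farr F (Farr G h) = h' h"
    if h: "h \<in> hom_set B b b'" for h b b'
  proof -
    have 1: "Dom B h = b" "Cod B h = b'" using h by (auto simp: hom_set_def)
    show "Farr G h \<in> hom_set A (o' b) (o' b')" "Farr F (Farr G h) = h' h"
      using lift[OF o o h'(2)[OF h]] F.cod.hom_objects[OF h] by (auto simp: G_def 1)
  qed
  \<comment> \<open>Naturality of \<open>\<epsilon>\<close>, available before \<open>G\<close> is
    known to be a functor; it is also what makes \<open>h'\<close> compatible with
    composition.\<close>
  have eh: "\<epsilon> b' \<cdot>\<^bsub>B\<^esub> h' h = h \<cdot>\<^bsub>B\<^esub> \<epsilon> b" if h: "h \<in> hom_set B b b'" for h b b'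
  proof -
    note b = F.cod.hom_objects[OF h]
    have he: "h \<cdot>\<^bsub>B\<^esub> \<epsilon> b \<in> hom_set B (Fobj F (o' b)) b'" using h e[OF b(1)] by blast
    then have "\<epsilon> b' \<cdot>\<^bsub>B\<^esub> h' h = (\<epsilon> b' \<cdot>\<^bsub>B\<^esub> \<delta> b') \<cdot>\<^bsub>B\<^esub> h \<cdot>\<^bsub>B\<^esub> \<epsilon> b"
      using F.cod.Comp_assoc[OF he d e] b h'(1)[OF h] by auto
    then show ?thesis using ed b he F.cod.Ident_Comp by auto
  qed
  have Gf: "cat_functor B A G"
  proof (intro cat_functor.intro F.dom.category_axioms F.cod.category_axioms, unfold_locales)
    show "Fobj G b \<in> Obj A" if "b \<in> Obj B" for b using o that by (simp add: G_def)
    show "Farr G f \<in> hom_set A (Fobj G a) (Fobj G b)" if "f \<in> hom_set B a b" for f a b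
      using G(1)[OF that] by (simp add: G_def)
    show "Farr G (Ident B b) = Ident A (Fobj G b)" if b: "b \<in> Obj B" for b
    proof (rule eq)
      note i = F.cod.Ident_in[OF b]
      show "Farr G (Ident B b) \<in> hom_set A (o' b) (o' b)" using G(1)[OF i] .
      show "Ident A (Fobj G b) \<in> hom_set A (o' b) (o' b)" using F.dom.Ident_in o b by (simp add: G_def)
      show "Farr F (Farr G (Ident B b)) = Farr F (Ident A (Fobj G b))"
        using G(2)[OF i] h'(1)[OF i] F.Farr_Ident[OF o[OF b]] de[OF b] F.cod.Ident_Comp[OF e[OF b]]
        by (simp add: G_def)
    qed
    show "Farr G (g \<cdot>\<^bsub>B\<^esub> f) = Farr G g \<cdot>\<^bsub>A\<^esub> Farr G f"
      if f: "f \<in> hom_set B a b" and g: "g \<in> hom_set B b c" for f g a b c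
    proof (rule eq)
      have gf: "g \<cdot>\<^bsub>B\<^esub> f \<in> hom_set B a c" using f g by blast
      note ab = F.cod.hom_objects[OF f] F.cod.hom_objects[OF g]
      show "Farr G (g \<cdot>\<^bsub>B\<^esub> f) \<in> hom_set A (o' a) (o' c)" using G(1)[OF gf] .
      show "Farr G g \<cdot>\<^bsub>A\<^esub> Farr G f \<in> hom_set A (o' a) (o' c)" using G(1)[OF f] G(1)[OF g] by blast
      have "h' g \<cdot>\<^bsub>B\<^esub> h' f = \<delta> c \<cdot>\<^bsub>B\<^esub> (g \<cdot>\<^bsub>B\<^esub> \<epsilon> b) \<cdot>\<^bsub>B\<^esub> h' f"
        using F.cod.Comp_assoc[OF h'(2)[OF f] F.cod.Comp_in[OF e g] d] ab h'(1)[OF g] by simp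
      also have "(g \<cdot>\<^bsub>B\<^esub> \<epsilon> b) \<cdot>\<^bsub>B\<^esub> h' f = g \<cdot>\<^bsub>B\<^esub> f \<cdot>\<^bsub>B\<^esub> \<epsilon> a"
        using F.cod.Comp_assoc[OF h'(2)[OF f] e g] eh[OF f] ab by simp
      also have "g \<cdot>\<^bsub>B\<^esub> f \<cdot>\<^bsub>B\<^esub> \<epsilon> a = (g \<cdot>\<^bsub>B\<^esub> f) \<cdot>\<^bsub>B\<^esub> \<epsilon> a"
        using F.cod.Comp_assoc[OF e f g] ab by simp
      finally have "h' g \<cdot>\<^bsub>B\<^esub> h' f = h' (g \<cdot>\<^bsub>B\<^esub> f)" using h'(1)[OF gf] by simp
      then show "Farr F (Farr G (g \<cdot>\<^bsub>B\<^esub> f)) = Farr F (Farr G g \<cdot>\<^bsub>A\<^esub> Farr G f)"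
        using F.Farr_Comp[OF G(1)[OF f] G(1)[OF g]] G(2)[OF f] G(2)[OF g] G(2)[OF gf] by simp
    qed
  qed
  have "naturally_isomorphic B B (comp_functor F G) id_functor"
    unfolding naturally_isomorphic_def natural_transformation_def
  proof (intro exI[of _ \<epsilon>] conjI ballI)
    show "\<epsilon> a \<in> hom_set B (Fobj (comp_functor F G) a) (Fobj id_functor a)" if "a \<in> Obj B" for a
      using e that by (simp add: comp_functor_def id_functor_def G_def)
    show "isomorphism B (\<epsilon> a)" if "a \<in> Obj B" for a
      using * that by (auto simp: isomorphism_def)
    show "\<epsilon> (Cod B f) \<cdot>\<^bsub>B\<^esub> Farr (comp_functor F G) f = Farr id_functor f \<cdot>\<^bsub>B\<^esub> \<epsilon> (Dom B f)"
      if "f \<in> Arr B" for f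
      using eh[OF F.cod.arr_hom[OF that]] G(2)[OF F.cod.arr_hom[OF that]]
      by (simp add: comp_functor_def id_functor_def)
  qed
  moreover have "naturally_isomorphic A A (comp_functor G F) id_functor"
    unfolding naturally_isomorphic_def natural_transformation_def
  proof (intro exI conjI ballI)
    let ?\<eta> = "\<lambda>a. lift (o' (Fobj F a)) a (\<epsilon> (Fobj F a))"
    let ?\<eta>' = "\<lambda>a. lift a (o' (Fobj F a)) (\<delta> (Fobj F a))"
    have n: "?\<eta> a \<in> hom_set A (o' (Fobj F a)) a" "Farr F (?\<eta> a) = \<epsilon> (Fobj F a)"
      "?\<eta>' a \<in> hom_set A a (o' (Fobj F a))" "Farr F (?\<eta>' a) = \<delta> (Fobj F a)" if "a \<in> Obj A" for a
      using lift[OF o that e] lift[OF that o d] F.Fobj_in[OF that] by auto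
    show "?\<eta> a \<in> hom_set A (Fobj (comp_functor G F) a) (Fobj id_functor a)" if "a \<in> Obj A" for a
      using n(1)[OF that] by (simp add: comp_functor_def id_functor_def G_def)
    show "isomorphism A (?\<eta> a)" if a: "a \<in> Obj A" for a
    proof -
      have oa: "o' (Fobj F a) \<in> Obj A" using o F.Fobj_in a by blast
      have "?\<eta> a \<cdot>\<^bsub>A\<^esub> ?\<eta>' a = Ident A a"
        by (rule eq[of _ a a]) (use n[OF a] a in \<open>auto simp: F.Farr_Comp[OF n(3) n(1)] F.Farr_Ident
            F.dom.Ident_in ed F.Fobj_in\<close>)
      moreover have "?\<eta>' a \<cdot>\<^bsub>A\<^esub> ?\<eta> a = Ident A (o' (Fobj F a))"
        by (rule eq[of _ "o' (Fobj F a)" "o' (Fobj F a)"]) (use n[OF a] a oa in \<open>auto simp: F.Farr_Comp[OF n(1) n(3)]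
            F.Farr_Ident F.dom.Ident_in de F.Fobj_in\<close>)
      ultimately show ?thesis
        using n[OF a] by (auto simp: isomorphism_def inverse_arrows_def hom_set_def)
    qed
    show "?\<eta> (Cod A f) \<cdot>\<^bsub>A\<^esub> Farr (comp_functor G F) f = Farr id_functor f \<cdot>\<^bsub>A\<^esub> ?\<eta> (Dom A f)"
      if f: "f \<in> Arr A" for f
    proof -
      let ?a = "Dom A f" and ?b = "Cod A f"
      have f: "f \<in> hom_set A ?a ?b" and ab: "?a \<in> Obj A" "?b \<in> Obj A"
        using f F.dom.arr_hom F.dom.Dom_in F.dom.Cod_in by auto
      note Ff = F.Farr_in[OF f]
      have "?\<eta> ?b \<cdot>\<^bsub>A\<^esub> Farr G (Farr F f) = f \<cdot>\<^bsub>A\<^esub> ?\<eta> ?a"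
      proof (rule eq)
        show "?\<eta> ?b \<cdot>\<^bsub>A\<^esub> Farr G (Farr F f) \<in> hom_set A (o' (Fobj F ?a)) ?b"
          using n(1)[OF ab(2)] G(1)[OF Ff] by blast
        show "f \<cdot>\<^bsub>A\<^esub> ?\<eta> ?a \<in> hom_set A (o' (Fobj F ?a)) ?b"
          using n(1)[OF ab(1)] f by blast
        show "Farr F (?\<eta> ?b \<cdot>\<^bsub>A\<^esub> Farr G (Farr F f)) = Farr F (f \<cdot>\<^bsub>A\<^esub> ?\<eta> ?a)"
          using F.Farr_Comp[OF G(1)[OF Ff] n(1)[OF ab(2)]] F.Farr_Comp[OF n(1)[OF ab(1)] f]
            n(2)[OF ab(1)] n(2)[OF ab(2)] G(2)[OF Ff] eh[OF Ff] by simp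
      qed
      then show ?thesis by (simp add: comp_functor_def id_functor_def)
    qed
  qed
  ultimately show ?thesis
    unfolding equivalence_functor_def using F Gf by blast
qed

section \<open>The category of small sets\<close>

lemma hom_set_Set_cat:
  "m \<in> hom_set Set_cat (X :: 'v set) Y \<longleftrightarrow> tdom m = X \<and> tcod m = Y \<and>
     small TYPE('v) X \<and> small TYPE('v) Y \<and> tmap m \<in> X \<rightarrow>\<^sub>E Y"
  by (cases m) (auto simp: hom_set_def Set_cat_def)

lemma Set_cat_simps [simp]:
  "Obj (Set_cat :: ('v set, _) cat) = {X. small TYPE('v) X}"
  "f \<in> Arr (Set_cat :: ('v set, _) cat) \<longleftrightarrow>
     small TYPE('v) (tdom f) \<and> small TYPE('v) (tcod f) \<and> tmap f \<in> tdom f \<rightarrow>\<^sub>E tcod f"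
  "Dom Set_cat = tdom" "Cod Set_cat = tcod"
  "Ident Set_cat X = TMap X (\<lambda>x\<in>X. x) X"
  "g \<cdot>\<^bsub>Set_cat\<^esub> f = TMap (tdom f) (compose (tdom f) (tmap g) (tmap f)) (tcod g)"
  by (simp_all add: Set_cat_def) (cases f, auto)

lemma category_Set_cat: "category (Set_cat :: ('v set, _) cat)"
proof (unfold_locales, goal_cases)
  case (4 f a b g c)
  then show ?case by (auto simp: hom_set_Set_cat compose_def dest: PiE_mem)
next
  case (7 f a b g c h d)
  then show ?case
    by (auto simp: hom_set_Set_cat fun_eq_iff compose_def dest!: PiE_mem[of "tmap f"])
next
  case (5 f a b)
  then show ?case by (cases f) (auto simp: hom_set_Set_cat compose_def fun_eq_iff PiE_def extensional_def)
next
  case (6 f a b)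
  then show ?case by (cases f) (auto simp: hom_set_Set_cat compose_def fun_eq_iff PiE_def extensional_def)
qed (auto simp: hom_set_Set_cat)

lemma isomorphism_Set_cat:
  assumes "m \<in> hom_set Set_cat X Y" "bij_betw (tmap m) X Y"
  shows "isomorphism Set_cat m"
proof -
  let ?n = "TMap Y (restrict (inv_into X (tmap m)) Y) X"
  have "?n \<in> hom_set Set_cat Y X"
    using assms by (auto simp: hom_set_Set_cat bij_betw_def inv_into_into)
  moreover have "?n \<cdot>\<^bsub>Set_cat\<^esub> m = Ident Set_cat X" "m \<cdot>\<^bsub>Set_cat\<^esub> ?n = Ident Set_cat Y"
    using assms by (auto simp: hom_set_Set_cat compose_inv_into_id compose_id_inv_into bij_betw_def)
  ultimately show ?thesis
    using assms(1) by (auto simp: isomorphism_def inverse_arrows_def hom_set_def intro!: exI[of _ ?n])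
qed

section \<open>Functor categories\<close>

lemma functor_cat_simps:
  "F \<in> Obj (functor_cat A B) \<longleftrightarrow>
     cat_functor A B F \<and> Fobj F \<in> extensional (Obj A) \<and> Farr F \<in> extensional (Arr A)"
  "Dom (functor_cat A B) = tdom" "Cod (functor_cat A B) = tcod"
  "Ident (functor_cat A B) F = TMap F (\<lambda>a\<in>Obj A. Ident B (Fobj F a)) F"
  "\<sigma> \<cdot>\<^bsub>functor_cat A B\<^esub> \<tau> = TMap (tdom \<tau>) (\<lambda>a\<in>Obj A. tmap \<sigma> a \<cdot>\<^bsub>B\<^esub> tmap \<tau> a) (tcod \<sigma>)"
  by (simp_all add: functor_cat_def Let_def)

lemma hom_set_functor_cat:
  "m \<in> hom_set (functor_cat A B) F G \<longleftrightarrow> tdom m = F \<and> tcod m = G \<and>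
     F \<in> Obj (functor_cat A B) \<and> G \<in> Obj (functor_cat A B) \<and>
     natural_transformation A B F G (tmap m) \<and> tmap m \<in> extensional (Obj A)"
  by (cases m) (auto simp: hom_set_def functor_cat_def Let_def)

lemma natural_transformation_comp:
  assumes "cat_functor A B F" "cat_functor A B G" "cat_functor A B H"
    and "natural_transformation A B F G \<tau>" "natural_transformation A B G H \<sigma>"
  shows "natural_transformation A B F H (\<lambda>a\<in>Obj A. \<sigma> a \<cdot>\<^bsub>B\<^esub> \<tau> a)"
proof -
  interpret F: cat_functor A B F by fact
  interpret G: cat_functor A B G by fact
  interpret H: cat_functor A B H by fact
  show ?thesis
    unfolding natural_transformation_def
  proof (intro conjI ballI)
    show "(\<lambda>a\<in>Obj A. \<sigma> a \<cdot>\<^bsub>B\<^esub> \<tau> a) a \<in> hom_set B (Fobj F a) (Fobj H a)" if "a \<in> Obj A" for a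
      using assms(4,5) that F.cod.Comp_in unfolding natural_transformation_def by auto
    fix f assume f: "f \<in> Arr A"
    let ?a = "Dom A f" and ?b = "Cod A f"
    have ab: "?a \<in> Obj A" "?b \<in> Obj A" and fh: "f \<in> hom_set A ?a ?b"
      using F.dom.Dom_in F.dom.Cod_in F.dom.arr_hom f by auto
    have t: "\<tau> a \<in> hom_set B (Fobj F a) (Fobj G a)" "\<sigma> a \<in> hom_set B (Fobj G a) (Fobj H a)"
      if "a \<in> Obj A" for a using assms(4,5) that unfolding natural_transformation_def by auto
    have n: "\<tau> ?b \<cdot>\<^bsub>B\<^esub> Farr F f = Farr G f \<cdot>\<^bsub>B\<^esub> \<tau> ?a" "\<sigma> ?b \<cdot>\<^bsub>B\<^esub> Farr G f = Farr H f \<cdot>\<^bsub>B\<^esub> \<sigma> ?a"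
      using assms(4,5) f unfolding natural_transformation_def by auto
    have "(\<sigma> ?b \<cdot>\<^bsub>B\<^esub> \<tau> ?b) \<cdot>\<^bsub>B\<^esub> Farr F f = \<sigma> ?b \<cdot>\<^bsub>B\<^esub> Farr G f \<cdot>\<^bsub>B\<^esub> \<tau> ?a"
      using F.cod.Comp_assoc[OF F.Farr_in[OF fh] t[OF ab(2)]] n(1) by simp
    also have "\<dots> = Farr H f \<cdot>\<^bsub>B\<^esub> \<sigma> ?a \<cdot>\<^bsub>B\<^esub> \<tau> ?a"
      using F.cod.Comp_assoc[OF t(1)[OF ab(1)] G.Farr_in[OF fh] t(2)[OF ab(2)]]
        F.cod.Comp_assoc[OF t[OF ab(1)] H.Farr_in[OF fh]] n(2) by simp
    finally show "(\<lambda>a\<in>Obj A. \<sigma> a \<cdot>\<^bsub>B\<^esub> \<tau> a) ?b \<cdot>\<^bsub>B\<^esub> Farr F f = Farr H f \<cdot>\<^bsub>B\<^esub> (\<lambda>a\<in>Obj A. \<sigma> a \<cdot>\<^bsub>B\<^esub> \<tau> a) ?a"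
      using ab by simp
  qed
qed

lemma natural_transformation_Ident:
  assumes "cat_functor A B F"
  shows "natural_transformation A B F F (\<lambda>a\<in>Obj A. Ident B (Fobj F a))"
proof -
  interpret F: cat_functor A B F by fact
  show ?thesis
    using F.cod.Ident_in F.Fobj_in F.Farr_in F.dom.arr_hom F.dom.Dom_in F.dom.Cod_in
      F.cod.Comp_Ident F.cod.Ident_Comp
    by (fastforce simp: natural_transformation_def)
qed

lemma category_functor_cat:
  assumes A: "category A" and B: "category B"
  shows "category (functor_cat A B)"
proof -
  interpret A: category A by fact
  interpret B: category B by fact
  show ?thesis
  proof (unfold_locales, goal_cases)
    case (1 f) then show ?case by (auto simp: functor_cat_def Let_def)
  next
    case (2 f) then show ?case by (auto simp: functor_cat_def Let_def)
  next
    case (3 F)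
    then show ?case
      by (auto simp: hom_set_functor_cat functor_cat_simps natural_transformation_Ident)
  next
    case (4 f F G g H)
    then show ?case
      by (auto simp: hom_set_functor_cat functor_cat_simps natural_transformation_comp)
  next
    case (5 f F G)
    then have "tmap f a \<cdot>\<^bsub>B\<^esub> Ident B (Fobj F a) = tmap f a" if "a \<in> Obj A" for a
      using that B.Comp_Ident by (auto simp: hom_set_functor_cat natural_transformation_def)
    with 5 show ?case
      by (cases f) (auto simp: hom_set_functor_cat functor_cat_simps fun_eq_iff extensional_def)
  next
    case (6 f F G)
    then have "Ident B (Fobj G a) \<cdot>\<^bsub>B\<^esub> tmap f a = tmap f a" if "a \<in> Obj A" for a
      using that B.Ident_Comp by (auto simp: hom_set_functor_cat natural_transformation_def)
    with 6 show ?case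
      by (cases f) (auto simp: hom_set_functor_cat functor_cat_simps fun_eq_iff extensional_def)
  next
    case (7 f F G g H h K)
    then have "(tmap h a \<cdot>\<^bsub>B\<^esub> tmap g a) \<cdot>\<^bsub>B\<^esub> tmap f a = tmap h a \<cdot>\<^bsub>B\<^esub> tmap g a \<cdot>\<^bsub>B\<^esub> tmap f a"
      if "a \<in> Obj A" for a
      using 7 that by (intro B.Comp_assoc[of _ "Fobj F a" "Fobj G a" _ "Fobj H a" _ "Fobj K a"])
        (auto simp: hom_set_functor_cat natural_transformation_def)
    with 7 show ?case
      by (auto simp: hom_set_functor_cat functor_cat_simps fun_eq_iff)
  qed
qed

text \<open>Componentwise inverses are natural: cancel the components of \<open>m\<close> on both
  sides of its naturality square. The inverse is exposed so that
  \<open>inverse_arrows_full_subcat\<close> can carry it into the full subcategory of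
  sheaves.\<close>

lemma isomorphism_functor_cat:
  assumes m: "m \<in> hom_set (functor_cat A B) F G" and iso: "\<And>a. a \<in> Obj A \<Longrightarrow> isomorphism B (tmap m a)"
  shows "\<exists>n. inverse_arrows (functor_cat A B) m n"
proof -
  have mA: "m \<in> Arr (functor_cat A B)" using m by (simp add: hom_set_def)
  interpret F: cat_functor A B F using m by (simp add: hom_set_functor_cat functor_cat_simps)
  interpret G: cat_functor A B G using m by (simp add: hom_set_functor_cat functor_cat_simps)
  have \<tau>: "tmap m a \<in> hom_set B (Fobj F a) (Fobj G a)" if "a \<in> Obj A" for a
    using m that by (simp add: hom_set_functor_cat natural_transformation_def)
  obtain \<sigma> where "\<And>a. a \<in> Obj A \<Longrightarrow> inverse_arrows B (tmap m a) (\<sigma> a)"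
    using iso unfolding isomorphism_def by metis
  then have \<sigma>: "\<sigma> a \<in> hom_set B (Fobj G a) (Fobj F a)" "\<sigma> a \<cdot>\<^bsub>B\<^esub> tmap m a = Ident B (Fobj F a)"
    "tmap m a \<cdot>\<^bsub>B\<^esub> \<sigma> a = Ident B (Fobj G a)" if "a \<in> Obj A" for a
    using that \<tau>[OF that] by (auto simp: inverse_arrows_def hom_set_def)
  have "natural_transformation A B G F (restrict \<sigma> (Obj A))"
    unfolding natural_transformation_def
  proof (intro conjI ballI)
    fix f assume f: "f \<in> Arr A"
    let ?a = "Dom A f" and ?b = "Cod A f"
    have ab: "?a \<in> Obj A" "?b \<in> Obj A" and fh: "f \<in> hom_set A ?a ?b"
      using F.dom.Dom_in F.dom.Cod_in F.dom.arr_hom f by auto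
    note Ff = F.Farr_in[OF fh] and Gf = G.Farr_in[OF fh]
    have n: "tmap m ?b \<cdot>\<^bsub>B\<^esub> Farr F f = Farr G f \<cdot>\<^bsub>B\<^esub> tmap m ?a"
      using m f by (simp add: hom_set_functor_cat natural_transformation_def)
    have "\<sigma> ?b \<cdot>\<^bsub>B\<^esub> Farr G f = \<sigma> ?b \<cdot>\<^bsub>B\<^esub> Farr G f \<cdot>\<^bsub>B\<^esub> tmap m ?a \<cdot>\<^bsub>B\<^esub> \<sigma> ?a"
      using F.cod.Comp_Ident[OF Gf] \<sigma>(3)[OF ab(1)] by simp
    also have "\<dots> = \<sigma> ?b \<cdot>\<^bsub>B\<^esub> (Farr G f \<cdot>\<^bsub>B\<^esub> tmap m ?a) \<cdot>\<^bsub>B\<^esub> \<sigma> ?a"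
      using F.cod.Comp_assoc[OF \<sigma>(1)[OF ab(1)] \<tau>[OF ab(1)] Gf] by simp
    also have "\<dots> = \<sigma> ?b \<cdot>\<^bsub>B\<^esub> tmap m ?b \<cdot>\<^bsub>B\<^esub> Farr F f \<cdot>\<^bsub>B\<^esub> \<sigma> ?a"
      using n F.cod.Comp_assoc[OF \<sigma>(1)[OF ab(1)] Ff \<tau>[OF ab(2)]] by simp
    also have "\<dots> = (\<sigma> ?b \<cdot>\<^bsub>B\<^esub> tmap m ?b) \<cdot>\<^bsub>B\<^esub> Farr F f \<cdot>\<^bsub>B\<^esub> \<sigma> ?a"
      using F.cod.Comp_assoc[OF F.cod.Comp_in[OF \<sigma>(1)[OF ab(1)] Ff] \<tau>[OF ab(2)] \<sigma>(1)[OF ab(2)]] by simp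
    also have "\<dots> = Farr F f \<cdot>\<^bsub>B\<^esub> \<sigma> ?a"
      using \<sigma>(2)[OF ab(2)] F.cod.Ident_Comp[OF F.cod.Comp_in[OF \<sigma>(1)[OF ab(1)] Ff]] by simp
    finally show "restrict \<sigma> (Obj A) ?b \<cdot>\<^bsub>B\<^esub> Farr G f = Farr F f \<cdot>\<^bsub>B\<^esub> restrict \<sigma> (Obj A) ?a"
      using ab by simp
  qed (use \<sigma> in simp)
  then have n: "TMap G (restrict \<sigma> (Obj A)) F \<in> hom_set (functor_cat A B) G F"
    using m by (simp add: hom_set_functor_cat)
  then have "inverse_arrows (functor_cat A B) m (TMap G (restrict \<sigma> (Obj A)) F)"
    using m mA \<sigma> by (auto simp: inverse_arrows_def functor_cat_simps hom_set_functor_cat fun_eq_iff)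
  then show ?thesis by blast
qed

section \<open>Small sets\<close>

lemma small_mono: "small v B \<Longrightarrow> A \<subseteq> B \<Longrightarrow> small v A"
  unfolding small_def using lesspoll_trans1 subset_imp_lepoll by blast

lemma small_image: "small v A \<Longrightarrow> small v (f ` A)"
  unfolding small_def using lesspoll_trans1 image_lepoll by blast

text \<open>Any two cardinals are comparable, so failing to be smaller than \<open>'v\<close> means
  containing a copy of it.\<close>

lemma not_small_iff_lepoll: "\<not> small TYPE('v) A \<longleftrightarrow> (UNIV :: 'v set) \<lesssim> A"
proof
  assume "\<not> small TYPE('v) A"
  then have "\<not> A \<lesssim> (UNIV :: 'v set) \<or> A \<approx> (UNIV :: 'v set)"
    by (auto simp: small_def lesspoll_def)
  then show "(UNIV :: 'v set) \<lesssim> A"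
    using ordLeq_total[OF card_of_Well_order card_of_Well_order, of A "UNIV :: 'v set"]
      eqpoll_imp_lepoll[OF eqpoll_sym]
    unfolding card_of_ordLeq[symmetric] lepoll_def by blast
next
  assume "(UNIV :: 'v set) \<lesssim> A"
  then show "\<not> small TYPE('v) A"
    unfolding small_def by (meson lesspoll_trans2 lesspoll_not_refl)
qed

text \<open>The regularity in \<open>set_universe\<close> speaks of subsets of \<open>'v\<close>
  only, while indices and members here have arbitrary types. A large union receives an injection
  \<open>j\<close> from \<open>'v\<close>, and the preimages of the members under \<open>j\<close>
  would cover \<open>'v\<close> by a small family of small sets.\<close>

lemma small_UN:
  fixes A :: "'i \<Rightarrow> 'x set"
  assumes v: "set_universe TYPE('v)" and I: "small TYPE('v) I"
    and A: "\<And>i. i \<in> I \<Longrightarrow> small TYPE('v) (A i)"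
  shows "small TYPE('v) (\<Union>i\<in>I. A i)"
proof (rule ccontr)
  assume "\<not> small TYPE('v) (\<Union>i\<in>I. A i)"
  then obtain j :: "'v \<Rightarrow> 'x" where j: "inj j" "range j \<subseteq> (\<Union>i\<in>I. A i)"
    unfolding not_small_iff_lepoll lepoll_def by blast
  have "small TYPE('v) (j -` A i)" if "i \<in> I" for i
  proof -
    have "j -` A i \<lesssim> A i"
      unfolding lepoll_def using j(1) by (intro exI[of _ j]) (auto intro: inj_on_subset)
    then show ?thesis using A[OF that] unfolding small_def by (rule lesspoll_trans1)
  qed
  moreover have "small TYPE('v) ((\<lambda>i. j -` A i) ` I)"
    using I by (rule small_image)
  ultimately have "small TYPE('v) (\<Union>((\<lambda>i. j -` A i) ` I))"
    using v unfolding set_universe_def small_def by blast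
  moreover have "\<Union>((\<lambda>i. j -` A i) ` I) = (UNIV :: 'v set)"
    using j(2) by blast
  ultimately show False by (simp add: small_def)
qed

text \<open>The classes of a small set form a small set, so they can be named by elements of
  \<open>'v\<close>. This is how a colimit becomes the underlying set of an action.\<close>

lemma small_quotient_map:
  assumes "small TYPE('v) A" "equiv A r"
  shows "\<exists>q :: 'x \<Rightarrow> 'v. \<forall>s\<in>A. \<forall>t\<in>A. q s = q t \<longleftrightarrow> (s, t) \<in> r"
proof -
  have "small TYPE('v) ((\<lambda>s. r `` {s}) ` A)"
    using assms(1) by (rule small_image)
  then obtain j :: "'x set \<Rightarrow> 'v" where "inj_on j ((\<lambda>s. r `` {s}) ` A)"
    unfolding small_def lesspoll_def lepoll_def by blast
  then have "j (r `` {s}) = j (r `` {t}) \<longleftrightarrow> (s, t) \<in> r" if "s \<in> A" "t \<in> A" for s t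
    using that eq_equiv_class_iff[OF assms(2)] by (metis (no_types, lifting) image_eqI inj_onD)
  then show ?thesis by (intro exI[of _ "\<lambda>s. j (r `` {s})"]) blast
qed

section \<open>Sheaves for the atomic topology\<close>

lemma
  assumes P: "cat_functor A Set_cat P"
  shows Farr_Set_in: "f \<in> hom_set A a b \<Longrightarrow> y \<in> Fobj P a \<Longrightarrow> tmap (Farr P f) y \<in> Fobj P b"
    and Farr_Set_Ident: "a \<in> Obj A \<Longrightarrow> y \<in> Fobj P a \<Longrightarrow> tmap (Farr P (Ident A a)) y = y"
    and Farr_Set_Comp: "f \<in> hom_set A a b \<Longrightarrow> g \<in> hom_set A b c \<Longrightarrow> y \<in> Fobj P a \<Longrightarrow>
      tmap (Farr P (g \<cdot>\<^bsub>A\<^esub> f)) y = tmap (Farr P g) (tmap (Farr P f) y)"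
proof -
  interpret P: cat_functor A Set_cat P by fact
  show "f \<in> hom_set A a b \<Longrightarrow> y \<in> Fobj P a \<Longrightarrow> tmap (Farr P f) y \<in> Fobj P b"
    using P.Farr_in by (auto simp: hom_set_Set_cat)
  show "a \<in> Obj A \<Longrightarrow> y \<in> Fobj P a \<Longrightarrow> tmap (Farr P (Ident A a)) y = y"
    using P.Farr_Ident by auto
  show "f \<in> hom_set A a b \<Longrightarrow> g \<in> hom_set A b c \<Longrightarrow> y \<in> Fobj P a \<Longrightarrow>
      tmap (Farr P (g \<cdot>\<^bsub>A\<^esub> f)) y = tmap (Farr P g) (tmap (Farr P f) y)"
    using P.Farr_Comp P.Farr_in[of f a b] by (auto simp: hom_set_Set_cat compose_def)
qed

text \<open>
  A covering sieve of \<open>op_cat C\<close> contains the one generated by any of its members \<open>f\<close>, and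
  amalgamation makes the value of a matching family at \<open>f\<close> determine all its other values.
\<close>
lemma is_sheaf_atomic_iff:
  assumes C: "category C" and amalg: "amalgamation_property C" and P: "cat_functor C Set_cat P"
  shows "is_sheaf (op_cat C) (atomic_topology (op_cat C)) P \<longleftrightarrow>
    (\<forall>f\<in>Arr C. \<forall>z\<in>Fobj P (Cod C f).
       (\<forall>x\<in>Obj C. \<forall>h\<in>hom_set C (Cod C f) x. \<forall>k\<in>hom_set C (Cod C f) x.
          h \<cdot>\<^bsub>C\<^esub> f = k \<cdot>\<^bsub>C\<^esub> f \<longrightarrow> tmap (Farr P h) z = tmap (Farr P k) z) \<longrightarrow>
       (\<exists>!y. y \<in> Fobj P (Dom C f) \<and> tmap (Farr P f) y = z))" (is "?sheaf \<longleftrightarrow> ?strict")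
proof
  interpret category C by fact
  assume sheaf: ?sheaf
  show ?strict
  proof (intro ballI impI)
    fix f z
    assume f: "f \<in> Arr C" and z: "z \<in> Fobj P (Cod C f)"
      and eq: "\<forall>x\<in>Obj C. \<forall>h\<in>hom_set C (Cod C f) x. \<forall>k\<in>hom_set C (Cod C f) x.
          h \<cdot>\<^bsub>C\<^esub> f = k \<cdot>\<^bsub>C\<^esub> f \<longrightarrow> tmap (Farr P h) z = tmap (Farr P k) z"
    note f' = arr_hom[OF f]
    \<comment> \<open>The sieve of \<open>op_cat C\<close> generated by \<open>f\<close>, and the
      family sending a composite of \<open>h\<close> with \<open>f\<close> to the image of
      \<open>z\<close> under \<open>h\<close>. An element of \<open>R\<close> may factor through
      \<open>f\<close> in several ways; \<open>eq\<close> makes the choice harmless.\<close>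
    define R where "R = {h \<cdot>\<^bsub>C\<^esub> f | h. h \<in> Arr C \<and> Dom C h = Cod C f}"
    define x where "x g = tmap (Farr P (SOME h. h \<in> Arr C \<and> Dom C h = Cod C f \<and> g = h \<cdot>\<^bsub>C\<^esub> f)) z" for g
    have hf: "h \<cdot>\<^bsub>C\<^esub> f \<in> hom_set C (Dom C f) (Cod C h)" if "h \<in> Arr C" "Dom C h = Cod C f" for h
      using Comp_in[OF f', of h "Cod C h"] that by (simp add: hom_set_def)
    have x: "x (h \<cdot>\<^bsub>C\<^esub> f) = tmap (Farr P h) z" if h: "h \<in> Arr C" "Dom C h = Cod C f" for h
    proof -
      let ?h = "SOME h'. h' \<in> Arr C \<and> Dom C h' = Cod C f \<and> h \<cdot>\<^bsub>C\<^esub> f = h' \<cdot>\<^bsub>C\<^esub> f"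
      have *: "?h \<in> Arr C \<and> Dom C ?h = Cod C f \<and> h \<cdot>\<^bsub>C\<^esub> f = ?h \<cdot>\<^bsub>C\<^esub> f"
        by (rule someI[of _ h]) (use h in simp)
      \<comment> \<open>Equal composites have equal codomains, so the selected factor is parallel to
        \<open>h\<close>, as \<open>eq\<close> requires.\<close>
      then have "Cod C ?h = Cod C h"
        using hf[OF h] hf[of ?h] by (auto simp: hom_set_def)
      then show ?thesis
        using * eq[rule_format, of "Cod C h" ?h h] h Cod_in by (auto simp: x_def hom_set_def)
    qed
    have ff: "f = Ident C (Cod C f) \<cdot>\<^bsub>C\<^esub> f" using Ident_Comp[OF f'] by simp
    have id: "Ident C (Cod C f) \<in> Arr C" "Dom C (Ident C (Cod C f)) = Cod C f"
      using Ident_in[OF Cod_in[OF f]] by (auto simp: hom_set_def)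
    have "f \<in> R" using ff id unfolding R_def by blast
    have xf: "x f = z"
      using x[OF id] ff Farr_Set_Ident[OF P Cod_in[OF f] z] by simp
    have assoc: "g \<cdot>\<^bsub>C\<^esub> h \<cdot>\<^bsub>C\<^esub> f = (g \<cdot>\<^bsub>C\<^esub> h) \<cdot>\<^bsub>C\<^esub> f" "g \<cdot>\<^bsub>C\<^esub> h \<in> Arr C" "Dom C (g \<cdot>\<^bsub>C\<^esub> h) = Cod C f"
      "Cod C (g \<cdot>\<^bsub>C\<^esub> h) = Cod C g"
      if "h \<in> Arr C" "Dom C h = Cod C f" "g \<in> Arr C" "Dom C g = Cod C h" for g h
      using Comp_assoc[OF f', of h "Cod C h" g "Cod C g"] Comp_in[of h "Cod C f" "Cod C h" g "Cod C g"] that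
      by (auto simp: hom_set_def)
    have "sieve (op_cat C) (Dom C f) R"
      unfolding sieve_def
    proof (intro conjI ballI impI)
      show "R \<subseteq> {g \<in> Arr (op_cat C). Cod (op_cat C) g = Dom C f}"
        using hf by (auto simp: R_def hom_set_def)
      fix k g assume "k \<in> R" and g: "g \<in> Arr (op_cat C)" "Cod (op_cat C) g = Dom (op_cat C) k"
      then obtain h where h: "k = h \<cdot>\<^bsub>C\<^esub> f" "h \<in> Arr C" "Dom C h = Cod C f" by (auto simp: R_def)
      then have "g \<in> Arr C" "Dom C g = Cod C h" using g hf[of h] by (auto simp: hom_set_def)
      then show "k \<cdot>\<^bsub>op_cat C\<^esub> g \<in> R"
        using assoc[OF h(2,3)] by (auto simp: R_def h(1))
    qed
    then have cover: "R \<in> atomic_topology (op_cat C) (Dom C f)"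
      using \<open>f \<in> R\<close> by (auto simp: atomic_topology_def)
    have "matching_family (op_cat C) P R x"
      unfolding matching_family_def
    proof (intro conjI ballI impI)
      fix k assume "k \<in> R"
      then obtain h where h: "k = h \<cdot>\<^bsub>C\<^esub> f" "h \<in> Arr C" "Dom C h = Cod C f" by (auto simp: R_def)
      have h': "h \<in> hom_set C (Cod C f) (Cod C h)" using h by (simp add: hom_set_def)
      have k: "Cod C k = Cod C h" using hf[OF h(2,3)] h(1) by (simp add: hom_set_def)
      show "x k \<in> Fobj P (Dom (op_cat C) k)"
        using Farr_Set_in[OF P h' z] x[OF h(2,3)] h(1) k by simp
      fix g assume g: "g \<in> Arr (op_cat C)" "Cod (op_cat C) g = Dom (op_cat C) k"
      then have g': "g \<in> Arr C" "Dom C g = Cod C h" using k by auto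
      then have "g \<in> hom_set C (Cod C h) (Cod C g)" by (simp add: hom_set_def)
      then show "tmap (Farr P g) (x k) = x (k \<cdot>\<^bsub>op_cat C\<^esub> g)"
        using x[OF h(2,3)] h(1) assoc[OF h(2,3) g'] x[OF assoc(2,3)[OF h(2,3) g']]
          Farr_Set_Comp[OF P h' _ z] by simp
    qed
    then have ex: "\<exists>!y. y \<in> Fobj P (Dom C f) \<and> (\<forall>g\<in>R. tmap (Farr P g) y = x g)"
      using sheaf cover Dom_in[OF f] unfolding is_sheaf_def by simp
    have "(\<forall>g\<in>R. tmap (Farr P g) y = x g) \<longleftrightarrow> tmap (Farr P f) y = z" if y: "y \<in> Fobj P (Dom C f)" for y
    proof
      show "tmap (Farr P f) y = z" if "\<forall>g\<in>R. tmap (Farr P g) y = x g"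
        using that \<open>f \<in> R\<close> xf by auto
      show "\<forall>g\<in>R. tmap (Farr P g) y = x g" if "tmap (Farr P f) y = z"
      proof
        fix k assume "k \<in> R"
        then obtain h where h: "k = h \<cdot>\<^bsub>C\<^esub> f" "h \<in> Arr C" "Dom C h = Cod C f" by (auto simp: R_def)
        then have "h \<in> hom_set C (Cod C f) (Cod C h)" by (simp add: hom_set_def)
        then show "tmap (Farr P k) y = x k"
          using Farr_Set_Comp[OF P f' _ y] x[OF h(2,3)] h(1) that by simp
      qed
    qed
    then show "\<exists>!y. y \<in> Fobj P (Dom C f) \<and> tmap (Farr P f) y = z"
      using ex by (simp cong: conj_cong)
  qed
next
  interpret category C by fact
  assume strict: ?strict
  \<comment> \<open>The transition maps of \<open>P\<close> are injective: the image of
    \<open>w\<close> under \<open>h\<close> meets the premise of the strictness condition because it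
    comes from \<open>w\<close>, and the uniqueness clause then applies.\<close>
  have inj: "w = w'" if h: "h \<in> hom_set C a b" and w: "w \<in> Fobj P a" "w' \<in> Fobj P a"
    and eq: "tmap (Farr P h) w = tmap (Farr P h) w'" for h a b w w'
  proof -
    have ab: "h \<in> Arr C" "Dom C h = a" "Cod C h = b" using h by (auto simp: hom_set_def)
    have "tmap (Farr P k) (tmap (Farr P h) w) = tmap (Farr P k') (tmap (Farr P h) w)"
      if "k \<in> hom_set C b x" "k' \<in> hom_set C b x" "k \<cdot>\<^bsub>C\<^esub> h = k' \<cdot>\<^bsub>C\<^esub> h" for x k k'
      using Farr_Set_Comp[OF P h that(1) w(1)] Farr_Set_Comp[OF P h that(2) w(1)] that(3) by simp
    then have "\<forall>x\<in>Obj C. \<forall>k\<in>hom_set C b x. \<forall>k'\<in>hom_set C b x. k \<cdot>\<^bsub>C\<^esub> h = k' \<cdot>\<^bsub>C\<^esub> h \<longrightarrow>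
        tmap (Farr P k) (tmap (Farr P h) w) = tmap (Farr P k') (tmap (Farr P h) w)"
      by blast
    then have "\<exists>!y. y \<in> Fobj P a \<and> tmap (Farr P h) y = tmap (Farr P h) w"
      using bspec[OF bspec[OF strict ab(1)], unfolded ab(2,3), OF Farr_Set_in[OF P h w(1)]] by (rule mp[rotated])
    then show ?thesis using w eq by metis
  qed
  show ?sheaf
    unfolding is_sheaf_def
  proof (intro ballI allI impI)
    fix c R x
    assume "R \<in> atomic_topology (op_cat C) c" and x: "matching_family (op_cat C) P R x"
    then obtain f where f: "f \<in> R" and R: "\<And>g. g \<in> R \<Longrightarrow> g \<in> hom_set C c (Cod C g)"
      by (auto simp: atomic_topology_def sieve_def hom_set_def)
    have xin: "x g \<in> Fobj P (Cod C g)" if "g \<in> R" for g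
      using x that by (auto simp: matching_family_def)
    have xeq: "tmap (Farr P h) (x g) = x (h \<cdot>\<^bsub>C\<^esub> g)" if "g \<in> R" "h \<in> hom_set C (Cod C g) d" for g h d
      using x that by (auto simp: matching_family_def hom_set_def)
    have fA: "f \<in> Arr C" "Dom C f = c" using R[OF f] by (auto simp: hom_set_def)
    have "\<forall>y\<in>Obj C. \<forall>h\<in>hom_set C (Cod C f) y. \<forall>k\<in>hom_set C (Cod C f) y. h \<cdot>\<^bsub>C\<^esub> f = k \<cdot>\<^bsub>C\<^esub> f \<longrightarrow>
        tmap (Farr P h) (x f) = tmap (Farr P k) (x f)"
      using xeq[OF f] by simp
    then have "\<exists>!y. y \<in> Fobj P c \<and> tmap (Farr P f) y = x f"
      using bspec[OF bspec[OF strict fA(1)], unfolded fA(2), OF xin[OF f]] by (rule mp[rotated])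
    moreover have "tmap (Farr P g) y = x g" if y: "y \<in> Fobj P c" "tmap (Farr P f) y = x f" and g: "g \<in> R" for y g
    proof -
      \<comment> \<open>The value at \<open>f\<close> determines the value at \<open>g\<close>:
        compare both at an amalgam \<open>d\<close> and cancel \<open>k\<close> by
        injectivity.\<close>
      have "c \<in> Obj C" "Cod C f \<in> Obj C" "Cod C g \<in> Obj C"
        using R[OF f] R[OF g] by (auto dest: hom_objects)
      then obtain d h k where hk: "h \<in> hom_set C (Cod C f) d" "k \<in> hom_set C (Cod C g) d"
        "h \<cdot>\<^bsub>C\<^esub> f = k \<cdot>\<^bsub>C\<^esub> g"
        using amalg R[OF f] R[OF g] unfolding amalgamation_property_def by meson
      have "tmap (Farr P k) (tmap (Farr P g) y) = tmap (Farr P h) (tmap (Farr P f) y)"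
        using Farr_Set_Comp[OF P R[OF f] hk(1) y(1)] Farr_Set_Comp[OF P R[OF g] hk(2) y(1)] hk(3) by simp
      also have "\<dots> = tmap (Farr P k) (x g)"
        using xeq[OF f hk(1)] xeq[OF g hk(2)] hk(3) y(2) by simp
      finally show ?thesis
        using inj[OF hk(2) Farr_Set_in[OF P R[OF g] y(1)] xin[OF g]] by simp
    qed
    ultimately show "\<exists>!y. y \<in> Fobj P c \<and> (\<forall>g\<in>R. tmap (Farr P g) y = x g)"
      using f by metis
  qed
qed

section \<open>The nerve of a functor\<close>

text \<open>
  The hom sets of \<open>E\<close> are made into sets of elements of \<open>'v\<close> by an encoding \<open>e\<close>.
\<close>
locale encoded_nerve = cat_functor S E F
  for S :: "('o, 'a) cat" and E :: "('p, 'b) cat" and F +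
  fixes e :: "'p \<Rightarrow> 'o \<Rightarrow> 'b \<Rightarrow> 'v"
  assumes inj_e: "\<lbrakk>X \<in> Obj E; c \<in> Obj S\<rbrakk> \<Longrightarrow> inj_on (e X c) (hom_set E (Fobj F c) X)"
    and small_e: "\<lbrakk>X \<in> Obj E; c \<in> Obj S\<rbrakk> \<Longrightarrow> small TYPE('v) (e X c ` hom_set E (Fobj F c) X)"
begin

abbreviation "K X c \<equiv> hom_set E (Fobj F c) X"
abbreviation "eK X c \<equiv> e X c ` K X c"

definition decode :: "'p \<Rightarrow> 'o \<Rightarrow> 'v \<Rightarrow> 'b" where
  "decode X c = inv_into (K X c) (e X c)"

text \<open>Both fields are restricted because objects of \<open>functor_cat\<close> are
  extensional.\<close>

definition nerve_presheaf :: "'p \<Rightarrow> ('o, 'a, 'v) presheaf" where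
  "nerve_presheaf X = \<lparr>Fobj = (\<lambda>c\<in>Obj S. eK X c),
     Farr = (\<lambda>f\<in>Arr S. TMap (eK X (Cod S f))
       (\<lambda>x\<in>eK X (Cod S f). e X (Dom S f) (decode X (Cod S f) x \<cdot>\<^bsub>E\<^esub> Farr F f)) (eK X (Dom S f)))\<rparr>"

definition nerve ::
  "('p, 'b, ('o, 'a, 'v) presheaf,
     (('o, 'a, 'v) presheaf, 'o \<Rightarrow> ('v set, 'v \<Rightarrow> 'v) tagged_map) tagged_map) cfunctor" where
  "nerve = \<lparr>Fobj = nerve_presheaf,
     Farr = (\<lambda>h. TMap (nerve_presheaf (Dom E h))
       (\<lambda>c\<in>Obj S. TMap (eK (Dom E h) c)
          (\<lambda>x\<in>eK (Dom E h) c. e (Cod E h) c (h \<cdot>\<^bsub>E\<^esub> decode (Dom E h) c x)) (eK (Cod E h) c))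
       (nerve_presheaf (Cod E h)))\<rparr>"

lemma decode_e [simp]: "\<lbrakk>X \<in> Obj E; c \<in> Obj S; m \<in> K X c\<rbrakk> \<Longrightarrow> decode X c (e X c m) = m"
  by (simp add: decode_def inj_e)

lemma decode_in: "x \<in> eK X c \<Longrightarrow> decode X c x \<in> K X c" "x \<in> eK X c \<Longrightarrow> e X c (decode X c x) = x"
  by (auto simp: decode_def inv_into_into f_inv_into_f)

lemma e_eq_iff:
  "\<lbrakk>X \<in> Obj E; c \<in> Obj S; m \<in> K X c; m' \<in> K X c\<rbrakk> \<Longrightarrow> e X c m = e X c m' \<longleftrightarrow> m = m'"
  using inj_e by (auto simp: inj_on_def)

lemma K_precomp:
  assumes "f \<in> hom_set S d c" "m \<in> K X c" shows "m \<cdot>\<^bsub>E\<^esub> Farr F f \<in> K X d"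
  using assms Farr_in cod.Comp_in by blast

lemma Fobj_nerve_presheaf [simp]: "c \<in> Obj S \<Longrightarrow> Fobj (nerve_presheaf X) c = eK X c"
  by (simp add: nerve_presheaf_def)

lemma Farr_nerve_presheaf:
  assumes "X \<in> Obj E" "f \<in> hom_set S d c" "m \<in> K X c"
  shows "tmap (Farr (nerve_presheaf X) f) (e X c m) = e X d (m \<cdot>\<^bsub>E\<^esub> Farr F f)"
  using assms dom.hom_objects[OF assms(2)] by (auto simp: nerve_presheaf_def hom_set_def)

lemma Farr_nerve_presheaf_in:
  assumes "X \<in> Obj E" "f \<in> hom_set S d c"
  shows "Farr (nerve_presheaf X) f \<in> hom_set Set_cat (eK X c) (eK X d)"
proof -
  have f: "Dom S f = d" "Cod S f = c" "f \<in> Arr S" and cd: "c \<in> Obj S" "d \<in> Obj S"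
    using assms(2) dom.hom_objects[OF assms(2)] by (auto simp: hom_set_def)
  show ?thesis
    using K_precomp[OF assms(2) decode_in(1)] small_e assms(1) cd
    by (auto simp: hom_set_Set_cat nerve_presheaf_def f decode_e intro!: imageI K_precomp[OF assms(2)])
qed

lemma Set_map_eqI:
  assumes "m \<in> hom_set Set_cat X Y" "m' \<in> hom_set Set_cat X Y" "\<And>x. x \<in> X \<Longrightarrow> tmap m x = tmap m' x"
  shows "m = m'"
  using assms by (intro tagged_map.expand) (auto simp: hom_set_Set_cat intro: PiE_ext)

lemma nerve_presheaf_functor:
  assumes X: "X \<in> Obj E"
  shows "cat_functor (op_cat S) Set_cat (nerve_presheaf X)"
proof (intro cat_functor.intro category_Set_cat dom.category_op_cat, unfold_locales)
  interpret Set_cat: category "Set_cat :: ('v set, _) cat" by (rule category_Set_cat)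
  show "Fobj (nerve_presheaf X) a \<in> Obj Set_cat" if "a \<in> Obj (op_cat S)" for a
    using that small_e[OF X] by simp
  show "Farr (nerve_presheaf X) f \<in> hom_set Set_cat (Fobj (nerve_presheaf X) a) (Fobj (nerve_presheaf X) b)"
    if "f \<in> hom_set (op_cat S) a b" for f a b
    using that Farr_nerve_presheaf_in[OF X, of f b a] dom.hom_objects[of f b a] by simp
  show "Farr (nerve_presheaf X) (Ident (op_cat S) a) = Ident Set_cat (Fobj (nerve_presheaf X) a)"
    if "a \<in> Obj (op_cat S)" for a
  proof (rule Set_map_eqI)
    have a: "a \<in> Obj S" using that by simp
    note i = dom.Ident_in[OF a]
    show "Farr (nerve_presheaf X) (Ident (op_cat S) a) \<in> hom_set Set_cat (eK X a) (eK X a)"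
      using Farr_nerve_presheaf_in[OF X i] by simp
    show "Ident Set_cat (Fobj (nerve_presheaf X) a) \<in> hom_set Set_cat (eK X a) (eK X a)"
      using Set_cat.Ident_in[of "eK X a"] small_e[OF X a] a by simp
    show "tmap (Farr (nerve_presheaf X) (Ident (op_cat S) a)) x = tmap (Ident Set_cat (Fobj (nerve_presheaf X) a)) x"
      if "x \<in> eK X a" for x
      using that a by (auto simp: Farr_nerve_presheaf[OF X i] Farr_Ident cod.Comp_Ident)
  qed
  show "Farr (nerve_presheaf X) (g \<cdot>\<^bsub>op_cat S\<^esub> f) = Farr (nerve_presheaf X) g \<cdot>\<^bsub>Set_cat\<^esub> Farr (nerve_presheaf X) f"
    if fg: "f \<in> hom_set (op_cat S) a b" "g \<in> hom_set (op_cat S) b c" for f a b g c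
  proof (rule Set_map_eqI)
    have f: "f \<in> hom_set S b a" and g: "g \<in> hom_set S c b" using fg by auto
    note gf = dom.Comp_in[OF g f]
    show "Farr (nerve_presheaf X) (g \<cdot>\<^bsub>op_cat S\<^esub> f) \<in> hom_set Set_cat (eK X a) (eK X c)"
      using Farr_nerve_presheaf_in[OF X gf] by simp
    show "Farr (nerve_presheaf X) g \<cdot>\<^bsub>Set_cat\<^esub> Farr (nerve_presheaf X) f \<in> hom_set Set_cat (eK X a) (eK X c)"
      using Set_cat.Comp_in[OF Farr_nerve_presheaf_in[OF X f] Farr_nerve_presheaf_in[OF X g]] .
    show "tmap (Farr (nerve_presheaf X) (g \<cdot>\<^bsub>op_cat S\<^esub> f)) x =
        tmap (Farr (nerve_presheaf X) g \<cdot>\<^bsub>Set_cat\<^esub> Farr (nerve_presheaf X) f) x" if x: "x \<in> eK X a" for x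
    proof -
      obtain m where m: "x = e X a m" "m \<in> K X a" using x by blast
      have "tdom (Farr (nerve_presheaf X) f) = eK X a"
        using Farr_nerve_presheaf_in[OF X f] by (simp add: hom_set_Set_cat)
      then show ?thesis
        using x m Farr_Comp[OF g f] cod.Comp_assoc[OF Farr_in[OF g] Farr_in[OF f] m(2)]
        by (simp add: Farr_nerve_presheaf[OF X] Farr_nerve_presheaf[OF X f] Farr_nerve_presheaf[OF X g]
            Farr_nerve_presheaf[OF X gf] K_precomp[OF f] compose_def)
    qed
  qed
qed

lemma nerve_presheaf_in: "X \<in> Obj E \<Longrightarrow> nerve_presheaf X \<in> Obj (functor_cat (op_cat S) Set_cat)"
  by (simp add: functor_cat_simps nerve_presheaf_functor) (simp add: nerve_presheaf_def)

lemma Fobj_nerve [simp]: "Fobj nerve = nerve_presheaf"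
  by (simp add: nerve_def)

lemma Farr_nerve:
  assumes "h \<in> hom_set E X Y" "c \<in> Obj S" "m \<in> K X c"
  shows "tmap (tmap (Farr nerve h) c) (e X c m) = e Y c (h \<cdot>\<^bsub>E\<^esub> m)"
  using assms cod.hom_objects[OF assms(1)] by (auto simp: nerve_def hom_set_def[of E X Y])

lemma Farr_nerve_component:
  assumes "h \<in> hom_set E X Y" "c \<in> Obj S"
  shows "tmap (Farr nerve h) c \<in> hom_set Set_cat (eK X c) (eK Y c)"
proof -
  have h: "Dom E h = X" "Cod E h = Y" and XY: "X \<in> Obj E" "Y \<in> Obj E"
    using assms(1) cod.hom_objects[OF assms(1)] by (auto simp: hom_set_def)
  show ?thesis
    using small_e assms XY
    by (auto simp: hom_set_Set_cat nerve_def h intro!: imageI cod.Comp_in[OF _ assms(1)])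
qed

text \<open>Reduces an equation between maps of code sets to one about single arrows
  \<open>m\<close>. Both directions matter: one shows that \<open>nerve\<close> is well defined on
  arrows, the other extracts a family of arrows from a transformation when proving fullness.\<close>

lemma natural_between_nerves:
  assumes XY: "X \<in> Obj E" "Y \<in> Obj E"
    and \<tau>: "\<And>c. c \<in> Obj S \<Longrightarrow> \<tau> c \<in> hom_set Set_cat (eK X c) (eK Y c)"
  shows "natural_transformation (op_cat S) Set_cat (nerve_presheaf X) (nerve_presheaf Y) \<tau> \<longleftrightarrow>
    (\<forall>d c. \<forall>f\<in>hom_set S d c. \<forall>m\<in>K X c.
       tmap (\<tau> d) (e X d (m \<cdot>\<^bsub>E\<^esub> Farr F f)) = tmap (Farr (nerve_presheaf Y) f) (tmap (\<tau> c) (e X c m)))"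
proof -
  interpret Set_cat: category "Set_cat :: ('v set, _) cat" by (rule category_Set_cat)
  have "\<tau> d \<cdot>\<^bsub>Set_cat\<^esub> Farr (nerve_presheaf X) f = Farr (nerve_presheaf Y) f \<cdot>\<^bsub>Set_cat\<^esub> \<tau> c \<longleftrightarrow>
      (\<forall>m\<in>K X c. tmap (\<tau> d) (e X d (m \<cdot>\<^bsub>E\<^esub> Farr F f)) =
         tmap (Farr (nerve_presheaf Y) f) (tmap (\<tau> c) (e X c m)))" (is "?l = ?r \<longleftrightarrow> ?q")
    if f: "f \<in> hom_set S d c" for f c d
  proof -
    have cd: "d \<in> Obj S" "c \<in> Obj S" using dom.hom_objects[OF f] by auto
    note l = Farr_nerve_presheaf_in[OF XY(1) f] and r = Farr_nerve_presheaf_in[OF XY(2) f]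
    have lr: "?l \<in> hom_set Set_cat (eK X c) (eK Y d)" "?r \<in> hom_set Set_cat (eK X c) (eK Y d)"
      using Set_cat.Comp_in[OF l \<tau>[OF cd(1)]] Set_cat.Comp_in[OF \<tau>[OF cd(2)] r] .
    have lv: "tmap ?l (e X c m) = tmap (\<tau> d) (e X d (m \<cdot>\<^bsub>E\<^esub> Farr F f))"
      and rv: "tmap ?r (e X c m) = tmap (Farr (nerve_presheaf Y) f) (tmap (\<tau> c) (e X c m))"
      if "m \<in> K X c" for m
      using that l \<tau>[OF cd(2)] Farr_nerve_presheaf[OF XY(1) f that]
      by (auto simp: hom_set_Set_cat compose_def)
    show ?thesis
    proof
      show ?q if eq: "?l = ?r"
      proof
        show "tmap (\<tau> d) (e X d (m \<cdot>\<^bsub>E\<^esub> Farr F f)) = tmap (Farr (nerve_presheaf Y) f) (tmap (\<tau> c) (e X c m))"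
          if "m \<in> K X c" for m
          unfolding lv[OF that, symmetric] rv[OF that, symmetric] eq ..
      qed
      show "?l = ?r" if q: ?q
      proof (rule Set_map_eqI[OF lr])
        fix x assume "x \<in> eK X c"
        then obtain m where m: "m \<in> K X c" "x = e X c m" by blast
        show "tmap ?l x = tmap ?r x"
          unfolding m(2) lv[OF m(1)] rv[OF m(1)] using q m(1) by blast
      qed
    qed
  qed
  note * = this
  have "natural_transformation (op_cat S) Set_cat (nerve_presheaf X) (nerve_presheaf Y) \<tau> \<longleftrightarrow>
    (\<forall>f\<in>Arr S. \<tau> (Dom S f) \<cdot>\<^bsub>Set_cat\<^esub> Farr (nerve_presheaf X) f = Farr (nerve_presheaf Y) f \<cdot>\<^bsub>Set_cat\<^esub> \<tau> (Cod S f))"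
    unfolding natural_transformation_def using \<tau> by (simp del: Set_cat_simps)
  also have "\<dots> \<longleftrightarrow> (\<forall>d c. \<forall>f\<in>hom_set S d c.
      \<tau> d \<cdot>\<^bsub>Set_cat\<^esub> Farr (nerve_presheaf X) f = Farr (nerve_presheaf Y) f \<cdot>\<^bsub>Set_cat\<^esub> \<tau> c)"
    unfolding hom_set_def by blast
  also have "\<dots> \<longleftrightarrow> (\<forall>d c. \<forall>f\<in>hom_set S d c. \<forall>m\<in>K X c.
      tmap (\<tau> d) (e X d (m \<cdot>\<^bsub>E\<^esub> Farr F f)) = tmap (Farr (nerve_presheaf Y) f) (tmap (\<tau> c) (e X c m)))"
    by (intro all_cong1 ball_cong refl *)
  finally show ?thesis .
qed

lemma Farr_nerve_in:
  assumes h: "h \<in> hom_set E X Y"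
  shows "Farr nerve h \<in> hom_set (functor_cat (op_cat S) Set_cat) (nerve_presheaf X) (nerve_presheaf Y)"
proof -
  have XY: "X \<in> Obj E" "Y \<in> Obj E" "Dom E h = X" "Cod E h = Y"
    using h cod.hom_objects[OF h] by (auto simp: hom_set_def)
  have "natural_transformation (op_cat S) Set_cat (nerve_presheaf X) (nerve_presheaf Y) (tmap (Farr nerve h))"
  proof (rule natural_between_nerves[OF XY(1,2), THEN iffD2], erule Farr_nerve_component[OF h],
      intro allI ballI)
    fix d c f m assume f: "f \<in> hom_set S d c" and m: "m \<in> K X c"
    have cd: "d \<in> Obj S" "c \<in> Obj S" using dom.hom_objects[OF f] by auto
    show "tmap (tmap (Farr nerve h) d) (e X d (m \<cdot>\<^bsub>E\<^esub> Farr F f)) =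
        tmap (Farr (nerve_presheaf Y) f) (tmap (tmap (Farr nerve h) c) (e X c m))"
      using Farr_nerve[OF h cd(1) K_precomp[OF f m]] Farr_nerve[OF h cd(2) m]
        Farr_nerve_presheaf[OF XY(2) f cod.Comp_in[OF m h]] cod.Comp_assoc[OF Farr_in[OF f] m h] by simp
  qed
  then show ?thesis
    using nerve_presheaf_in XY by (auto simp: hom_set_functor_cat) (auto simp: nerve_def)
qed

lemma nerve_hom_eqI:
  assumes "m \<in> hom_set (functor_cat (op_cat S) Set_cat) (nerve_presheaf X) P"
    "m' \<in> hom_set (functor_cat (op_cat S) Set_cat) (nerve_presheaf X) P"
    and eq: "\<And>c k. c \<in> Obj S \<Longrightarrow> k \<in> K X c \<Longrightarrow> tmap (tmap m c) (e X c k) = tmap (tmap m' c) (e X c k)"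
  shows "m = m'"
proof (rule tagged_map.expand, intro conjI)
  show "tmap m = tmap m'"
  proof (rule extensionalityI)
    show "tmap m c = tmap m' c" if "c \<in> Obj S" for c
    proof (rule Set_map_eqI)
      show "tmap m c \<in> hom_set Set_cat (eK X c) (Fobj P c)" "tmap m' c \<in> hom_set Set_cat (eK X c) (Fobj P c)"
        using assms(1,2) that by (auto simp: hom_set_functor_cat natural_transformation_def)
      show "tmap (tmap m c) x = tmap (tmap m' c) x" if "x \<in> eK X c" for x
        using that eq \<open>c \<in> Obj S\<close> by blast
    qed
  qed (use assms(1,2) in \<open>auto simp: hom_set_functor_cat\<close>)
qed (use assms(1,2) in \<open>auto simp: hom_set_functor_cat\<close>)

lemma nerve_functor: "cat_functor E (functor_cat (op_cat S) Set_cat) nerve"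
proof (intro cat_functor.intro category_Set_cat dom.category_op_cat category_functor_cat
    cod.category_axioms, unfold_locales)
  interpret FC: category "functor_cat (op_cat S) (Set_cat :: ('v set, _) cat)"
    by (intro category_functor_cat category_Set_cat dom.category_op_cat)
  show "Fobj nerve X \<in> Obj (functor_cat (op_cat S) Set_cat)" if "X \<in> Obj E" for X
    using nerve_presheaf_in[OF that] by simp
  show "Farr nerve f \<in> hom_set (functor_cat (op_cat S) Set_cat) (Fobj nerve a) (Fobj nerve b)"
    if "f \<in> hom_set E a b" for f a b
    using Farr_nerve_in[OF that] by simp
  show "Farr nerve (Ident E X) = Ident (functor_cat (op_cat S) Set_cat) (Fobj nerve X)"
    if X: "X \<in> Obj E" for X
  proof (rule nerve_hom_eqI)
    show "Farr nerve (Ident E X) \<in> hom_set (functor_cat (op_cat S) Set_cat) (nerve_presheaf X) (nerve_presheaf X)"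
      by (rule Farr_nerve_in[OF cod.Ident_in[OF X]])
    show "Ident (functor_cat (op_cat S) Set_cat) (Fobj nerve X)
        \<in> hom_set (functor_cat (op_cat S) Set_cat) (nerve_presheaf X) (nerve_presheaf X)"
      using FC.Ident_in[OF nerve_presheaf_in[OF X]] by simp
    show "tmap (tmap (Farr nerve (Ident E X)) c) (e X c k) =
        tmap (tmap (Ident (functor_cat (op_cat S) Set_cat) (Fobj nerve X)) c) (e X c k)"
      if "c \<in> Obj S" "k \<in> K X c" for c k
      using that by (simp add: functor_cat_simps Farr_nerve[OF cod.Ident_in[OF X]] cod.Ident_Comp)
  qed
  show "Farr nerve (h \<cdot>\<^bsub>E\<^esub> g) = Farr nerve h \<cdot>\<^bsub>functor_cat (op_cat S) Set_cat\<^esub> Farr nerve g"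
    if gh: "g \<in> hom_set E X Y" "h \<in> hom_set E Y Z" for g X Y h Z
  proof (rule nerve_hom_eqI)
    note hg = cod.Comp_in[OF gh]
    show "Farr nerve (h \<cdot>\<^bsub>E\<^esub> g) \<in> hom_set (functor_cat (op_cat S) Set_cat) (nerve_presheaf X) (nerve_presheaf Z)"
      by (rule Farr_nerve_in[OF hg])
    show "Farr nerve h \<cdot>\<^bsub>functor_cat (op_cat S) Set_cat\<^esub> Farr nerve g
        \<in> hom_set (functor_cat (op_cat S) Set_cat) (nerve_presheaf X) (nerve_presheaf Z)"
      using FC.Comp_in[OF Farr_nerve_in[OF gh(1)] Farr_nerve_in[OF gh(2)]] .
    show "tmap (tmap (Farr nerve (h \<cdot>\<^bsub>E\<^esub> g)) c) (e X c k) =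
        tmap (tmap (Farr nerve h \<cdot>\<^bsub>functor_cat (op_cat S) Set_cat\<^esub> Farr nerve g) c) (e X c k)"
      if c: "c \<in> Obj S" and k: "k \<in> K X c" for c k
      using Farr_nerve_component[OF gh(1) c] c k
      by (simp add: functor_cat_simps hom_set_Set_cat compose_def Farr_nerve[OF hg c k]
          Farr_nerve[OF gh(1) c k] Farr_nerve[OF gh(2) c cod.Comp_in[OF k gh(1)]] cod.Comp_assoc[OF k gh])
  qed
qed

lemma induced_by_nerve: "induced_by S E F nerve"
  unfolding induced_by_def
proof (intro exI[of _ e] conjI ballI)
  show "bij_betw (e X c) (K X c) (Fobj (Fobj nerve X) c)" if "X \<in> Obj E" "c \<in> Obj S" for X c
    using inj_e that by (simp add: bij_betw_def)
  show "e X (Dom S f) (m \<cdot>\<^bsub>E\<^esub> Farr F f) = tmap (Farr (Fobj nerve X) f) (e X (Cod S f) m)"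
    if "X \<in> Obj E" "f \<in> Arr S" "m \<in> K X (Cod S f)" for X f m
    using Farr_nerve_presheaf[OF that(1) dom.arr_hom[OF that(2)] that(3)] by simp
  show "e (Cod E h) c (h \<cdot>\<^bsub>E\<^esub> m) = tmap (tmap (Farr nerve h) c) (e (Dom E h) c m)"
    if "h \<in> Arr E" "c \<in> Obj S" "m \<in> K (Dom E h) c" for h c m
    using Farr_nerve[OF cod.arr_hom[OF that(1)] that(2,3)] by simp
qed

text \<open>The premise \<open>sep\<close> says that the objects \<open>F c\<close> form a
  separating family of \<open>E\<close>; it is applied to the arrows recovered from their
  codes.\<close>

lemma nerve_faithful:
  assumes sep: "\<And>X Y t t'. \<lbrakk>t \<in> hom_set E X Y; t' \<in> hom_set E X Y;
      \<And>c m. c \<in> Obj S \<Longrightarrow> m \<in> K X c \<Longrightarrow> t \<cdot>\<^bsub>E\<^esub> m = t' \<cdot>\<^bsub>E\<^esub> m\<rbrakk> \<Longrightarrow> t = t'"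
  shows "faithful_functor E nerve"
  unfolding faithful_functor_def inj_on_def
proof (intro ballI impI)
  fix X Y t t'
  assume t: "t \<in> hom_set E X Y" "t' \<in> hom_set E X Y" and eq: "Farr nerve t = Farr nerve t'"
    and XY: "X \<in> Obj E" "Y \<in> Obj E"
  show "t = t'"
  proof (rule sep[OF t])
    show "t \<cdot>\<^bsub>E\<^esub> m = t' \<cdot>\<^bsub>E\<^esub> m" if "c \<in> Obj S" "m \<in> K X c" for c m
      using Farr_nerve[OF t(1) that] Farr_nerve[OF t(2) that] eq
        e_eq_iff[OF XY(2) that(1) cod.Comp_in[OF that(2) t(1)] cod.Comp_in[OF that(2) t(2)]] by simp
  qed
qed

text \<open>A compatible family \<open>\<theta>\<close> is a cocone with vertex \<open>Y\<close> on
  the canonical diagram of all arrows from objects \<open>F c\<close> to \<open>X\<close>. The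
  premise \<open>dense\<close> says that every such cocone factors through \<open>X\<close>.\<close>

lemma nerve_full:
  assumes dense: "\<And>X Y \<theta>. \<lbrakk>X \<in> Obj E; Y \<in> Obj E; \<And>c m. c \<in> Obj S \<Longrightarrow> m \<in> K X c \<Longrightarrow> \<theta> c m \<in> K Y c;
      \<And>d c f m. f \<in> hom_set S d c \<Longrightarrow> m \<in> K X c \<Longrightarrow> \<theta> d (m \<cdot>\<^bsub>E\<^esub> Farr F f) = \<theta> c m \<cdot>\<^bsub>E\<^esub> Farr F f\<rbrakk> \<Longrightarrow>
      \<exists>t\<in>hom_set E X Y. \<forall>c\<in>Obj S. \<forall>m\<in>K X c. \<theta> c m = t \<cdot>\<^bsub>E\<^esub> m"
  shows "full_functor E (functor_cat (op_cat S) Set_cat) nerve"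
  unfolding full_functor_def
proof (intro ballI)
  fix X Y g
  assume XY: "X \<in> Obj E" "Y \<in> Obj E"
    and g: "g \<in> hom_set (functor_cat (op_cat S) Set_cat) (Fobj nerve X) (Fobj nerve Y)"
  have gc: "tmap g c \<in> hom_set Set_cat (eK X c) (eK Y c)" if "c \<in> Obj S" for c
    using g that by (auto simp: hom_set_functor_cat natural_transformation_def)
  have nat: "natural_transformation (op_cat S) Set_cat (nerve_presheaf X) (nerve_presheaf Y) (tmap g)"
    using g by (simp add: hom_set_functor_cat)
  \<comment> \<open>The components of \<open>g\<close> act on codes; \<open>\<theta>\<close> is the
    family of arrows that these codes stand for.\<close>
  define \<theta> where "\<theta> c m = decode Y c (tmap (tmap g c) (e X c m))" for c m
  have ge: "tmap (tmap g c) (e X c m) \<in> eK Y c" if "c \<in> Obj S" "m \<in> K X c" for c m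
    using gc[OF that(1)] that(2) by (auto simp: hom_set_Set_cat)
  have \<theta>: "\<theta> c m \<in> K Y c" "e Y c (\<theta> c m) = tmap (tmap g c) (e X c m)" if "c \<in> Obj S" "m \<in> K X c" for c m
    using decode_in ge[OF that] by (auto simp: \<theta>_def)
  have "\<theta> d (m \<cdot>\<^bsub>E\<^esub> Farr F f) = \<theta> c m \<cdot>\<^bsub>E\<^esub> Farr F f" if f: "f \<in> hom_set S d c" and m: "m \<in> K X c" for d c f m
  proof -
    have cd: "d \<in> Obj S" "c \<in> Obj S" using dom.hom_objects[OF f] by auto
    have "tmap (tmap g d) (e X d (m \<cdot>\<^bsub>E\<^esub> Farr F f)) =
        tmap (Farr (nerve_presheaf Y) f) (tmap (tmap g c) (e X c m))"
      using natural_between_nerves[OF XY, where \<tau> = "tmap g"] gc nat f m by blast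
    then have "e Y d (\<theta> d (m \<cdot>\<^bsub>E\<^esub> Farr F f)) = e Y d (\<theta> c m \<cdot>\<^bsub>E\<^esub> Farr F f)"
      using \<theta>(2)[OF cd(1) K_precomp[OF f m]]
        Farr_nerve_presheaf[OF XY(2) f \<theta>(1)[OF cd(2) m]] \<theta>(2)[OF cd(2) m] by simp
    then show ?thesis
      using e_eq_iff[OF XY(2) cd(1)] \<theta>(1)[OF cd(1) K_precomp[OF f m]] K_precomp[OF f \<theta>(1)[OF cd(2) m]] by blast
  qed
  then obtain t where t: "t \<in> hom_set E X Y" "\<forall>c\<in>Obj S. \<forall>m\<in>K X c. \<theta> c m = t \<cdot>\<^bsub>E\<^esub> m"
    using dense[OF XY, of \<theta>] \<theta>(1) by auto
  have "Farr nerve t = g"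
    using Farr_nerve_in[OF t(1)] g[simplified]
  proof (rule nerve_hom_eqI)
    show "tmap (tmap (Farr nerve t) c) (e X c k) = tmap (tmap g c) (e X c k)" if "c \<in> Obj S" "k \<in> K X c" for c k
      using Farr_nerve[OF t(1) that] t(2) \<theta>(2) that by simp
  qed
  with t(1) show "\<exists>t\<in>hom_set E X Y. Farr nerve t = g" by blast
qed

text \<open>The bijections \<open>p\<close> go from \<open>P\<close> to hom sets, since in the
  application an element of \<open>P\<close> gives rise to an equivariant map. The isomorphism
  produced goes the other way, as essential surjectivity in \<open>equivalence_functorI\<close>
  expects.\<close>

lemma nerve_isomorphic:
  assumes X: "X \<in> Obj E" and P: "P \<in> Obj (functor_cat (op_cat S) Set_cat)"
    and p: "\<And>c. c \<in> Obj S \<Longrightarrow> bij_betw (p c) (Fobj P c) (K X c)"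
    and nat: "\<And>d c f y. f \<in> hom_set S d c \<Longrightarrow> y \<in> Fobj P c \<Longrightarrow> p d (tmap (Farr P f) y) = p c y \<cdot>\<^bsub>E\<^esub> Farr F f"
  shows "\<exists>m\<in>hom_set (functor_cat (op_cat S) Set_cat) (nerve_presheaf X) P.
    \<exists>n. inverse_arrows (functor_cat (op_cat S) Set_cat) m n"
proof -
  interpret P: cat_functor "op_cat S" Set_cat P using P by (simp add: functor_cat_simps)
  define q where "q c = (\<lambda>x\<in>eK X c. inv_into (Fobj P c) (p c) (decode X c x))" for c
  define \<tau> where "\<tau> = (\<lambda>c\<in>Obj S. TMap (eK X c) (q c) (Fobj P c))"
  have q: "q c (e X c (p c y)) = y" "e X c (p c y) \<in> eK X c" if "c \<in> Obj S" "y \<in> Fobj P c" for c y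
  proof -
    have "p c y \<in> K X c" "inj_on (p c) (Fobj P c)"
      using that(2) p[OF that(1)] by (auto simp: bij_betw_def)
    then show "q c (e X c (p c y)) = y" "e X c (p c y) \<in> eK X c"
      using that X by (simp_all add: q_def)
  qed
  have eK: "eK X c = (\<lambda>y. e X c (p c y)) ` Fobj P c" if "c \<in> Obj S" for c
    using p[OF that] by (auto simp: bij_betw_def image_image[symmetric])
  have bij: "bij_betw (q c) (eK X c) (Fobj P c)" if "c \<in> Obj S" for c
    using q[OF that] eK[OF that] by (intro bij_betw_byWitness[where f' = "\<lambda>y. e X c (p c y)"]) auto
  have \<tau>: "\<tau> c \<in> hom_set Set_cat (eK X c) (Fobj P c)" if "c \<in> Obj S" for c
    using that bij[OF that] small_e[OF X that] P.Fobj_in[of c]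
    by (auto simp: \<tau>_def hom_set_Set_cat bij_betw_def q_def)
  have "natural_transformation (op_cat S) Set_cat (nerve_presheaf X) P \<tau>"
    unfolding natural_transformation_def
  proof (intro conjI ballI)
    show "\<tau> a \<in> hom_set Set_cat (Fobj (nerve_presheaf X) a) (Fobj P a)" if "a \<in> Obj (op_cat S)" for a
      using \<tau> that by simp
    fix f assume "f \<in> Arr (op_cat S)"
    then obtain d c where f: "f \<in> hom_set S d c" "Dom S f = d" "Cod S f = c" by (auto simp: hom_set_def)
    have cd: "d \<in> Obj S" "c \<in> Obj S" using dom.hom_objects[OF f(1)] by auto
    note Nf = Farr_nerve_presheaf_in[OF X f(1)]
    have Pf: "Farr P f \<in> hom_set Set_cat (Fobj P c) (Fobj P d)" using P.Farr_in[of f c d] f(1) by simp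
    have "\<tau> d \<cdot>\<^bsub>Set_cat\<^esub> Farr (nerve_presheaf X) f = Farr P f \<cdot>\<^bsub>Set_cat\<^esub> \<tau> c"
    proof (rule Set_map_eqI[OF P.cod.Comp_in[OF Nf \<tau>[OF cd(1)]] P.cod.Comp_in[OF \<tau>[OF cd(2)] Pf]])
      fix x assume x: "x \<in> eK X c"
      then obtain y where y: "y \<in> Fobj P c" "x = e X c (p c y)" using eK[OF cd(2)] by blast
      have pK: "p c y \<in> K X c" using p[OF cd(2)] y(1) by (auto simp: bij_betw_def)
      have Py: "tmap (Farr P f) y \<in> Fobj P d" using Pf y(1) by (auto simp: hom_set_Set_cat)
      have "tmap (\<tau> d \<cdot>\<^bsub>Set_cat\<^esub> Farr (nerve_presheaf X) f) x = q d (e X d (p c y \<cdot>\<^bsub>E\<^esub> Farr F f))"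
        using Nf x cd Farr_nerve_presheaf[OF X f(1) pK] y(2) by (simp add: hom_set_Set_cat compose_def \<tau>_def)
      also have "\<dots> = tmap (Farr P f) y"
        using q(1)[OF cd(1) Py] nat[OF f(1) y(1)] by simp
      also have "\<dots> = tmap (Farr P f \<cdot>\<^bsub>Set_cat\<^esub> \<tau> c) x"
        using x cd y q(1)[OF cd(2) y(1)] by (simp add: compose_def \<tau>_def)
      finally show "tmap (\<tau> d \<cdot>\<^bsub>Set_cat\<^esub> Farr (nerve_presheaf X) f) x = tmap (Farr P f \<cdot>\<^bsub>Set_cat\<^esub> \<tau> c) x" .
    qed
    then show "\<tau> (Cod (op_cat S) f) \<cdot>\<^bsub>Set_cat\<^esub> Farr (nerve_presheaf X) f = Farr P f \<cdot>\<^bsub>Set_cat\<^esub> \<tau> (Dom (op_cat S) f)"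
      unfolding op_cat_simps f(2,3) .
  qed
  then have m: "TMap (nerve_presheaf X) \<tau> P \<in> hom_set (functor_cat (op_cat S) Set_cat) (nerve_presheaf X) P"
    using nerve_presheaf_in[OF X] P by (simp add: hom_set_functor_cat \<tau>_def)
  have iso: "isomorphism Set_cat (\<tau> c)" if "c \<in> Obj S" for c
    using isomorphism_Set_cat[OF \<tau>[OF that]] bij[OF that] that by (simp add: \<tau>_def)
  show ?thesis
    by (rule bexI[OF _ m], rule isomorphism_functor_cat[OF m]) (simp add: iso)
qed

end

section \<open>Continuous actions\<close>

text \<open>A \<open>group_action\<close> is a homomorphism into the group of extensional
  bijections. Bijectivity comes from the action laws, the inverse of \<open>\<phi> g\<close> being
  the action of the inverse of \<open>g\<close>.\<close>

lemma group_actionI: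
  assumes "group G"
    and ext: "\<And>g. g \<in> carrier G \<Longrightarrow> \<phi> g \<in> extensional E"
    and closed: "\<And>g x. g \<in> carrier G \<Longrightarrow> x \<in> E \<Longrightarrow> \<phi> g x \<in> E"
    and one: "\<And>x. x \<in> E \<Longrightarrow> \<phi> \<one>\<^bsub>G\<^esub> x = x"
    and mult: "\<And>g h x. g \<in> carrier G \<Longrightarrow> h \<in> carrier G \<Longrightarrow> x \<in> E \<Longrightarrow> \<phi> (g \<otimes>\<^bsub>G\<^esub> h) x = \<phi> g (\<phi> h x)"
  shows "group_action G E \<phi>"
proof -
  interpret group G by fact
  have inverse: "\<phi> g (\<phi> (inv\<^bsub>G\<^esub> g) x) = x" "\<phi> (inv\<^bsub>G\<^esub> g) (\<phi> g x) = x" if "g \<in> carrier G" "x \<in> E" for g x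
    using mult[of g "inv\<^bsub>G\<^esub> g" x] mult[of "inv\<^bsub>G\<^esub> g" g x] one that by simp_all
  have bij: "\<phi> g \<in> Bij E" if "g \<in> carrier G" for g
    using that ext closed inverse
    by (auto simp: Bij_def intro!: bij_betw_byWitness[where f' = "\<phi> (inv\<^bsub>G\<^esub> g)"])
  have "\<phi> (g \<otimes>\<^bsub>G\<^esub> h) = compose E (\<phi> g) (\<phi> h)" if "g \<in> carrier G" "h \<in> carrier G" for g h
    using that mult by (intro extensionalityI[OF ext compose_extensional]) (auto simp: compose_def)
  then have "\<phi> \<in> hom G (BijGroup E)"
    using bij by (auto simp: hom_def BijGroup_def)
  then show ?thesis
    by (intro group_action.intro group_hom.intro group_hom_axioms.intro group_BijGroup \<open>group G\<close>)
qed

text \<open>The points are discrete, so continuity is a matter of the group variable alone.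
  Continuity at the identity and \<open>x\<close> puts a member of the base inside the stabilizer of
  \<open>x\<close>; conversely, if \<open>H\<close> fixes \<open>x\<close>, the action is constant
  on the open set of pairs from the coset of \<open>g\<close> by \<open>H\<close> and from
  \<open>{x}\<close>.\<close>

lemma continuous_gset_iff:
  assumes G: "group G" and B: "algebraic_base G \<B>"
  shows "continuous_gset G (generated_topology G \<B>) X \<longleftrightarrow>
    group_action G (Pts X) (Act X) \<and> Act X \<in> extensional (carrier G) \<and>
    (\<forall>x\<in>Pts X. \<exists>H\<in>\<B>. \<forall>h\<in>H. Act X h x = x)"
proof (cases "group_action G (Pts X) (Act X)")
  case True
  interpret group G by fact
  interpret X: group_action G "Pts X" "Act X" by fact
  let ?T = "generated_topology G \<B>"
  note top = topspace_generated_topology[OF G B]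
  have "continuous_map (prod_topology ?T (discrete_topology (Pts X))) (discrete_topology (Pts X)) (\<lambda>(g, x). Act X g x)
    \<longleftrightarrow> (\<forall>x\<in>Pts X. \<exists>H\<in>\<B>. \<forall>h\<in>H. Act X h x = x)" (is "?cont \<longleftrightarrow> ?stab")
  proof
    assume cont: ?cont
    show ?stab
    proof
      fix x assume x: "x \<in> Pts X"
      let ?V = "{z \<in> topspace (prod_topology ?T (discrete_topology (Pts X))). (case z of (g, x) \<Rightarrow> Act X g x) \<in> {x}}"
      have "openin (prod_topology ?T (discrete_topology (Pts X))) ?V"
        using openin_continuous_map_preimage[OF cont, of "{x}"] x by simp
      moreover have "(\<one>\<^bsub>G\<^esub>, x) \<in> ?V"
        using x X.id_eq_one[symmetric] by (simp add: top)
      ultimately obtain U W where U: "openin ?T U" "\<one>\<^bsub>G\<^esub> \<in> U" "x \<in> W" "U \<times> W \<subseteq> ?V"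
        unfolding openin_prod_topology_alt by blast
      then obtain H where H: "H \<in> \<B>" "\<one>\<^bsub>G\<^esub> <#\<^bsub>G\<^esub> H \<subseteq> U"
        unfolding openin_generated_topology[OF G B] by blast
      have "\<one>\<^bsub>G\<^esub> <#\<^bsub>G\<^esub> H = H"
        using base_subgroup[OF G B H(1), THEN subgroup.subset] by (rule lcos_mult_one)
      then have "(h, x) \<in> ?V" if "h \<in> H" for h using that H(2) U(3,4) by blast
      then have "\<forall>h\<in>H. Act X h x = x" by simp
      then show "\<exists>H\<in>\<B>. \<forall>h\<in>H. Act X h x = x" using H(1) by blast
    qed
  next
    assume stab: ?stab
    show ?cont
      unfolding continuous_map
    proof (intro conjI allI impI)
      show "(\<lambda>(g, x). Act X g x) ` topspace (prod_topology ?T (discrete_topology (Pts X)))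
          \<subseteq> topspace (discrete_topology (Pts X))"
        using X.element_image by (auto simp: top)
      fix V assume "openin (discrete_topology (Pts X)) V"
      let ?V = "{z \<in> topspace (prod_topology ?T (discrete_topology (Pts X))). (case z of (g, x) \<Rightarrow> Act X g x) \<in> V}"
      show "openin (prod_topology ?T (discrete_topology (Pts X))) ?V"
        unfolding openin_prod_topology_alt
      proof (intro allI impI)
        fix g x assume "(g, x) \<in> ?V"
        then have gx: "g \<in> carrier G" "x \<in> Pts X" "Act X g x \<in> V" by (auto simp: top)
        then obtain H where H: "H \<in> \<B>" "\<forall>h\<in>H. Act X h x = x" using stab by blast
        note Hc = subgroup.mem_carrier[OF base_subgroup[OF G B H(1)]]
        have "(g <#\<^bsub>G\<^esub> H) \<times> {x} \<subseteq> ?V"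
          using gx Hc H(2) X.composition_rule[OF gx(2,1)] by (auto simp: top l_coset_def)
        then show "\<exists>U W. openin ?T U \<and> openin (discrete_topology (Pts X)) W \<and> g \<in> U \<and> x \<in> W \<and> U \<times> W \<subseteq> ?V"
          using openin_coset[OF G B H(1) gx(1)] gx(2)
          by (intro exI[of _ "g <#\<^bsub>G\<^esub> H"] exI[of _ "{x}"]) simp
      qed
    qed
  qed
  then show ?thesis by (simp add: continuous_gset_def True)
next
  case False
  then show ?thesis by (simp add: continuous_gset_def)
qed

section \<open>The category of continuous actions\<close>

lemma Cont_simps:
  "X \<in> Obj (Cont G T) \<longleftrightarrow> small TYPE('v) (Pts X) \<and> continuous_gset G T (X :: ('g, 'v) gset)"
  "Dom (Cont G T) = tdom" "Cod (Cont G T) = tcod"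
  "Ident (Cont G T) X = TMap X (\<lambda>x\<in>Pts X. x) X"
  "n \<cdot>\<^bsub>Cont G T\<^esub> m = TMap (tdom m) (compose (Pts (tdom m)) (tmap n) (tmap m)) (tcod n)"
  by (simp_all add: Cont_def Let_def)

lemma hom_set_Cont:
  "m \<in> hom_set (Cont G T) X Y \<longleftrightarrow> tdom m = X \<and> tcod m = Y \<and>
     X \<in> Obj (Cont G T) \<and> Y \<in> Obj (Cont G T) \<and> tmap m \<in> equivariant_maps G X Y"
  by (cases m) (auto simp: hom_set_def Cont_def Let_def)

lemma Cont_hom_apply:
  assumes "m \<in> hom_set (Cont G T) X Y" "x \<in> Pts X"
  shows "tmap m x \<in> Pts Y" "g \<in> carrier G \<Longrightarrow> tmap m (Act X g x) = Act Y g (tmap m x)"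
    "tmap (n \<cdot>\<^bsub>Cont G T\<^esub> m) x = tmap n (tmap m x)"
  using assms by (auto simp: hom_set_Cont Cont_simps equivariant_maps_def compose_def)

lemma Cont_hom_eqI:
  assumes "m \<in> hom_set (Cont G T) X Y" "m' \<in> hom_set (Cont G T) X Y"
    "\<And>x. x \<in> Pts X \<Longrightarrow> tmap m x = tmap m' x"
  shows "m = m'"
  using assms by (intro tagged_map.expand) (auto simp: hom_set_Cont equivariant_maps_def intro: PiE_ext)

lemma category_Cont: "category (Cont G T)"
proof (unfold_locales, goal_cases)
  case (1 f) then show ?case by (auto simp: Cont_def Let_def)
next
  case (2 f) then show ?case by (auto simp: Cont_def Let_def)
next
  case (3 X)
  then interpret group_action G "Pts X" "Act X" by (simp add: Cont_simps continuous_gset_def)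
  show ?case
    using 3 by (auto simp: hom_set_Cont Cont_simps equivariant_maps_def element_image)
next
  case (4 f X Y g Z)
  then interpret group_action G "Pts X" "Act X" by (simp add: hom_set_Cont Cont_simps continuous_gset_def)
  show ?case
    using 4 Cont_hom_apply[OF 4(1)] Cont_hom_apply[OF 4(2)] element_image
    by (simp add: hom_set_Cont Cont_simps equivariant_maps_def compose_def)
next
  case (5 f X Y)
  then show ?case
    by (cases f) (auto simp: hom_set_Cont Cont_simps equivariant_maps_def compose_def fun_eq_iff PiE_def extensional_def)
next
  case (6 f X Y)
  then show ?case
    by (cases f) (auto simp: hom_set_Cont Cont_simps equivariant_maps_def compose_def fun_eq_iff PiE_def extensional_def)
next
  case (7 f X Y g Z h W)
  then show ?case
    using Cont_hom_apply(1)[OF 7(1)] by (auto simp: hom_set_Cont Cont_simps compose_def fun_eq_iff)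
qed

section \<open>Automorphism groups\<close>

lemma Aut_group_simps [simp]:
  "g \<otimes>\<^bsub>Aut_group D u\<^esub> h = g \<cdot>\<^bsub>D\<^esub> h" "\<one>\<^bsub>Aut_group D u\<^esub> = Ident D u"
  by (simp_all add: Aut_group_def)

lemma carrier_Aut_group:
  "g \<in> carrier (Aut_group D u) \<longleftrightarrow> g \<in> hom_set D u u \<and>
     (\<exists>h\<in>hom_set D u u. h \<cdot>\<^bsub>D\<^esub> g = Ident D u \<and> g \<cdot>\<^bsub>D\<^esub> h = Ident D u)"
  by (auto simp: Aut_group_def isomorphism_def inverse_arrows_def hom_set_def)

lemma (in category) group_Aut_group:
  assumes u: "u \<in> Obj C"
  shows "group (Aut_group C u)"
proof (rule groupI)
  note i = Ident_in[OF u]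
  show "\<one>\<^bsub>Aut_group C u\<^esub> \<in> carrier (Aut_group C u)"
    using i Ident_Comp[OF i] by (auto simp: carrier_Aut_group)
  show "x \<otimes>\<^bsub>Aut_group C u\<^esub> y \<in> carrier (Aut_group C u)"
    if xy: "x \<in> carrier (Aut_group C u)" "y \<in> carrier (Aut_group C u)" for x y
  proof -
    obtain x' y' where x: "x \<in> hom_set C u u" "x' \<in> hom_set C u u" "x' \<cdot> x = Ident C u" "x \<cdot> x' = Ident C u"
      and y: "y \<in> hom_set C u u" "y' \<in> hom_set C u u" "y' \<cdot> y = Ident C u" "y \<cdot> y' = Ident C u"
      using xy by (auto simp: carrier_Aut_group)
    have "(y' \<cdot> x') \<cdot> x \<cdot> y = y' \<cdot> (x' \<cdot> x) \<cdot> y"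
      using Comp_assoc[OF Comp_in[OF y(1) x(1)] x(2) y(2)] Comp_assoc[OF y(1) x(1,2)] by simp
    moreover have "(x \<cdot> y) \<cdot> y' \<cdot> x' = x \<cdot> (y \<cdot> y') \<cdot> x'"
      using Comp_assoc[OF Comp_in[OF x(2) y(2)] y(1) x(1)] Comp_assoc[OF x(2) y(2,1)] by simp
    ultimately have "(y' \<cdot> x') \<cdot> x \<cdot> y = Ident C u" "(x \<cdot> y) \<cdot> y' \<cdot> x' = Ident C u"
      using x y Ident_Comp by auto
    then show ?thesis
      using Comp_in[OF y(1) x(1)] Comp_in[OF x(2) y(2)] by (auto simp: carrier_Aut_group)
  qed
  show "x \<otimes>\<^bsub>Aut_group C u\<^esub> y \<otimes>\<^bsub>Aut_group C u\<^esub> z = x \<otimes>\<^bsub>Aut_group C u\<^esub> (y \<otimes>\<^bsub>Aut_group C u\<^esub> z)"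
    if "x \<in> carrier (Aut_group C u)" "y \<in> carrier (Aut_group C u)" "z \<in> carrier (Aut_group C u)" for x y z
    using that Comp_assoc by (auto simp: carrier_Aut_group)
  show "\<one>\<^bsub>Aut_group C u\<^esub> \<otimes>\<^bsub>Aut_group C u\<^esub> x = x" if "x \<in> carrier (Aut_group C u)" for x
    using that Ident_Comp by (auto simp: carrier_Aut_group)
  show "\<exists>y\<in>carrier (Aut_group C u). y \<otimes>\<^bsub>Aut_group C u\<^esub> x = \<one>\<^bsub>Aut_group C u\<^esub>"
    if "x \<in> carrier (Aut_group C u)" for x
    using that unfolding Aut_group_simps Bex_def carrier_Aut_group by blast
qed

lemma hom_gset_simps [simp]:
  "Pts (hom_gset D u c) = hom_set D c u"
  "g \<in> carrier (Aut_group D u) \<Longrightarrow> \<chi> \<in> hom_set D c u \<Longrightarrow> Act (hom_gset D u c) g \<chi> = g \<cdot>\<^bsub>D\<^esub> \<chi>"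
  by (simp_all add: hom_gset_def)

lemma (in category) group_action_hom_gset:
  assumes "u \<in> Obj C"
  shows "group_action (Aut_group C u) (hom_set C c u) (Act (hom_gset C u c))"
proof (rule group_actionI[OF group_Aut_group[OF assms]])
  interpret group "Aut_group C u" by (rule group_Aut_group[OF assms])
  fix g x assume g: "g \<in> carrier (Aut_group C u)"
  show "Act (hom_gset C u c) g \<in> extensional (hom_set C c u)"
    using g by (simp add: hom_gset_def)
  show gx: "Act (hom_gset C u c) g x \<in> hom_set C c u" if "x \<in> hom_set C c u"
    using g that Comp_in by (simp add: carrier_Aut_group)
  fix h assume h: "h \<in> carrier (Aut_group C u)"
  show "Act (hom_gset C u c) (g \<otimes>\<^bsub>Aut_group C u\<^esub> h) x = Act (hom_gset C u c) g (Act (hom_gset C u c) h x)"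
    if "x \<in> hom_set C c u"
    using m_closed[OF g h] g h that Comp_in[OF that, of h u] Comp_assoc[OF that]
    by (auto simp: carrier_Aut_group)
next
  interpret group "Aut_group C u" by (rule group_Aut_group[OF assms])
  show "Act (hom_gset C u c) \<one>\<^bsub>Aut_group C u\<^esub> x = x" if "x \<in> hom_set C c u" for x
    using one_closed that Ident_Comp[OF that] by simp
qed

section \<open>Ultrahomogeneous universal objects\<close>

text \<open>\<open>joint\<close> and \<open>cancel\<close> are the properties (a) and (b).
  \<open>small_hom\<close> makes every Hom(c, u) small enough to carry an object of
  \<open>Cont\<close>.\<close>

locale galois_object = cat_functor C D \<iota>
  for C :: "('c, 'b) cat" and D :: "('d, 'v) cat" and \<iota> +
  fixes u :: 'd
  assumes nonempty: "Obj C \<noteq> {}"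
    and u: "u \<in> Obj D"
    and ultrahomogeneous: "ultrahomogeneous_object C D \<iota> u"
    and universal: "universal_object C D \<iota> u"
    and joint: "\<lbrakk>a \<in> Obj C; b \<in> Obj C;
              \<xi> \<in> hom_set D (Fobj \<iota> a) u; \<chi> \<in> hom_set D (Fobj \<iota> b) u\<rbrakk> \<Longrightarrow>
              \<exists>c\<in>Obj C. \<exists>f\<in>hom_set C a c. \<exists>g\<in>hom_set C b c. \<exists>\<epsilon>\<in>hom_set D (Fobj \<iota> c) u.
                \<epsilon> \<cdot>\<^bsub>D\<^esub> Farr \<iota> f = \<xi> \<and> \<epsilon> \<cdot>\<^bsub>D\<^esub> Farr \<iota> g = \<chi>"
    and cancel: "\<lbrakk>a \<in> Obj C; b \<in> Obj C; f \<in> hom_set C a b; g \<in> hom_set C a b;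
              \<chi> \<in> hom_set D (Fobj \<iota> b) u; \<chi> \<cdot>\<^bsub>D\<^esub> Farr \<iota> f = \<chi> \<cdot>\<^bsub>D\<^esub> Farr \<iota> g\<rbrakk> \<Longrightarrow> f = g"
    and small_hom: "c \<in> Obj C \<Longrightarrow> small TYPE('v) (hom_set D (Fobj \<iota> c) u)"
begin

abbreviation "H c \<equiv> hom_set D (Fobj \<iota> c) u"
abbreviation "Hset c \<equiv> hom_gset D u (Fobj \<iota> c)"
abbreviation "G \<equiv> Aut_group D u"
abbreviation "E \<equiv> Cont_Aut C D \<iota> u"
abbreviation "F \<equiv> hom_functor C D \<iota> u"
abbreviation pull :: "'v \<Rightarrow> 'b \<Rightarrow> 'v"  (infixl \<open>\<star>\<close> 76) where
  "\<chi> \<star> f \<equiv> \<chi> \<cdot>\<^bsub>D\<^esub> Farr \<iota> f"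

lemma H_pull: "f \<in> hom_set C d c \<Longrightarrow> \<chi> \<in> H c \<Longrightarrow> \<chi> \<star> f \<in> H d"
  using Farr_in cod.Comp_in by blast

lemma H_act: "g \<in> carrier G \<Longrightarrow> \<chi> \<in> H c \<Longrightarrow> g \<cdot>\<^bsub>D\<^esub> \<chi> \<in> H c"
  using cod.Comp_in by (auto simp: carrier_Aut_group)

lemma pull_pull:
  "f \<in> hom_set C d c \<Longrightarrow> k \<in> hom_set C e d \<Longrightarrow> \<chi> \<in> H c \<Longrightarrow> (\<chi> \<star> f) \<star> k = \<chi> \<star> (f \<cdot>\<^bsub>C\<^esub> k)"
  by (simp add: Farr_Comp cod.Comp_assoc[OF Farr_in Farr_in])

lemma act_pull:
  "g \<in> carrier G \<Longrightarrow> f \<in> hom_set C d c \<Longrightarrow> \<chi> \<in> H c \<Longrightarrow> (g \<cdot>\<^bsub>D\<^esub> \<chi>) \<star> f = g \<cdot>\<^bsub>D\<^esub> (\<chi> \<star> f)"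
  using cod.Comp_assoc[OF Farr_in] by (auto simp: carrier_Aut_group)

lemma act_act:
  "g \<in> carrier G \<Longrightarrow> h \<in> carrier G \<Longrightarrow> \<chi> \<in> H c \<Longrightarrow> (g \<cdot>\<^bsub>D\<^esub> h) \<cdot>\<^bsub>D\<^esub> \<chi> = g \<cdot>\<^bsub>D\<^esub> h \<cdot>\<^bsub>D\<^esub> \<chi>"
  using cod.Comp_assoc by (auto simp: carrier_Aut_group)

lemma pull_Ident: "c \<in> Obj C \<Longrightarrow> \<chi> \<in> H c \<Longrightarrow> \<chi> \<star> Ident C c = \<chi>"
  by (simp add: Farr_Ident cod.Comp_Ident)

lemma act_one: "\<chi> \<in> H c \<Longrightarrow> Ident D u \<cdot>\<^bsub>D\<^esub> \<chi> = \<chi>"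
  by (rule cod.Ident_Comp)

lemma H_nonempty: "c \<in> Obj C \<Longrightarrow> \<exists>\<chi>. \<chi> \<in> H c"
  using universal by (auto simp: universal_object_def)

lemma ultra:
  assumes "j \<in> hom_set C a b" "\<chi> \<in> H a" "\<xi> \<in> H b"
  shows "\<exists>k\<in>carrier G. k \<cdot>\<^bsub>D\<^esub> \<chi> = \<xi> \<star> j"
  using ultrahomogeneous assms dom.hom_objects[OF assms(1)]
  unfolding ultrahomogeneous_object_def by blast

text \<open>Ultrahomogeneity for the identity arrow of \<open>c\<close>.\<close>

lemma transitive:
  assumes "c \<in> Obj C" "\<chi> \<in> H c" "\<xi> \<in> H c"
  shows "\<exists>k\<in>carrier G. k \<cdot>\<^bsub>D\<^esub> \<chi> = \<xi>"
  using ultra[OF dom.Ident_in[OF assms(1)] assms(2,3)] pull_Ident[OF assms(1,3)] by simp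

lemma cancelD:
  assumes "\<chi> \<in> H b" "f \<in> hom_set C a b" "g \<in> hom_set C a b" "\<chi> \<star> f = \<chi> \<star> g"
  shows "f = g"
  using cancel assms dom.hom_objects[OF assms(2)] by blast

lemma jointE:
  assumes "a \<in> Obj C" "b \<in> Obj C" "\<xi> \<in> H a" "\<chi> \<in> H b"
  obtains c f g \<epsilon> where "c \<in> Obj C" "f \<in> hom_set C a c" "g \<in> hom_set C b c" "\<epsilon> \<in> H c"
    "\<xi> = \<epsilon> \<star> f" "\<chi> = \<epsilon> \<star> g"
  using joint[OF assms] by blast

text \<open>Property (b) for the arrow \<open>\<chi> \<star> f\<close>. It supplies the uniqueness
  half of strictness.\<close>

lemma mono_C:
  assumes "f \<in> hom_set C d c" "m \<in> hom_set C e d" "m' \<in> hom_set C e d" "f \<cdot>\<^bsub>C\<^esub> m = f \<cdot>\<^bsub>C\<^esub> m'"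
  shows "m = m'"
proof -
  obtain \<chi> where \<chi>: "\<chi> \<in> H c" using H_nonempty dom.hom_objects(2)[OF assms(1)] by blast
  have "(\<chi> \<star> f) \<star> m = (\<chi> \<star> f) \<star> m'"
    using pull_pull[OF assms(1) _ \<chi>] assms(2-4) by simp
  then show ?thesis using cancelD[OF H_pull[OF assms(1) \<chi>] assms(2,3)] by blast
qed

text \<open>Transitivity on Hom(a, u) moves \<open>\<chi> \<star> f\<close> to
  \<open>\<xi> \<star> g\<close> by some \<open>k\<close>; (a) brings the translate of
  \<open>\<chi>\<close> by \<open>k\<close> and \<open>\<xi>\<close> to a common stage, and (b)
  turns the resulting equation over \<open>u\<close> into one in \<open>C\<close>.\<close>

lemma amalgamation: "amalgamation_property C"
  unfolding amalgamation_property_def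
proof (intro ballI)
  fix a b c f g
  assume abc: "a \<in> Obj C" "b \<in> Obj C" "c \<in> Obj C" and f: "f \<in> hom_set C a b" and g: "g \<in> hom_set C a c"
  obtain \<chi> \<xi> where \<chi>: "\<chi> \<in> H b" "\<xi> \<in> H c" using H_nonempty abc by blast
  obtain k where k: "k \<in> carrier G" "k \<cdot>\<^bsub>D\<^esub> (\<chi> \<star> f) = \<xi> \<star> g"
    using transitive[OF abc(1) H_pull[OF f \<chi>(1)] H_pull[OF g \<chi>(2)]] by blast
  obtain d f' g' \<epsilon> where d: "d \<in> Obj C" "f' \<in> hom_set C b d" "g' \<in> hom_set C c d" "\<epsilon> \<in> H d"
    "k \<cdot>\<^bsub>D\<^esub> \<chi> = \<epsilon> \<star> f'" "\<xi> = \<epsilon> \<star> g'"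
    using jointE[OF abc(2,3) H_act[OF k(1) \<chi>(1)] \<chi>(2)] by metis
  have "(\<epsilon> \<star> f') \<star> f = (\<epsilon> \<star> g') \<star> g"
    using k(2) act_pull[OF k(1) f \<chi>(1)] d(5,6) by simp
  then have "f' \<cdot>\<^bsub>C\<^esub> f = g' \<cdot>\<^bsub>C\<^esub> g"
    using cancelD[OF d(4) dom.Comp_in[OF f d(2)] dom.Comp_in[OF g d(3)]]
      pull_pull[OF d(2) f d(4)] pull_pull[OF d(3) g d(4)] by simp
  then show "\<exists>d\<in>Obj C. \<exists>f'\<in>hom_set C b d. \<exists>g'\<in>hom_set C c d. f' \<cdot>\<^bsub>C\<^esub> f = g' \<cdot>\<^bsub>C\<^esub> g"
    using d by blast
qed

lemma joint_embedding: "joint_embedding_property C"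
  unfolding joint_embedding_property_def
proof (intro ballI)
  fix a b assume ab: "a \<in> Obj C" "b \<in> Obj C"
  then obtain \<chi> \<xi> where "\<chi> \<in> H a" "\<xi> \<in> H b" using H_nonempty by blast
  from jointE[OF ab this] show "\<exists>c\<in>Obj C. hom_set C a c \<noteq> {} \<and> hom_set C b c \<noteq> {}"
    by blast
qed

section \<open>Stabilizers of arrows into \<open>u\<close> and the topology they define\<close>

sublocale group G
  using u by (rule cod.group_Aut_group)

lemma inv_act:
  assumes g: "g \<in> carrier G" and \<chi>: "\<chi> \<in> H c"
  shows "inv\<^bsub>G\<^esub> g \<cdot>\<^bsub>D\<^esub> g \<cdot>\<^bsub>D\<^esub> \<chi> = \<chi>" "g \<cdot>\<^bsub>D\<^esub> inv\<^bsub>G\<^esub> g \<cdot>\<^bsub>D\<^esub> \<chi> = \<chi>"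
  using act_act[OF inv_closed[OF g] g \<chi>] act_act[OF g inv_closed[OF g] \<chi>] l_inv[OF g] r_inv[OF g]
    act_one[OF \<chi>] by simp_all

abbreviation "stab \<chi> \<equiv> fixing_subgroup D u \<chi>"

lemma subgroup_stab: "\<chi> \<in> H c \<Longrightarrow> subgroup (stab \<chi>) G"
proof (rule subgroupI)
  assume \<chi>: "\<chi> \<in> H c"
  show "stab \<chi> \<subseteq> carrier G" by (auto simp: fixing_subgroup_def)
  have "Ident D u \<in> stab \<chi>"
    using act_one[OF \<chi>] one_closed by (simp add: fixing_subgroup_def)
  then show "stab \<chi> \<noteq> {}" by blast
  show "inv\<^bsub>G\<^esub> g \<in> stab \<chi>" if "g \<in> stab \<chi>" for g
    using that inv_act(1)[OF _ \<chi>, of g] by (auto simp: fixing_subgroup_def)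
  show "g \<otimes>\<^bsub>G\<^esub> h \<in> stab \<chi>" if "g \<in> stab \<chi>" "h \<in> stab \<chi>" for g h
    using that act_act[OF _ _ \<chi>, of g h] m_closed[of g h] by (auto simp: fixing_subgroup_def)
qed

text \<open>A translate of \<open>\<chi>\<close> has the same source as \<open>\<chi>\<close>, so
  this identity yields closure of the base under conjugation.\<close>

lemma conjugate_stab:
  assumes g: "g \<in> carrier G" and \<chi>: "\<chi> \<in> H c"
  shows "g <#\<^bsub>G\<^esub> stab \<chi> #>\<^bsub>G\<^esub> inv\<^bsub>G\<^esub> g = stab (g \<cdot>\<^bsub>D\<^esub> \<chi>)"
proof (intro Set.set_eqI iffI)
  note g\<chi> = H_act[OF g \<chi>] and ig = inv_closed[OF g]
  fix k
  show "k \<in> stab (g \<cdot>\<^bsub>D\<^esub> \<chi>)" if k: "k \<in> g <#\<^bsub>G\<^esub> stab \<chi> #>\<^bsub>G\<^esub> inv\<^bsub>G\<^esub> g"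
  proof -
    obtain h where h: "h \<in> carrier G" "h \<cdot>\<^bsub>D\<^esub> \<chi> = \<chi>" "k = (g \<otimes>\<^bsub>G\<^esub> h) \<otimes>\<^bsub>G\<^esub> inv\<^bsub>G\<^esub> g"
      using k by (auto simp: l_coset_def r_coset_def fixing_subgroup_def)
    have "k \<cdot>\<^bsub>D\<^esub> g \<cdot>\<^bsub>D\<^esub> \<chi> = (g \<otimes>\<^bsub>G\<^esub> h) \<cdot>\<^bsub>D\<^esub> inv\<^bsub>G\<^esub> g \<cdot>\<^bsub>D\<^esub> g \<cdot>\<^bsub>D\<^esub> \<chi>"
      using act_act[OF m_closed[OF g h(1)] ig g\<chi>] h(3) by simp
    also have "\<dots> = g \<cdot>\<^bsub>D\<^esub> \<chi>"
      using inv_act(1)[OF g \<chi>] act_act[OF g h(1) \<chi>] h(2) by simp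
    finally show ?thesis
      using h m_closed[OF m_closed[OF g h(1)] ig] by (simp add: fixing_subgroup_def)
  qed
  show "k \<in> g <#\<^bsub>G\<^esub> stab \<chi> #>\<^bsub>G\<^esub> inv\<^bsub>G\<^esub> g" if "k \<in> stab (g \<cdot>\<^bsub>D\<^esub> \<chi>)"
  proof -
    have k: "k \<in> carrier G" "k \<cdot>\<^bsub>D\<^esub> g \<cdot>\<^bsub>D\<^esub> \<chi> = g \<cdot>\<^bsub>D\<^esub> \<chi>" using that by (auto simp: fixing_subgroup_def)
    let ?h = "inv\<^bsub>G\<^esub> g \<otimes>\<^bsub>G\<^esub> (k \<otimes>\<^bsub>G\<^esub> g)"
    have "?h \<cdot>\<^bsub>D\<^esub> \<chi> = \<chi>"
      using act_act[OF ig m_closed[OF k(1) g] \<chi>] act_act[OF k(1) g \<chi>] k(2) inv_act(1)[OF g \<chi>] by simp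
    then have "?h \<in> stab \<chi>"
      using m_closed[OF ig m_closed[OF k(1) g]] by (simp add: fixing_subgroup_def)
    moreover have "k = (g \<otimes>\<^bsub>G\<^esub> ?h) \<otimes>\<^bsub>G\<^esub> inv\<^bsub>G\<^esub> g"
      using g k(1) ig by (metis inv_solve_left m_closed inv_solve_right)
    ultimately show ?thesis
      unfolding l_coset_def r_coset_def by blast
  qed
qed

text \<open>An automorphism fixing \<open>\<epsilon>\<close> fixes every arrow that factors through
  it, so a common stage from (a) gives a stabilizer inside a given intersection.\<close>

lemma algebraic_base: "algebraic_base G (fixing_subgroups C D \<iota> u)"
  unfolding algebraic_base_def
proof (intro conjI ballI)
  obtain c \<chi> where "c \<in> Obj C" "\<chi> \<in> H c" using nonempty H_nonempty by blast
  then show "fixing_subgroups C D \<iota> u \<noteq> {}" by (auto simp: fixing_subgroups_def)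
  fix I assume "I \<in> fixing_subgroups C D \<iota> u"
  then obtain c \<chi> where c: "c \<in> Obj C" "\<chi> \<in> H c" and I: "I = stab \<chi>"
    by (auto simp: fixing_subgroups_def)
  show "subgroup I G" using subgroup_stab[OF c(2)] I by simp
  show "g <#\<^bsub>G\<^esub> I #>\<^bsub>G\<^esub> inv\<^bsub>G\<^esub> g \<in> fixing_subgroups C D \<iota> u" if "g \<in> carrier G" for g
    using conjugate_stab[OF that c(2)] H_act[OF that c(2)] c(1) I by (auto simp: fixing_subgroups_def)
  fix J assume "J \<in> fixing_subgroups C D \<iota> u"
  then obtain d \<xi> where d: "d \<in> Obj C" "\<xi> \<in> H d" and J: "J = stab \<xi>"
    by (auto simp: fixing_subgroups_def)
  obtain e f g \<epsilon> where e: "e \<in> Obj C" "f \<in> hom_set C c e" "g \<in> hom_set C d e" "\<epsilon> \<in> H e"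
    "\<chi> = \<epsilon> \<star> f" "\<xi> = \<epsilon> \<star> g"
    using jointE[OF c(1) d(1) c(2) d(2)] by metis
  have "stab \<epsilon> \<subseteq> I \<inter> J"
    by (auto simp: fixing_subgroup_def I J e(5,6) act_pull[OF _ e(2,4), symmetric] act_pull[OF _ e(3,4), symmetric])
  then show "\<exists>L\<in>fixing_subgroups C D \<iota> u. L \<subseteq> I \<inter> J"
    using e(1,4) by (auto simp: fixing_subgroups_def)
qed

text \<open>The topology is unfolded once and for all: below, a continuous action is one in which
  each point is fixed by the stabilizer of some arrow into \<open>u\<close>.\<close>

lemma Obj_E:
  "X \<in> Obj E \<longleftrightarrow> small TYPE('v) (Pts X) \<and> group_action G (Pts X) (Act X) \<and>
     Act X \<in> extensional (carrier G) \<and>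
     (\<forall>x\<in>Pts X. \<exists>c\<in>Obj C. \<exists>\<chi>\<in>H c. \<forall>g\<in>carrier G. g \<cdot>\<^bsub>D\<^esub> \<chi> = \<chi> \<longrightarrow> Act X g x = x)"
proof -
  have "(\<exists>I\<in>fixing_subgroups C D \<iota> u. \<forall>g\<in>I. Act X g x = x) \<longleftrightarrow>
      (\<exists>c\<in>Obj C. \<exists>\<chi>\<in>H c. \<forall>g\<in>stab \<chi>. Act X g x = x)" for x
    unfolding fixing_subgroups_def by blast
  moreover have "(\<forall>g\<in>stab \<chi>. Act X g x = x) \<longleftrightarrow> (\<forall>g\<in>carrier G. g \<cdot>\<^bsub>D\<^esub> \<chi> = \<chi> \<longrightarrow> Act X g x = x)" for x \<chi>
    unfolding fixing_subgroup_def by blast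
  ultimately show ?thesis
    unfolding Cont_Aut_def Cont_simps continuous_gset_iff[OF group_axioms algebraic_base] by presburger
qed

lemma Act_simps:
  assumes "X \<in> Obj E" "x \<in> Pts X"
  shows "g \<in> carrier G \<Longrightarrow> Act X g x \<in> Pts X" "Act X (Ident D u) x = x"
    "g \<in> carrier G \<Longrightarrow> h \<in> carrier G \<Longrightarrow> Act X (g \<cdot>\<^bsub>D\<^esub> h) x = Act X g (Act X h x)"
proof -
  interpret X: group_action G "Pts X" "Act X" using assms(1) by (simp add: Obj_E)
  show "g \<in> carrier G \<Longrightarrow> Act X g x \<in> Pts X" using X.element_image assms(2) by blast
  show "Act X (Ident D u) x = x" using X.id_eq_one[symmetric] assms(2) by simp
  show "g \<in> carrier G \<Longrightarrow> h \<in> carrier G \<Longrightarrow> Act X (g \<cdot>\<^bsub>D\<^esub> h) x = Act X g (Act X h x)"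
    using X.composition_rule[OF assms(2)] by simp
qed

text \<open>The stabilizer of the point \<open>\<chi>\<close> is \<open>stab \<chi>\<close>, itself
  a member of the base, so continuity is immediate.\<close>

lemma Hset_in:
  assumes c: "c \<in> Obj C"
  shows "Hset c \<in> Obj E"
  unfolding Obj_E
proof (intro conjI ballI)
  show "small TYPE('v) (Pts (Hset c))" using small_hom[OF c] by simp
  show "group_action G (Pts (Hset c)) (Act (Hset c))"
    using cod.group_action_hom_gset[OF u] by simp
  show "Act (Hset c) \<in> extensional (carrier G)" by (simp add: hom_gset_def)
  fix \<chi> assume "\<chi> \<in> Pts (Hset c)"
  then have \<chi>: "\<chi> \<in> H c" by simp
  then have "\<forall>g\<in>carrier G. g \<cdot>\<^bsub>D\<^esub> \<chi> = \<chi> \<longrightarrow> Act (Hset c) g \<chi> = \<chi>" by simp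
  with c \<chi> show "\<exists>c'\<in>Obj C. \<exists>\<xi>\<in>H c'. \<forall>g\<in>carrier G. g \<cdot>\<^bsub>D\<^esub> \<xi> = \<xi> \<longrightarrow> Act (Hset c) g \<chi> = \<chi>"
    by blast
qed

lemma transitive_Hset:
  assumes "c \<in> Obj C" shows "transitive_gset G (Hset c)"
  unfolding transitive_gset_def
proof (intro conjI transitive_action.intro transitive_action_axioms.intro)
  show "Pts (Hset c) \<noteq> {}" using H_nonempty[OF assms] by auto
  show "group_action G (Pts (Hset c)) (Act (Hset c))"
    using Hset_in[OF assms] by (simp add: Obj_E)
  show "\<exists>g\<in>carrier G. Act (Hset c) g \<chi> = \<xi>" if "\<chi> \<in> Pts (Hset c)" "\<xi> \<in> Pts (Hset c)" for \<chi> \<xi>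
    using transitive[OF assms, of \<chi> \<xi>] that by auto
qed

section \<open>The functor Hom(-, u) into continuous actions\<close>

lemma F_simps: "Fobj F c = Hset c" "f \<in> hom_set C d c \<Longrightarrow> \<chi> \<in> H c \<Longrightarrow> tmap (Farr F f) \<chi> = \<chi> \<star> f"
  by (auto simp: hom_functor_def hom_set_def)

lemma F_in:
  assumes f: "f \<in> hom_set C d c"
  shows "Farr F f \<in> hom_set E (Hset c) (Hset d)"
proof -
  have "Dom C f = d" "Cod C f = c" using f by (auto simp: hom_set_def)
  then show ?thesis
    using Hset_in[OF dom.hom_objects(1)[OF f]] Hset_in[OF dom.hom_objects(2)[OF f]]
      H_pull[OF f] act_pull[OF _ f] H_act
    by (simp add: hom_set_Cont Cont_Aut_def hom_functor_def equivariant_maps_def)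
qed

lemma E_apply:
  assumes "m \<in> hom_set E X Y" "x \<in> Pts X"
  shows "tmap m x \<in> Pts Y" "g \<in> carrier G \<Longrightarrow> tmap m (Act X g x) = Act Y g (tmap m x)"
    "tmap (n \<cdot>\<^bsub>E\<^esub> m) x = tmap n (tmap m x)"
  using Cont_hom_apply[OF assms[unfolded Cont_Aut_def]] by (simp_all add: Cont_Aut_def)

lemma E_eqI:
  assumes "m \<in> hom_set E X Y" "m' \<in> hom_set E X Y" "\<And>x. x \<in> Pts X \<Longrightarrow> tmap m x = tmap m' x"
  shows "m = m'"
  using assms unfolding Cont_Aut_def by (rule Cont_hom_eqI)

lemma category_E: "category E"
  unfolding Cont_Aut_def by (rule category_Cont)

lemma hom_set_E:
  "m \<in> hom_set E X Y \<longleftrightarrow> tdom m = X \<and> tcod m = Y \<and> X \<in> Obj E \<and> Y \<in> Obj E \<and>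
     tmap m \<in> Pts X \<rightarrow>\<^sub>E Pts Y \<and> (\<forall>g\<in>carrier G. \<forall>x\<in>Pts X. tmap m (Act X g x) = Act Y g (tmap m x))"
  unfolding Cont_Aut_def hom_set_Cont by (auto simp: equivariant_maps_def)

lemma F_functor: "cat_functor (op_cat C) E F"
proof (intro cat_functor.intro category_E dom.category_op_cat, unfold_locales)
  interpret E: category E by (rule category_E)
  show "Fobj F a \<in> Obj E" if "a \<in> Obj (op_cat C)" for a
    using that Hset_in by (simp add: F_simps)
  show "Farr F f \<in> hom_set E (Fobj F a) (Fobj F b)" if "f \<in> hom_set (op_cat C) a b" for f a b
    using that F_in by (simp add: F_simps)
  show "Farr F (Ident (op_cat C) a) = Ident E (Fobj F a)" if "a \<in> Obj (op_cat C)" for a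
  proof (rule E_eqI)
    have a: "a \<in> Obj C" using that by simp
    show "Farr F (Ident (op_cat C) a) \<in> hom_set E (Hset a) (Hset a)"
      using F_in[OF dom.Ident_in[OF a]] by simp
    show "Ident E (Fobj F a) \<in> hom_set E (Hset a) (Hset a)"
      using E.Ident_in[OF Hset_in[OF a]] by (simp add: F_simps)
    show "tmap (Farr F (Ident (op_cat C) a)) x = tmap (Ident E (Fobj F a)) x" if "x \<in> Pts (Hset a)" for x
      using that pull_Ident[OF a] F_simps(2)[OF dom.Ident_in[OF a]]
      by (simp add: F_simps Cont_Aut_def Cont_simps)
  qed
  show "Farr F (g \<cdot>\<^bsub>op_cat C\<^esub> f) = Farr F g \<cdot>\<^bsub>E\<^esub> Farr F f"
    if fg: "f \<in> hom_set (op_cat C) a b" "g \<in> hom_set (op_cat C) b c" for f a b g c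
  proof (rule E_eqI)
    have f: "f \<in> hom_set C b a" and g: "g \<in> hom_set C c b" using fg by auto
    show "Farr F (g \<cdot>\<^bsub>op_cat C\<^esub> f) \<in> hom_set E (Hset a) (Hset c)"
      using F_in[OF dom.Comp_in[OF g f]] by simp
    show "Farr F g \<cdot>\<^bsub>E\<^esub> Farr F f \<in> hom_set E (Hset a) (Hset c)"
      by (rule E.Comp_in[OF F_in[OF f] F_in[OF g]])
    show "tmap (Farr F (g \<cdot>\<^bsub>op_cat C\<^esub> f)) x = tmap (Farr F g \<cdot>\<^bsub>E\<^esub> Farr F f) x" if "x \<in> Pts (Hset a)" for x
      using that by (simp add: E_apply(3)[OF F_in[OF f]] F_simps(2)[OF f] F_simps(2)[OF g H_pull[OF f]]
          F_simps(2)[OF dom.Comp_in[OF g f]] pull_pull[OF f g])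
  qed
qed

lemma F_functor_transitive: "cat_functor (op_cat C) (full_subcat E {X. transitive_gset G X}) F"
  using F_functor by (rule cat_functor_full_subcat) (simp add: F_simps transitive_Hset)

section \<open>Equivariant maps out of \<open>Hom(c, u)\<close>\<close>

lemma E_hom_H:
  assumes "m \<in> hom_set E (Hset c) X" "\<chi> \<in> H c"
  shows "tmap m \<chi> \<in> Pts X" "g \<in> carrier G \<Longrightarrow> tmap m (g \<cdot>\<^bsub>D\<^esub> \<chi>) = Act X g (tmap m \<chi>)"
  using E_apply(1,2)[OF assms(1), of \<chi>] assms(2) by auto

lemma E_hom_pull:
  assumes "m \<in> hom_set E (Hset d) X" "f \<in> hom_set C d c" "\<chi> \<in> H c"
  shows "tmap (m \<cdot>\<^bsub>E\<^esub> Farr F f) \<chi> = tmap m (\<chi> \<star> f)"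
  using E_apply(3)[OF F_in[OF assms(2)], of \<chi>] assms(3) F_simps(2)[OF assms(2,3)] by simp

text \<open>Hom(c, u) is a single orbit, so one value determines an equivariant map on it.\<close>

lemma E_hom_H_eqI:
  assumes c: "c \<in> Obj C" and m: "m \<in> hom_set E (Hset c) X" "m' \<in> hom_set E (Hset c) X"
    and \<chi>: "\<chi> \<in> H c" "tmap m \<chi> = tmap m' \<chi>"
  shows "m = m'"
proof (rule E_eqI[OF m])
  fix \<xi> assume "\<xi> \<in> Pts (Hset c)"
  then obtain g where "g \<in> carrier G" "g \<cdot>\<^bsub>D\<^esub> \<chi> = \<xi>" using transitive[OF c \<chi>(1)] by auto
  then show "tmap m \<xi> = tmap m' \<xi>"
    using E_hom_H(2)[OF m(1) \<chi>(1)] E_hom_H(2)[OF m(2) \<chi>(1)] \<chi>(2) by metis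
qed

text \<open>Hom(c, u) is the coset space of \<open>stab \<chi>\<close>, so sending the translate of
  \<open>\<chi>\<close> by \<open>g\<close> to the translate of \<open>x\<close> by \<open>g\<close>
  is well defined once \<open>stab \<chi>\<close> fixes \<open>x\<close>. With
  \<open>E_hom_H_eqI\<close>, maps from \<open>Hset c\<close> to \<open>X\<close> amount to points
  of \<open>X\<close> fixed by \<open>stab \<chi>\<close>.\<close>

lemma E_hom_H_exists:
  assumes c: "c \<in> Obj C" and \<chi>: "\<chi> \<in> H c" and X: "X \<in> Obj E" and x: "x \<in> Pts X"
    and fix_x: "\<And>g. g \<in> carrier G \<Longrightarrow> g \<cdot>\<^bsub>D\<^esub> \<chi> = \<chi> \<Longrightarrow> Act X g x = x"
  shows "\<exists>m\<in>hom_set E (Hset c) X. tmap m \<chi> = x"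
proof -
  define \<alpha> where "\<alpha> = (\<lambda>\<xi>\<in>H c. Act X (SOME g. g \<in> carrier G \<and> g \<cdot>\<^bsub>D\<^esub> \<chi> = \<xi>) x)"
  have \<alpha>: "\<alpha> (g \<cdot>\<^bsub>D\<^esub> \<chi>) = Act X g x" if g: "g \<in> carrier G" for g
  proof -
    define k where "k = (SOME k. k \<in> carrier G \<and> k \<cdot>\<^bsub>D\<^esub> \<chi> = g \<cdot>\<^bsub>D\<^esub> \<chi>)"
    have k: "k \<in> carrier G" "k \<cdot>\<^bsub>D\<^esub> \<chi> = g \<cdot>\<^bsub>D\<^esub> \<chi>"
      using someI[of "\<lambda>k. k \<in> carrier G \<and> k \<cdot>\<^bsub>D\<^esub> \<chi> = g \<cdot>\<^bsub>D\<^esub> \<chi>" g] g by (auto simp: k_def)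
    \<comment> \<open>\<open>k\<close> is the group element selected in \<open>\<alpha>\<close>, in
      general different from \<open>g\<close>. Both move \<open>\<chi>\<close> to the same point, so
      the inverse of \<open>k\<close> followed by precomposition with \<open>g\<close> stabilizes
      \<open>\<chi>\<close> and hence fixes \<open>x\<close>.\<close>
    have kg: "inv\<^bsub>G\<^esub> k \<cdot>\<^bsub>D\<^esub> g \<in> carrier G" using m_closed[of "inv\<^bsub>G\<^esub> k" g] k(1) g by simp
    have "(inv\<^bsub>G\<^esub> k \<cdot>\<^bsub>D\<^esub> g) \<cdot>\<^bsub>D\<^esub> \<chi> = \<chi>"
      using act_act[of "inv\<^bsub>G\<^esub> k" g \<chi> c] k g \<chi> inv_act(1)[OF k(1) \<chi>] by simp
    then have "Act X (inv\<^bsub>G\<^esub> k \<cdot>\<^bsub>D\<^esub> g) x = x" using fix_x kg by blast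
    then have "Act X k x = Act X (k \<cdot>\<^bsub>D\<^esub> inv\<^bsub>G\<^esub> k \<cdot>\<^bsub>D\<^esub> g) x"
      using Act_simps(3)[OF X x k(1) kg] by simp
    moreover have "k \<cdot>\<^bsub>D\<^esub> inv\<^bsub>G\<^esub> k \<cdot>\<^bsub>D\<^esub> g = g"
      using m_assoc[of k "inv\<^bsub>G\<^esub> k" g] k(1) g r_inv[OF k(1)] l_one[OF g] by simp
    ultimately show ?thesis using H_act[OF g \<chi>] by (simp add: \<alpha>_def k_def)
  qed
  have "\<alpha> \<xi> \<in> Pts X \<and> (\<forall>g\<in>carrier G. \<alpha> (g \<cdot>\<^bsub>D\<^esub> \<xi>) = Act X g (\<alpha> \<xi>))" if "\<xi> \<in> H c" for \<xi>
  proof -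
    obtain h where h: "h \<in> carrier G" "h \<cdot>\<^bsub>D\<^esub> \<chi> = \<xi>" using transitive[OF c \<chi> \<open>\<xi> \<in> H c\<close>] by blast
    have "\<alpha> (g \<cdot>\<^bsub>D\<^esub> \<xi>) = Act X g (\<alpha> \<xi>)" if g: "g \<in> carrier G" for g
      using \<alpha>[OF m_closed[OF g h(1)]] act_act[OF g h(1) \<chi>] Act_simps(3)[OF X x g h(1)] \<alpha>[OF h(1)] h(2)
      by simp
    then show ?thesis using \<alpha>[OF h(1)] h(2) Act_simps(1)[OF X x h(1)] by simp
  qed
  moreover have "\<alpha> \<in> extensional (H c)" by (simp add: \<alpha>_def)
  ultimately have "TMap (Hset c) \<alpha> X \<in> hom_set E (Hset c) X"
    using Hset_in[OF c] X by (auto simp: hom_set_E PiE_def)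
  moreover have "\<alpha> \<chi> = x"
    using \<alpha>[OF one_closed] act_one[OF \<chi>] Act_simps(2)[OF X x] by simp
  ultimately show ?thesis by (intro bexI) auto
qed

lemma E_hom_H_hits:
  assumes X: "X \<in> Obj E" and x: "x \<in> Pts X"
  shows "\<exists>c\<in>Obj C. \<exists>\<chi>\<in>H c. \<exists>m\<in>hom_set E (Hset c) X. tmap m \<chi> = x"
proof -
  obtain c \<chi> where "c \<in> Obj C" "\<chi> \<in> H c" "\<forall>g\<in>carrier G. g \<cdot>\<^bsub>D\<^esub> \<chi> = \<chi> \<longrightarrow> Act X g x = x"
    using X x unfolding Obj_E by meson
  then show ?thesis using E_hom_H_exists[OF _ _ X x] by metis
qed

lemma faithful: "faithful_functor (op_cat C) F"
  unfolding faithful_functor_def inj_on_def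
proof (intro ballI impI)
  fix a b f g
  assume ab: "a \<in> Obj (op_cat C)" "b \<in> Obj (op_cat C)" and "f \<in> hom_set (op_cat C) a b" "g \<in> hom_set (op_cat C) a b"
    and eq: "Farr F f = Farr F g"
  then have fg: "f \<in> hom_set C b a" "g \<in> hom_set C b a" by auto
  obtain \<chi> where \<chi>: "\<chi> \<in> H a" using H_nonempty ab(1) by auto
  show "f = g"
    using cancelD[OF \<chi> fg] F_simps(2)[OF fg(1) \<chi>] F_simps(2)[OF fg(2) \<chi>] eq by simp
qed

text \<open>
  Both implications rest on the fact that, for \<open>\<chi>\<close> in \<open>Hom(c, u)\<close>, \<open>g\<close> equalizes all pairs equalized
  by \<open>f\<close> if and only if \<open>\<chi> \<circ> f \<mapsto> \<chi> \<circ> g\<close> extends to an equivariant map.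
\<close>
lemma full_iff_strict:
  "full_functor (op_cat C) E F \<longleftrightarrow> (\<forall>f\<in>Arr C. strict_monomorphism C f)"
proof
  assume full: "full_functor (op_cat C) E F"
  show "\<forall>f\<in>Arr C. strict_monomorphism C f"
  proof
    fix f assume fA: "f \<in> Arr C"
    define d c where "d = Dom C f" and "c = Cod C f"
    have f: "f \<in> hom_set C d c" using fA by (simp add: hom_set_def d_def c_def)
    note dc = dom.hom_objects(1,2)[OF f]
    have "\<exists>!m. m \<in> hom_set C e d \<and> f \<cdot>\<^bsub>C\<^esub> m = g"
      if e: "e \<in> Obj C" and g: "g \<in> hom_set C e c"
        and eq: "\<forall>x\<in>Obj C. \<forall>h\<in>hom_set C c x. \<forall>k\<in>hom_set C c x. h \<cdot>\<^bsub>C\<^esub> f = k \<cdot>\<^bsub>C\<^esub> f \<longrightarrow> h \<cdot>\<^bsub>C\<^esub> g = k \<cdot>\<^bsub>C\<^esub> g" for e g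
    proof -
      obtain \<chi> where \<chi>: "\<chi> \<in> H c" using H_nonempty dc by blast
      have "\<exists>m\<in>hom_set E (Hset d) (Hset e). tmap m (\<chi> \<star> f) = \<chi> \<star> g"
      proof (rule E_hom_H_exists[OF dc(1) H_pull[OF f \<chi>] Hset_in[OF e]])
        show "\<chi> \<star> g \<in> Pts (Hset e)" using H_pull[OF g \<chi>] by simp
        fix s assume s: "s \<in> carrier G" "s \<cdot>\<^bsub>D\<^esub> (\<chi> \<star> f) = \<chi> \<star> f"
        \<comment> \<open>Testing in \<open>C\<close>: at a common stage of \<open>\<chi>\<close>
          and its translate by \<open>s\<close>, the automorphism becomes a parallel pair
          \<open>h\<close>, \<open>k\<close>, and the fact that \<open>s\<close> fixes
          \<open>\<chi> \<star> f\<close> says that \<open>h\<close> and \<open>k\<close> agree on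
          \<open>f\<close>.\<close>
        obtain x h k \<epsilon> where x: "x \<in> Obj C" "h \<in> hom_set C c x" "k \<in> hom_set C c x" "\<epsilon> \<in> H x"
          "s \<cdot>\<^bsub>D\<^esub> \<chi> = \<epsilon> \<star> h" "\<chi> = \<epsilon> \<star> k"
          using jointE[OF dc(2,2) H_act[OF s(1) \<chi>] \<chi>] by metis
        have "(\<epsilon> \<star> h) \<star> f = (\<epsilon> \<star> k) \<star> f"
          using s(2) act_pull[OF s(1) f \<chi>] x(5,6) by metis
        then have "h \<cdot>\<^bsub>C\<^esub> f = k \<cdot>\<^bsub>C\<^esub> f"
          using cancelD[OF x(4) dom.Comp_in[OF f x(2)] dom.Comp_in[OF f x(3)]]
            pull_pull[OF x(2) f x(4)] pull_pull[OF x(3) f x(4)] by simp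
        then have "h \<cdot>\<^bsub>C\<^esub> g = k \<cdot>\<^bsub>C\<^esub> g" using eq x by blast
        then have "(\<epsilon> \<star> h) \<star> g = (\<epsilon> \<star> k) \<star> g"
          using pull_pull[OF x(2) g x(4)] pull_pull[OF x(3) g x(4)] by simp
        then have "(s \<cdot>\<^bsub>D\<^esub> \<chi>) \<star> g = \<chi> \<star> g" unfolding x(5) x(6)[symmetric] .
        then show "Act (Hset e) s (\<chi> \<star> g) = \<chi> \<star> g"
          using act_pull[OF s(1) g \<chi>] s(1) H_pull[OF g \<chi>] by simp
      qed
      then obtain \<alpha> where \<alpha>: "\<alpha> \<in> hom_set E (Fobj F d) (Fobj F e)" "tmap \<alpha> (\<chi> \<star> f) = \<chi> \<star> g"
        by (auto simp: F_simps)
      then obtain m where m: "m \<in> hom_set C e d" "Farr F m = \<alpha>"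
        using full dc(1) e unfolding full_functor_def op_cat_simps hom_set_op_cat by blast
      have "\<chi> \<star> (f \<cdot>\<^bsub>C\<^esub> m) = \<chi> \<star> g"
        using F_simps(2)[OF m(1) H_pull[OF f \<chi>]] pull_pull[OF f m(1) \<chi>] m(2) \<alpha>(2) by simp
      then have "f \<cdot>\<^bsub>C\<^esub> m = g" using cancelD[OF \<chi> dom.Comp_in[OF m(1) f] g] by blast
      then show ?thesis using m(1) mono_C[OF f] by blast
    qed
    then show "strict_monomorphism C f"
      unfolding strict_monomorphism_def d_def c_def using fA by blast
  qed
next
  assume strict: "\<forall>f\<in>Arr C. strict_monomorphism C f"
  show "full_functor (op_cat C) E F"
    unfolding full_functor_def
  proof (intro ballI)
    fix d e \<alpha>
    assume "d \<in> Obj (op_cat C)" "e \<in> Obj (op_cat C)" "\<alpha> \<in> hom_set E (Fobj F d) (Fobj F e)"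
    then have de: "d \<in> Obj C" "e \<in> Obj C" and \<alpha>: "\<alpha> \<in> hom_set E (Hset d) (Hset e)"
      by (auto simp: F_simps)
    obtain \<xi> where \<xi>: "\<xi> \<in> H d" using H_nonempty de by blast
    have \<alpha>\<xi>: "tmap \<alpha> \<xi> \<in> H e" using E_hom_H(1)[OF \<alpha> \<xi>] by simp
    \<comment> \<open>At a common stage of \<open>\<xi>\<close> and its image,
      \<open>\<alpha>\<close> sends \<open>\<epsilon> \<star> f\<close> to
      \<open>\<epsilon> \<star> g\<close>, so a factorization of \<open>g\<close> through
      \<open>f\<close> is exactly an arrow inducing \<open>\<alpha>\<close>.\<close>
    obtain c f g \<epsilon> where c: "c \<in> Obj C" "f \<in> hom_set C d c" "g \<in> hom_set C e c" "\<epsilon> \<in> H c"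
      "\<xi> = \<epsilon> \<star> f" "tmap \<alpha> \<xi> = \<epsilon> \<star> g"
      using jointE[OF de \<xi> \<alpha>\<xi>] by metis
    have "h \<cdot>\<^bsub>C\<^esub> g = k \<cdot>\<^bsub>C\<^esub> g"
      if h: "h \<in> hom_set C c x" and k: "k \<in> hom_set C c x" and eq: "h \<cdot>\<^bsub>C\<^esub> f = k \<cdot>\<^bsub>C\<^esub> f" for x h k
    proof -
      \<comment> \<open>The reverse translation: ultrahomogeneity replaces \<open>h\<close> and
        \<open>k\<close> by automorphisms \<open>s\<close> and \<open>t\<close>. These agree at
        \<open>\<xi> = \<epsilon> \<star> f\<close>, hence by equivariance of
        \<open>\<alpha>\<close> also at \<open>\<epsilon> \<star> g\<close>.\<close>
      obtain \<zeta> where \<zeta>: "\<zeta> \<in> H x" using H_nonempty dom.hom_objects(2)[OF h] by blast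
      obtain s t where s: "s \<in> carrier G" "s \<cdot>\<^bsub>D\<^esub> \<epsilon> = \<zeta> \<star> h" and t: "t \<in> carrier G" "t \<cdot>\<^bsub>D\<^esub> \<epsilon> = \<zeta> \<star> k"
        using ultra[OF h c(4) \<zeta>] ultra[OF k c(4) \<zeta>] by blast
      have "s \<cdot>\<^bsub>D\<^esub> \<xi> = t \<cdot>\<^bsub>D\<^esub> \<xi>"
        using act_pull[OF s(1) c(2,4)] act_pull[OF t(1) c(2,4)] c(5) s(2) t(2)
          pull_pull[OF h c(2) \<zeta>] pull_pull[OF k c(2) \<zeta>] eq by simp
      then have "Act (Hset e) s (tmap \<alpha> \<xi>) = Act (Hset e) t (tmap \<alpha> \<xi>)"
        using E_hom_H(2)[OF \<alpha> \<xi> s(1)] E_hom_H(2)[OF \<alpha> \<xi> t(1)] by simp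
      then have "s \<cdot>\<^bsub>D\<^esub> (\<epsilon> \<star> g) = t \<cdot>\<^bsub>D\<^esub> (\<epsilon> \<star> g)"
        using s(1) t(1) \<alpha>\<xi> c(6) by simp
      then have "\<zeta> \<star> (h \<cdot>\<^bsub>C\<^esub> g) = \<zeta> \<star> (k \<cdot>\<^bsub>C\<^esub> g)"
        using act_pull[OF s(1) c(3,4)] act_pull[OF t(1) c(3,4)] s(2) t(2)
          pull_pull[OF h c(3) \<zeta>] pull_pull[OF k c(3) \<zeta>] by simp
      then show ?thesis
        using cancelD[OF \<zeta> dom.Comp_in[OF c(3) h] dom.Comp_in[OF c(3) k]] by blast
    qed
    moreover have "Dom C f = d" "Cod C f = c" "strict_monomorphism C f"
      using c(2) strict by (auto simp: hom_set_def)
    ultimately obtain m where m: "m \<in> hom_set C e d" "f \<cdot>\<^bsub>C\<^esub> m = g"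
      using de(2) c(3) unfolding strict_monomorphism_def by blast
    have "tmap (Farr F m) \<xi> = tmap \<alpha> \<xi>"
      using F_simps(2)[OF m(1) \<xi>] c(5,6) pull_pull[OF c(2) m(1) c(4)] m(2) by simp
    then have "Farr F m = \<alpha>"
      using E_hom_H_eqI[OF de(1) F_in[OF m(1)] \<alpha> \<xi>] by blast
    then show "\<exists>f\<in>hom_set (op_cat C) d e. Farr F f = \<alpha>" using m(1) by auto
  qed
qed

section \<open>The equivalence with sheaves\<close>

definition base_point :: "'c \<Rightarrow> 'v" where
  "base_point c = (SOME \<chi>. \<chi> \<in> H c)"

lemma base_point: "c \<in> Obj C \<Longrightarrow> base_point c \<in> H c"
  unfolding base_point_def using H_nonempty by (rule someI_ex)

text \<open>
  An equivariant map on the transitive action \<open>Hom(c, u)\<close> is encoded by its value at one point.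
\<close>
sublocale nerve: encoded_nerve "op_cat C" E F "\<lambda>X c m. tmap m (base_point c)"
proof (intro encoded_nerve.intro F_functor encoded_nerve_axioms.intro)
  fix X c assume X: "X \<in> Obj E" and "c \<in> Obj (op_cat C)"
  then have c: "c \<in> Obj C" by simp
  show "inj_on (\<lambda>m. tmap m (base_point c)) (hom_set E (Fobj F c) X)"
    by (rule inj_onI) (auto simp: F_simps intro: E_hom_H_eqI[OF c _ _ base_point[OF c]])
  have "(\<lambda>m. tmap m (base_point c)) ` hom_set E (Fobj F c) X \<subseteq> Pts X"
    using E_hom_H(1)[OF _ base_point[OF c]] by (auto simp: F_simps)
  then show "small TYPE('v) ((\<lambda>m. tmap m (base_point c)) ` hom_set E (Fobj F c) X)"
    using X small_mono by (auto simp: Obj_E)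
qed

text \<open>Parallel to the first half of \<open>full_iff_strict\<close>, with an arbitrary action
  \<open>X\<close> for \<open>Hset e\<close> and a point \<open>tmap m \<chi>\<close> for
  \<open>\<chi> \<star> g\<close>: an automorphism fixing \<open>\<chi> \<star> f\<close> has to fix
  that point.\<close>

lemma nerve_sheaf:
  assumes X: "X \<in> Obj E"
  shows "is_sheaf (op_cat C) (atomic_topology (op_cat C)) (nerve.nerve_presheaf X)"
proof -
  let ?N = "nerve.nerve_presheaf X"
  let ?e = "\<lambda>c m. tmap m (base_point c)"
  have N: "cat_functor C Set_cat ?N" using nerve.nerve_presheaf_functor[OF X] by simp
  have Nobj: "Fobj ?N c = ?e c ` hom_set E (Hset c) X" if "c \<in> Obj C" for c
    using nerve.Fobj_nerve_presheaf[of c X] that by (simp add: F_simps)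
  have Narr: "tmap (Farr ?N f) (?e d m) = ?e c (m \<cdot>\<^bsub>E\<^esub> Farr F f)"
    "m \<cdot>\<^bsub>E\<^esub> Farr F f \<in> hom_set E (Hset c) X"
    if "f \<in> hom_set C d c" "m \<in> hom_set E (Hset d) X" for f d c m
    using nerve.Farr_nerve_presheaf[OF X, of f c d m] nerve.K_precomp[of f c d m X] that
    by (simp_all add: F_simps)
  have e_eq: "?e c m = ?e c m' \<longleftrightarrow> m = m'"
    if "c \<in> Obj C" "m \<in> hom_set E (Hset c) X" "m' \<in> hom_set E (Hset c) X" for c m m'
    using E_hom_H_eqI[OF that base_point[OF that(1)]] by blast
  show ?thesis
    unfolding is_sheaf_atomic_iff[OF dom.category_axioms amalgamation N]
  proof (intro ballI impI)
    fix f z assume fA: "f \<in> Arr C" and z: "z \<in> Fobj ?N (Cod C f)"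
      and eq: "\<forall>x\<in>Obj C. \<forall>h\<in>hom_set C (Cod C f) x. \<forall>k\<in>hom_set C (Cod C f) x.
          h \<cdot>\<^bsub>C\<^esub> f = k \<cdot>\<^bsub>C\<^esub> f \<longrightarrow> tmap (Farr ?N h) z = tmap (Farr ?N k) z"
    define d c where "d = Dom C f" and "c = Cod C f"
    have f: "f \<in> hom_set C d c" using fA by (simp add: hom_set_def d_def c_def)
    note dc = dom.hom_objects(1,2)[OF f]
    obtain m where m: "m \<in> hom_set E (Hset c) X" "z = ?e c m"
      using z dc Nobj by (auto simp: c_def)
    obtain \<chi> where \<chi>: "\<chi> \<in> H c" using H_nonempty dc by blast
    have "\<exists>y\<in>hom_set E (Hset d) X. tmap y (\<chi> \<star> f) = tmap m \<chi>"
    proof (rule E_hom_H_exists[OF dc(1) H_pull[OF f \<chi>] X E_hom_H(1)[OF m(1) \<chi>]])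
      fix s assume s: "s \<in> carrier G" "s \<cdot>\<^bsub>D\<^esub> (\<chi> \<star> f) = \<chi> \<star> f"
      obtain x h k \<epsilon> where x: "x \<in> Obj C" "h \<in> hom_set C c x" "k \<in> hom_set C c x" "\<epsilon> \<in> H x"
        "s \<cdot>\<^bsub>D\<^esub> \<chi> = \<epsilon> \<star> h" "\<chi> = \<epsilon> \<star> k"
        using jointE[OF dc(2,2) H_act[OF s(1) \<chi>] \<chi>] by metis
      have "(\<epsilon> \<star> h) \<star> f = (\<epsilon> \<star> k) \<star> f"
        using s(2) act_pull[OF s(1) f \<chi>] x(5,6) by metis
      then have "h \<cdot>\<^bsub>C\<^esub> f = k \<cdot>\<^bsub>C\<^esub> f"
        using cancelD[OF x(4) dom.Comp_in[OF f x(2)] dom.Comp_in[OF f x(3)]]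
          pull_pull[OF x(2) f x(4)] pull_pull[OF x(3) f x(4)] by simp
      then have "tmap (Farr ?N h) z = tmap (Farr ?N k) z"
        using eq x(1-3) unfolding c_def by blast
      then have "m \<cdot>\<^bsub>E\<^esub> Farr F h = m \<cdot>\<^bsub>E\<^esub> Farr F k"
        using Narr[OF x(2) m(1)] Narr[OF x(3) m(1)] m(2) e_eq[OF x(1)] by metis
      then have "tmap m (s \<cdot>\<^bsub>D\<^esub> \<chi>) = tmap m \<chi>"
        using E_hom_pull[OF m(1) x(2,4)] E_hom_pull[OF m(1) x(3,4)] x(5,6) by metis
      then show "Act X s (tmap m \<chi>) = tmap m \<chi>"
        using E_hom_H(2)[OF m(1) \<chi> s(1)] by simp
    qed
    then obtain y where y: "y \<in> hom_set E (Hset d) X" "tmap y (\<chi> \<star> f) = tmap m \<chi>" by blast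
    have iff: "tmap (Farr ?N f) (?e d y') = z \<longleftrightarrow> y' = y" if y': "y' \<in> hom_set E (Hset d) X" for y'
    proof -
      have "tmap (Farr ?N f) (?e d y') = z \<longleftrightarrow> y' \<cdot>\<^bsub>E\<^esub> Farr F f = m"
        using Narr[OF f y'] m e_eq[OF dc(2)] by metis
      \<comment> \<open>Maps out of Hom(c, u) are compared at the single point
        \<open>\<chi>\<close>, where precomposition with \<open>Farr F f\<close> means evaluation at
        \<open>\<chi> \<star> f\<close>.\<close>
      also have "\<dots> \<longleftrightarrow> tmap y' (\<chi> \<star> f) = tmap y (\<chi> \<star> f)"
        using E_hom_H_eqI[OF dc(2) Narr(2)[OF f y'] m(1) \<chi>] E_hom_pull[OF y' f \<chi>] y(2) by metis
      also have "\<dots> \<longleftrightarrow> y' = y"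
        using E_hom_H_eqI[OF dc(1) y' y(1) H_pull[OF f \<chi>]] by blast
      finally show ?thesis .
    qed
    show "\<exists>!y. y \<in> Fobj ?N (Dom C f) \<and> tmap (Farr ?N f) y = z"
      unfolding d_def[symmetric] Nobj[OF dc(1)]
      by (rule ex1I[of _ "?e d y"]) (use y(1) iff in auto)
  qed
qed

section \<open>Full faithfulness and essential surjectivity of the nerve\<close>

lemma nerve_faithful: "faithful_functor E nerve.nerve"
proof (rule nerve.nerve_faithful)
  fix X Y t t'
  assume t: "t \<in> hom_set E X Y" "t' \<in> hom_set E X Y"
    and eq: "\<And>c m. c \<in> Obj (op_cat C) \<Longrightarrow> m \<in> hom_set E (Fobj F c) X \<Longrightarrow> t \<cdot>\<^bsub>E\<^esub> m = t' \<cdot>\<^bsub>E\<^esub> m"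
  show "t = t'"
  proof (rule E_eqI[OF t])
    fix x assume x: "x \<in> Pts X"
    have "X \<in> Obj E" using t(1) by (simp add: hom_set_E)
    then obtain c \<chi> m where c: "c \<in> Obj C" "\<chi> \<in> H c" "m \<in> hom_set E (Hset c) X" "tmap m \<chi> = x"
      using E_hom_H_hits[OF _ x] by blast
    then have "t \<cdot>\<^bsub>E\<^esub> m = t' \<cdot>\<^bsub>E\<^esub> m" using eq by (simp add: F_simps)
    then show "tmap t x = tmap t' x"
      using E_apply(3)[OF c(3), of \<chi>] c(2,4) by (metis hom_gset_simps(1))
  qed
qed

lemma nerve_full: "full_functor E (functor_cat (op_cat (op_cat C)) Set_cat) nerve.nerve"
proof (rule nerve.nerve_full)
  fix X Y \<theta>
  assume X: "X \<in> Obj E" and Y: "Y \<in> Obj E"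
    and in': "\<And>c m. c \<in> Obj (op_cat C) \<Longrightarrow> m \<in> hom_set E (Fobj F c) X \<Longrightarrow> \<theta> c m \<in> hom_set E (Fobj F c) Y"
    and nat': "\<And>d c f m. f \<in> hom_set (op_cat C) d c \<Longrightarrow> m \<in> hom_set E (Fobj F c) X \<Longrightarrow>
      \<theta> d (m \<cdot>\<^bsub>E\<^esub> Farr F f) = \<theta> c m \<cdot>\<^bsub>E\<^esub> Farr F f"
  have \<theta>: "\<theta> c m \<in> hom_set E (Hset c) Y" if "c \<in> Obj C" "m \<in> hom_set E (Hset c) X" for c m
    using in'[of c m] that by (simp add: F_simps)
  have nat: "\<theta> d (m \<cdot>\<^bsub>E\<^esub> Farr F f) = \<theta> c m \<cdot>\<^bsub>E\<^esub> Farr F f"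
    if "f \<in> hom_set C c d" "m \<in> hom_set E (Hset c) X" for c d f m
    using nat'[of f d c m] that by (simp add: F_simps)
  have pre: "m \<cdot>\<^bsub>E\<^esub> Farr F f \<in> hom_set E (Hset d) X"
    if "f \<in> hom_set C c d" "m \<in> hom_set E (Hset c) X" for c d f m
    using nerve.K_precomp[of f d c m X] that by (simp add: F_simps)
  \<comment> \<open>The map sought sends \<open>tmap m \<chi>\<close> to
    \<open>tmap (\<theta> c m) \<chi>\<close>. Two ways of reaching the same point are pulled to a
    common stage \<open>\<epsilon>\<close>, where they become one and the same map on a transitive
    action; naturality of \<open>\<theta>\<close> does the rest.\<close>
  have well_defined: "tmap (\<theta> c m) \<chi> = tmap (\<theta> d n) \<xi>"
    if c: "c \<in> Obj C" "m \<in> hom_set E (Hset c) X" "\<chi> \<in> H c"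
      and d: "d \<in> Obj C" "n \<in> hom_set E (Hset d) X" "\<xi> \<in> H d" and eq: "tmap m \<chi> = tmap n \<xi>" for c m \<chi> d n \<xi>
  proof -
    obtain x f g \<epsilon> where x: "x \<in> Obj C" "f \<in> hom_set C c x" "g \<in> hom_set C d x" "\<epsilon> \<in> H x"
      "\<chi> = \<epsilon> \<star> f" "\<xi> = \<epsilon> \<star> g"
      using jointE[OF c(1) d(1) c(3) d(3)] by metis
    have "tmap (m \<cdot>\<^bsub>E\<^esub> Farr F f) \<epsilon> = tmap (n \<cdot>\<^bsub>E\<^esub> Farr F g) \<epsilon>"
      using E_hom_pull[OF c(2) x(2,4)] E_hom_pull[OF d(2) x(3,4)] eq x(5,6) by simp
    then have "m \<cdot>\<^bsub>E\<^esub> Farr F f = n \<cdot>\<^bsub>E\<^esub> Farr F g"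
      by (rule E_hom_H_eqI[OF x(1) pre[OF x(2) c(2)] pre[OF x(3) d(2)] x(4)])
    then have "\<theta> c m \<cdot>\<^bsub>E\<^esub> Farr F f = \<theta> d n \<cdot>\<^bsub>E\<^esub> Farr F g"
      using nat[OF x(2) c(2)] nat[OF x(3) d(2)] by simp
    then show ?thesis
      using E_hom_pull[OF \<theta>[OF c(1,2)] x(2,4)] E_hom_pull[OF \<theta>[OF d(1,2)] x(3,4)] x(5,6) by simp
  qed
  have "\<forall>x\<in>Pts X. \<exists>y. \<forall>c\<in>Obj C. \<forall>m\<in>hom_set E (Hset c) X. \<forall>\<chi>\<in>H c. tmap m \<chi> = x \<longrightarrow> tmap (\<theta> c m) \<chi> = y"
    using E_hom_H_hits[OF X] well_defined by metis
  then obtain t where t: "\<And>c m \<chi>. c \<in> Obj C \<Longrightarrow> m \<in> hom_set E (Hset c) X \<Longrightarrow> \<chi> \<in> H c \<Longrightarrow>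
      tmap (\<theta> c m) \<chi> = t (tmap m \<chi>)"
    using E_hom_H(1) by (metis (no_types, lifting))
  have "t x \<in> Pts Y \<and> (\<forall>g\<in>carrier G. t (Act X g x) = Act Y g (t x))" if x: "x \<in> Pts X" for x
  proof -
    obtain c \<chi> m where c: "c \<in> Obj C" "\<chi> \<in> H c" "m \<in> hom_set E (Hset c) X" "tmap m \<chi> = x"
      using E_hom_H_hits[OF X x] by blast
    show ?thesis
      using E_hom_H[OF c(3,2)] E_hom_H[OF \<theta>[OF c(1,3)] c(2)] t[OF c(1,3)] c(2,4) H_act[OF _ c(2)]
      by metis
  qed
  then have T: "TMap X (restrict t (Pts X)) Y \<in> hom_set E X Y" (is "?t \<in> _")
    using X Y Act_simps(1)[OF X] by (auto simp: hom_set_E)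
  have "\<theta> c m = ?t \<cdot>\<^bsub>E\<^esub> m" if c: "c \<in> Obj C" and m: "m \<in> hom_set E (Hset c) X" for c m
  proof (rule E_hom_H_eqI[OF c \<theta>[OF c m] nerve.cod.Comp_in[OF m T] base_point[OF c]])
    show "tmap (\<theta> c m) (base_point c) = tmap (?t \<cdot>\<^bsub>E\<^esub> m) (base_point c)"
      using E_apply(3)[OF m, of "base_point c" ?t] base_point[OF c] t[OF c m] E_hom_H(1)[OF m] by simp
  qed
  then show "\<exists>t\<in>hom_set E X Y. \<forall>c\<in>Obj (op_cat C). \<forall>m\<in>hom_set E (Fobj F c) X. \<theta> c m = t \<cdot>\<^bsub>E\<^esub> m"
    using T by (intro bexI[OF _ T]) (simp add: F_simps)
qed

text \<open>
  The action corresponding to a sheaf \<open>P\<close> is the colimit of the \<open>P(c)\<close> over all arrows \<open>\<chi> : c \<rightarrow> u\<close>: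
  pairs \<open>(\<chi>, y)\<close> with \<open>y\<close> in \<open>P(c)\<close>, identified when they agree at a common stage \<open>d \<rightarrow> u\<close>.
\<close>
lemma nerve_surjective:
  fixes P :: "('c, 'b, 'v) presheaf"
  assumes v: "set_universe TYPE('v)" and small: "small TYPE('v) (Obj C)"
    and P: "cat_functor C Set_cat P" and sheaf: "is_sheaf (op_cat C) (atomic_topology (op_cat C)) P"
  shows "\<exists>X\<in>Obj E. \<exists>p. (\<forall>c\<in>Obj C. bij_betw (p c) (Fobj P c) (hom_set E (Hset c) X)) \<and>
    (\<forall>c d f y. f \<in> hom_set C c d \<longrightarrow> y \<in> Fobj P c \<longrightarrow> p d (tmap (Farr P f) y) = p c y \<cdot>\<^bsub>E\<^esub> Farr F f)"
proof -
  interpret P: cat_functor C Set_cat P by fact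
  note P_in = Farr_Set_in[OF P] and P_Ident = Farr_Set_Ident[OF P] and P_Comp = Farr_Set_Comp[OF P]
  have strict: "\<exists>!y. y \<in> Fobj P d \<and> tmap (Farr P f) y = z"
    if f: "f \<in> hom_set C d c" and z: "z \<in> Fobj P c"
      and eq: "\<And>x h k. h \<in> hom_set C c x \<Longrightarrow> k \<in> hom_set C c x \<Longrightarrow> h \<cdot>\<^bsub>C\<^esub> f = k \<cdot>\<^bsub>C\<^esub> f \<Longrightarrow>
          tmap (Farr P h) z = tmap (Farr P k) z" for f d c z
  proof -
    have dc: "f \<in> Arr C" "Dom C f = d" "Cod C f = c" using f by (auto simp: hom_set_def)
    have "\<forall>x\<in>Obj C. \<forall>h\<in>hom_set C c x. \<forall>k\<in>hom_set C c x. h \<cdot>\<^bsub>C\<^esub> f = k \<cdot>\<^bsub>C\<^esub> f \<longrightarrow>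
        tmap (Farr P h) z = tmap (Farr P k) z"
      using eq by blast
    then show ?thesis
      using bspec[OF bspec[OF sheaf[unfolded is_sheaf_atomic_iff[OF dom.category_axioms amalgamation P]] dc(1)],
          unfolded dc(2,3), OF z] by blast
  qed
  \<comment> \<open>An element \<open>y\<close> shows that its own image satisfies the premise of
    \<open>strict\<close>, so uniqueness there makes the transition maps injective.\<close>
  have inj: "y = y'" if f: "f \<in> hom_set C d c" and y: "y \<in> Fobj P d" "y' \<in> Fobj P d"
    "tmap (Farr P f) y = tmap (Farr P f) y'" for f d c y y'
  proof -
    have "\<exists>!w. w \<in> Fobj P d \<and> tmap (Farr P f) w = tmap (Farr P f) y"
    proof (rule strict[OF f P_in[OF f y(1)]])
      fix x h k assume hk: "h \<in> hom_set C c x" "k \<in> hom_set C c x" "h \<cdot>\<^bsub>C\<^esub> f = k \<cdot>\<^bsub>C\<^esub> f"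
      show "tmap (Farr P h) (tmap (Farr P f) y) = tmap (Farr P k) (tmap (Farr P f) y)"
        using P_Comp[OF f hk(1) y(1)] P_Comp[OF f hk(2) y(1)] hk(3) by simp
    qed
    then show ?thesis using y by metis
  qed
  define A where "A = (\<Union>c\<in>Obj C. \<Union>\<chi>\<in>H c. (\<lambda>y. (c, \<chi>, y)) ` Fobj P c)"
  have A: "(c, \<chi>, y) \<in> A \<longleftrightarrow> c \<in> Obj C \<and> \<chi> \<in> H c \<and> y \<in> Fobj P c" for c \<chi> y
    by (auto simp: A_def)
  have "small TYPE('v) (Fobj P c)" if "c \<in> Obj C" for c
    using P.Fobj_in[OF that] by simp
  \<comment> \<open>Regularity of the universe enters here, through the unions over the objects of
    \<open>C\<close> and over the arrows into \<open>u\<close>.\<close>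
  then have smallA: "small TYPE('v) A"
    unfolding A_def by (intro small_UN[OF v] small small_hom small_image)
  \<comment> \<open>One common stage suffices and no zigzags are needed: by (a) the arrows into
    \<open>u\<close> form a directed system, and by (b) at most one arrow of \<open>C\<close> with
    given ends factors one of them through another.\<close>
  define rel where "rel c \<chi> y c' \<chi>' y' \<longleftrightarrow> (\<exists>d f f' \<epsilon>. f \<in> hom_set C c d \<and> f' \<in> hom_set C c' d \<and> \<epsilon> \<in> H d \<and>
      \<epsilon> \<star> f = \<chi> \<and> \<epsilon> \<star> f' = \<chi>' \<and> tmap (Farr P f) y = tmap (Farr P f') y')" for c \<chi> y c' \<chi>' y'
  have rel_trans: "rel c \<chi> y c'' \<chi>'' y''"
    if y: "y \<in> Fobj P c" "y' \<in> Fobj P c'" "y'' \<in> Fobj P c''"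
      and r: "rel c \<chi> y c' \<chi>' y'" "rel c' \<chi>' y' c'' \<chi>'' y''" for c \<chi> y c' \<chi>' y' c'' \<chi>'' y''
  proof -
    obtain d f f' \<epsilon> where f: "f \<in> hom_set C c d" "f' \<in> hom_set C c' d" "\<epsilon> \<in> H d" "\<epsilon> \<star> f = \<chi>" "\<epsilon> \<star> f' = \<chi>'"
      "tmap (Farr P f) y = tmap (Farr P f') y'"
      using r(1) unfolding rel_def by blast
    obtain e k k' \<eta> where k: "k \<in> hom_set C c' e" "k' \<in> hom_set C c'' e" "\<eta> \<in> H e" "\<eta> \<star> k = \<chi>'" "\<eta> \<star> k' = \<chi>''"
      "tmap (Farr P k) y' = tmap (Farr P k') y''"
      using r(2) unfolding rel_def by blast
    obtain x s t \<zeta> where x: "x \<in> Obj C" "s \<in> hom_set C d x" "t \<in> hom_set C e x" "\<zeta> \<in> H x" "\<epsilon> = \<zeta> \<star> s" "\<eta> = \<zeta> \<star> t"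
      using jointE[OF dom.hom_objects(2)[OF f(1)] dom.hom_objects(2)[OF k(1)] f(3) k(3)] by metis
    \<comment> \<open>Both composites pull \<open>\<zeta>\<close> back to the middle arrow
      \<open>\<chi>'\<close>, so (b) identifies them and \<open>y'\<close> has the same image along
      either route.\<close>
    have "\<zeta> \<star> (s \<cdot>\<^bsub>C\<^esub> f') = \<zeta> \<star> (t \<cdot>\<^bsub>C\<^esub> k)"
      using pull_pull[OF x(2) f(2) x(4)] pull_pull[OF x(3) k(1) x(4)] f(5) k(4) x(5,6) by simp
    then have "s \<cdot>\<^bsub>C\<^esub> f' = t \<cdot>\<^bsub>C\<^esub> k"
      by (rule cancelD[OF x(4) dom.Comp_in[OF f(2) x(2)] dom.Comp_in[OF k(1) x(3)]])
    then have "tmap (Farr P (s \<cdot>\<^bsub>C\<^esub> f)) y = tmap (Farr P (t \<cdot>\<^bsub>C\<^esub> k')) y''"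
      using P_Comp[OF f(1) x(2) y(1)] P_Comp[OF f(2) x(2) y(2)] P_Comp[OF k(1) x(3) y(2)]
        P_Comp[OF k(2) x(3) y(3)] f(6) k(6) by simp
    moreover have "\<zeta> \<star> (s \<cdot>\<^bsub>C\<^esub> f) = \<chi>" "\<zeta> \<star> (t \<cdot>\<^bsub>C\<^esub> k') = \<chi>''"
      using pull_pull[OF x(2) f(1) x(4)] pull_pull[OF x(3) k(2) x(4)] f(4) k(5) x(5,6) by simp_all
    ultimately show ?thesis
      unfolding rel_def using dom.Comp_in[OF f(1) x(2)] dom.Comp_in[OF k(2) x(3)] x(4) by blast
  qed
  have rel_pull: "rel c (\<epsilon> \<star> f) y d \<epsilon> (tmap (Farr P f) y)"
    if f: "f \<in> hom_set C c d" and "\<epsilon> \<in> H d" "y \<in> Fobj P c" for c d f \<epsilon> y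
    unfolding rel_def
    using that dom.Ident_in[OF dom.hom_objects(2)[OF f]] pull_Ident[OF dom.hom_objects(2)[OF f]]
      P_Ident[OF dom.hom_objects(2)[OF f] P_in[OF f]] by metis
  have rel_act: "rel c (g \<cdot>\<^bsub>D\<^esub> \<chi>) y c' (g \<cdot>\<^bsub>D\<^esub> \<chi>') y'" if g: "g \<in> carrier G" and r: "rel c \<chi> y c' \<chi>' y'"
    for g c \<chi> y c' \<chi>' y'
    using r act_pull[OF g] H_act[OF g] unfolding rel_def by metis
  \<comment> \<open>Over a fixed \<open>\<chi>\<close> nothing is identified: (b) forces the two
    arrows to the common stage to coincide, and transition maps are injective. So every
    \<open>Fobj P c\<close> embeds in the colimit.\<close>
  have rel_inj: "y = y'" if y: "y \<in> Fobj P c" "y' \<in> Fobj P c" and r: "rel c \<chi> y c \<chi> y'" for c \<chi> y y'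
  proof -
    obtain d f f' \<epsilon> where f: "f \<in> hom_set C c d" "f' \<in> hom_set C c d" "\<epsilon> \<in> H d" "\<epsilon> \<star> f = \<chi>" "\<epsilon> \<star> f' = \<chi>"
      "tmap (Farr P f) y = tmap (Farr P f') y'"
      using r unfolding rel_def by blast
    then have "f = f'" using cancelD[OF f(3,1,2)] by simp
    then show ?thesis using inj[OF f(1) y] f(6) by simp
  qed
  define r where "r = {((c, \<chi>, y), (c', \<chi>', y')) | c \<chi> y c' \<chi>' y'.
      (c, \<chi>, y) \<in> A \<and> (c', \<chi>', y') \<in> A \<and> rel c \<chi> y c' \<chi>' y'}"
  have "equiv A r"
  proof (rule equivI)
    show "r \<subseteq> A \<times> A" by (auto simp: r_def)
    show "refl_on A r"
    proof (rule refl_onI)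
      fix t assume "t \<in> A"
      moreover obtain c \<chi> y where t: "t = (c, \<chi>, y)" by (cases t)
      ultimately have t': "c \<in> Obj C" "\<chi> \<in> H c" "y \<in> Fobj P c" by (auto simp: A)
      have "rel c \<chi> y c \<chi> y" unfolding rel_def
        using t' dom.Ident_in[OF t'(1)] pull_Ident[OF t'(1,2)] by blast
      then show "(t, t) \<in> r" using \<open>t \<in> A\<close> by (auto simp: r_def t)
    qed
    show "sym r" unfolding sym_def r_def rel_def by (auto; metis)
    show "trans r"
      by (rule transI) (auto simp: r_def A intro: rel_trans)
  qed
  from small_quotient_map[OF smallA this]
  obtain q' where q': "\<forall>s\<in>A. \<forall>t\<in>A. q' s = (q' t :: 'v) \<longleftrightarrow> (s, t) \<in> r" by blast
  define q where "q c \<chi> y = q' (c, \<chi>, y)" for c \<chi> y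
  have q: "q c \<chi> y = q c' \<chi>' y' \<longleftrightarrow> rel c \<chi> y c' \<chi>' y'"
    if "c \<in> Obj C" "\<chi> \<in> H c" "y \<in> Fobj P c" "c' \<in> Obj C" "\<chi>' \<in> H c'" "y' \<in> Fobj P c'" for c \<chi> y c' \<chi>' y'
    using q'[rule_format, of "(c, \<chi>, y)" "(c', \<chi>', y')"] that by (simp add: q_def r_def A)
  have q_pull: "q c (\<epsilon> \<star> f) y = q d \<epsilon> (tmap (Farr P f) y)"
    if "f \<in> hom_set C c d" "\<epsilon> \<in> H d" "y \<in> Fobj P c" for c d f \<epsilon> y
    using q rel_pull[OF that] that dom.hom_objects[OF that(1)] H_pull[OF that(1,2)] P_in[OF that(1,3)] by blast
  have q_inj: "y = y'" if "q c \<chi> y = q c \<chi> y'" "c \<in> Obj C" "\<chi> \<in> H c" "y \<in> Fobj P c" "y' \<in> Fobj P c" for c \<chi> y y'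
    using that q rel_inj by blast
  define Q where "Q = q' ` A"
  have Q_E: "\<exists>c\<in>Obj C. \<exists>\<chi>\<in>H c. \<exists>y\<in>Fobj P c. x = q c \<chi> y" if "x \<in> Q" for x
    using that by (auto simp: Q_def A_def q_def)
  have q_in: "q c \<chi> y \<in> Q" if "c \<in> Obj C" "\<chi> \<in> H c" "y \<in> Fobj P c" for c \<chi> y
    using that A by (auto simp: Q_def q_def)
  \<comment> \<open>The group moves the arrow into \<open>u\<close> and keeps the element of
    \<open>P\<close>; \<open>rel_act\<close> makes the selected representative immaterial.\<close>
  define act where "act g = (\<lambda>x\<in>Q. case inv_into A q' x of (c, \<chi>, y) \<Rightarrow> q c (g \<cdot>\<^bsub>D\<^esub> \<chi>) y)" for g
  have act: "act g (q c \<chi> y) = q c (g \<cdot>\<^bsub>D\<^esub> \<chi>) y"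
    if g: "g \<in> carrier G" and c: "c \<in> Obj C" "\<chi> \<in> H c" "y \<in> Fobj P c" for g c \<chi> y
  proof -
    obtain c' \<chi>' y' where c': "inv_into A q' (q c \<chi> y) = (c', \<chi>', y')" by (cases "inv_into A q' (q c \<chi> y)")
    have "(c', \<chi>', y') \<in> A" "q' (c', \<chi>', y') = q c \<chi> y"
      using inv_into_into[of "q c \<chi> y" q' A] f_inv_into_f[of "q c \<chi> y" q' A] q_in[OF c] c' by (auto simp: Q_def)
    then have A': "c' \<in> Obj C" "\<chi>' \<in> H c'" "y' \<in> Fobj P c'" "q c' \<chi>' y' = q c \<chi> y" by (auto simp: A q_def)
    then have "rel c' (g \<cdot>\<^bsub>D\<^esub> \<chi>') y' c (g \<cdot>\<^bsub>D\<^esub> \<chi>) y" using q c rel_act[OF g] by blast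
    then have "q c' (g \<cdot>\<^bsub>D\<^esub> \<chi>') y' = q c (g \<cdot>\<^bsub>D\<^esub> \<chi>) y" using q A' c H_act[OF g] by blast
    then show ?thesis using q_in[OF c] c' by (simp add: act_def)
  qed
  define X where "X = \<lparr>Pts = Q, Act = restrict act (carrier G)\<rparr>"
  have "group_action G Q (restrict act (carrier G))"
  proof (rule group_actionI[OF group_axioms])
    show "restrict act (carrier G) g \<in> extensional Q" if "g \<in> carrier G" for g
      using that by (simp add: act_def)
    fix x assume "x \<in> Q"
    then obtain c \<chi> y where c: "c \<in> Obj C" "\<chi> \<in> H c" "y \<in> Fobj P c" and x: "x = q c \<chi> y"
      using Q_E by blast
    show "restrict act (carrier G) g x \<in> Q" if "g \<in> carrier G" for g
      using act[OF that c] q_in[OF c(1) H_act[OF that c(2)] c(3)] x that by simp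
    show "restrict act (carrier G) \<one>\<^bsub>G\<^esub> x = x"
      using act[OF one_closed c] act_one[OF c(2)] one_closed x by simp
    show "restrict act (carrier G) (g \<otimes>\<^bsub>G\<^esub> h) x = restrict act (carrier G) g (restrict act (carrier G) h x)"
      if g: "g \<in> carrier G" and h: "h \<in> carrier G" for g h
      using act[OF m_closed[OF g h] c] act[OF h c] act[OF g c(1) H_act[OF h c(2)] c(3)]
        act_act[OF g h c(2)] m_closed[OF g h] g h x by simp
  qed
  moreover have "\<exists>c\<in>Obj C. \<exists>\<chi>\<in>H c. \<forall>g\<in>carrier G. g \<cdot>\<^bsub>D\<^esub> \<chi> = \<chi> \<longrightarrow> restrict act (carrier G) g x = x"
    if "x \<in> Q" for x
  proof -
    from Q_E[OF that] obtain c \<chi> y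
      where c: "c \<in> Obj C" "\<chi> \<in> H c" "y \<in> Fobj P c" and x: "x = q c \<chi> y" by blast
    \<comment> \<open>A class represented over \<open>\<chi>\<close> is fixed by
      \<open>stab \<chi>\<close>, which is the continuity of the action.\<close>
    then have "\<forall>g\<in>carrier G. g \<cdot>\<^bsub>D\<^esub> \<chi> = \<chi> \<longrightarrow> restrict act (carrier G) g x = x"
      using act by simp
    then show ?thesis using c by blast
  qed
  ultimately have X: "X \<in> Obj E"
    unfolding Obj_E using small_image[OF smallA, of q'] by (simp add: X_def Q_def[symmetric])
  define p where "p c y = TMap (Hset c) (\<lambda>\<chi>\<in>H c. q c \<chi> y) X" for c y
  have p: "p c y \<in> hom_set E (Hset c) X" "\<And>\<chi>. \<chi> \<in> H c \<Longrightarrow> tmap (p c y) \<chi> = q c \<chi> y"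
    if c: "c \<in> Obj C" "y \<in> Fobj P c" for c y
  proof -
    show "p c y \<in> hom_set E (Hset c) X"
      using X Hset_in[OF c(1)] q_in[OF c(1) _ c(2)] act[OF _ c(1) _ c(2)] H_act
      by (auto simp: hom_set_E p_def X_def)
    show "\<And>\<chi>. \<chi> \<in> H c \<Longrightarrow> tmap (p c y) \<chi> = q c \<chi> y" by (simp add: p_def)
  qed
  have surj: "\<exists>y\<in>Fobj P c. p c y = m" if c: "c \<in> Obj C" and m: "m \<in> hom_set E (Hset c) X" for c m
  proof -
    obtain \<chi> where \<chi>: "\<chi> \<in> H c" using H_nonempty c by blast
    have "tmap m \<chi> \<in> Q" using E_hom_H(1)[OF m \<chi>] by (simp add: X_def)
    then obtain d \<xi> w where d: "d \<in> Obj C" "\<xi> \<in> H d" "w \<in> Fobj P d" "tmap m \<chi> = q d \<xi> w"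
      using Q_E by blast
    \<comment> \<open>At a common stage of \<open>\<chi>\<close> and the arrow \<open>\<xi>\<close>
      representing its image, the image is the class of some \<open>w'\<close> over
      \<open>\<epsilon>\<close>, while \<open>\<chi> = \<epsilon> \<star> f\<close>. It remains to
      descend \<open>w'\<close> along \<open>f\<close>, which is what the sheaf condition
      provides.\<close>
    obtain e f g \<epsilon> where e: "e \<in> Obj C" "f \<in> hom_set C c e" "g \<in> hom_set C d e" "\<epsilon> \<in> H e"
      "\<chi> = \<epsilon> \<star> f" "\<xi> = \<epsilon> \<star> g"
      using jointE[OF c d(1) \<chi> d(2)] by metis
    define w' where "w' = tmap (Farr P g) w"
    have w': "w' \<in> Fobj P e" using P_in[OF e(3) d(3)] by (simp add: w'_def)
    have m\<chi>: "tmap m \<chi> = q e \<epsilon> w'"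
      using q_pull[OF e(3,4) d(3)] d(4) e(6) by (simp add: w'_def)
    have "tmap (Farr P h) w' = tmap (Farr P k) w'"
      if h: "h \<in> hom_set C e x" and k: "k \<in> hom_set C e x" and eq: "h \<cdot>\<^bsub>C\<^esub> f = k \<cdot>\<^bsub>C\<^esub> f" for x h k
    proof -
      note x = dom.hom_objects(2)[OF h]
      \<comment> \<open>As in \<open>full_iff_strict\<close>, automorphisms \<open>s\<close> and
        \<open>t\<close> imitate \<open>h\<close> and \<open>k\<close> at \<open>\<epsilon>\<close>.
        Equivariance of \<open>m\<close> carries their agreement at \<open>\<chi>\<close> to the
        class of \<open>w'\<close>, and \<open>q_inj\<close> brings it back to
        \<open>P\<close>.\<close>
      obtain \<zeta> where \<zeta>: "\<zeta> \<in> H x" using H_nonempty x by blast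
      obtain s t where s: "s \<in> carrier G" "s \<cdot>\<^bsub>D\<^esub> \<epsilon> = \<zeta> \<star> h" and t: "t \<in> carrier G" "t \<cdot>\<^bsub>D\<^esub> \<epsilon> = \<zeta> \<star> k"
        using ultra[OF h e(4) \<zeta>] ultra[OF k e(4) \<zeta>] by blast
      have "s \<cdot>\<^bsub>D\<^esub> \<chi> = t \<cdot>\<^bsub>D\<^esub> \<chi>"
        using act_pull[OF s(1) e(2,4)] act_pull[OF t(1) e(2,4)] e(5) s(2) t(2)
          pull_pull[OF h e(2) \<zeta>] pull_pull[OF k e(2) \<zeta>] eq by simp
      then have "Act X s (q e \<epsilon> w') = Act X t (q e \<epsilon> w')"
        using E_hom_H(2)[OF m \<chi> s(1)] E_hom_H(2)[OF m \<chi> t(1)] m\<chi> by simp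
      then have "q e (\<zeta> \<star> h) w' = q e (\<zeta> \<star> k) w'"
        using act[OF s(1) e(1,4) w'] act[OF t(1) e(1,4) w'] s t by (simp add: X_def)
      then have "q x \<zeta> (tmap (Farr P h) w') = q x \<zeta> (tmap (Farr P k) w')"
        using q_pull[OF h \<zeta> w'] q_pull[OF k \<zeta> w'] by simp
      then show ?thesis
        using q_inj x \<zeta> P_in[OF h w'] P_in[OF k w'] by blast
    qed
    then obtain y where y: "y \<in> Fobj P c" "tmap (Farr P f) y = w'"
      using strict[OF e(2) w'] by blast
    have "tmap (p c y) \<chi> = tmap m \<chi>"
      using p(2)[OF c y(1) \<chi>] q_pull[OF e(2,4) y(1)] y(2) e(5) m\<chi> by simp
    then show ?thesis using E_hom_H_eqI[OF c p(1)[OF c y(1)] m \<chi>] y(1) by blast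
  qed
  have "bij_betw (p c) (Fobj P c) (hom_set E (Hset c) X)" if c: "c \<in> Obj C" for c
    unfolding bij_betw_def
  proof
    show "p c ` Fobj P c = hom_set E (Hset c) X" using p(1)[OF c] surj[OF c] by blast
    obtain \<chi> where \<chi>: "\<chi> \<in> H c" using H_nonempty c by blast
    show "inj_on (p c) (Fobj P c)"
    proof (rule inj_onI)
      fix y y' assume "y \<in> Fobj P c" "y' \<in> Fobj P c" "p c y = p c y'"
      then show "y = y'" using p(2)[OF c _ \<chi>] q_inj c \<chi> by metis
    qed
  qed
  moreover have "p d (tmap (Farr P f) y) = p c y \<cdot>\<^bsub>E\<^esub> Farr F f"
    if f: "f \<in> hom_set C c d" and y: "y \<in> Fobj P c" for c d f y
  proof -
    note cd = dom.hom_objects(1,2)[OF f]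
    obtain \<epsilon> where \<epsilon>: "\<epsilon> \<in> H d" using H_nonempty cd by blast
    show ?thesis
    proof (rule E_hom_H_eqI[OF cd(2) p(1)[OF cd(2) P_in[OF f y]] nerve.cod.Comp_in[OF F_in[OF f] p(1)[OF cd(1) y]] \<epsilon>])
      show "tmap (p d (tmap (Farr P f) y)) \<epsilon> = tmap (p c y \<cdot>\<^bsub>E\<^esub> Farr F f) \<epsilon>"
        using p(2)[OF cd(2) P_in[OF f y] \<epsilon>] E_hom_pull[OF p(1)[OF cd(1) y] f \<epsilon>]
          p(2)[OF cd(1) y H_pull[OF f \<epsilon>]] q_pull[OF f \<epsilon> y] by simp
    qed
  qed
  ultimately show ?thesis using X by blast
qed

lemma sheaf_equivalence:
  assumes v: "set_universe TYPE('v)" and small: "small TYPE('v) (Obj C)"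
  shows "induces_sheaf_equivalence TYPE('v) (op_cat C) (atomic_topology (op_cat C)) E F"
  unfolding induces_sheaf_equivalence_def
proof (intro exI[of _ nerve.nerve] conjI nerve.induced_by_nerve)
  let ?FC = "functor_cat (op_cat (op_cat C)) (Set_cat :: ('v set, _) cat)"
  let ?Sh = "Sh (op_cat C) (atomic_topology (op_cat C)) ::
    (('c, 'b, 'v) presheaf, (('c, 'b, 'v) presheaf, 'c \<Rightarrow> ('v set, 'v \<Rightarrow> 'v) tagged_map) tagged_map) cat"
  show "equivalence_functor E ?Sh nerve.nerve"
  proof (rule equivalence_functorI[OF _ _ nerve_faithful])
    show "cat_functor E ?Sh nerve.nerve"
      unfolding Sh_def by (rule cat_functor_full_subcat[OF nerve.nerve_functor]) (simp add: nerve_sheaf)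
    show "full_functor E ?Sh nerve.nerve"
      using nerve_full unfolding full_functor_def Sh_def
      by (auto simp: hom_set_full_subcat split: if_splits)
    fix P assume P: "P \<in> Obj ?Sh"
    then have P': "P \<in> Obj ?FC" "is_sheaf (op_cat C) (atomic_topology (op_cat C)) P"
      by (simp_all add: Sh_def)
    then have "cat_functor C Set_cat P" by (simp add: functor_cat_simps)
    then obtain X p where X: "X \<in> Obj E" and p: "\<And>c. c \<in> Obj C \<Longrightarrow> bij_betw (p c) (Fobj P c) (hom_set E (Hset c) X)"
      "\<And>c d f y. f \<in> hom_set C c d \<Longrightarrow> y \<in> Fobj P c \<Longrightarrow> p d (tmap (Farr P f) y) = p c y \<cdot>\<^bsub>E\<^esub> Farr F f"
      using nerve_surjective[OF v small _ P'(2)] by blast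
    have "\<exists>m\<in>hom_set ?FC (nerve.nerve_presheaf X) P. \<exists>n. inverse_arrows ?FC m n"
      by (rule nerve.nerve_isomorphic[OF X P'(1), of p]) (use p in \<open>simp_all add: F_simps\<close>)
    then obtain m n where m: "m \<in> hom_set ?FC (nerve.nerve_presheaf X) P" "inverse_arrows ?FC m n"
      by blast
    then have "m \<in> hom_set ?Sh (Fobj nerve.nerve X) P" "inverse_arrows ?Sh m n"
      using P'(2) nerve_sheaf[OF X] inverse_arrows_full_subcat[OF m(2)]
      by (auto simp: Sh_def hom_set_full_subcat) (auto simp: hom_set_def)
    then show "\<exists>X\<in>Obj E. \<exists>m\<in>hom_set ?Sh (Fobj nerve.nerve X) P. isomorphism ?Sh m"
      using X by (auto simp: isomorphism_def)
  qed
qed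

end

theorem theorem4p3:
  fixes C :: "('c, 'b) cat"
    and D :: "('d, 'v) cat"
    and \<iota> :: "('c, 'b, 'd, 'v) cfunctor"
    and u :: 'd
  assumes universe: "set_universe TYPE('v)"
    and C: "small_category TYPE('v) C" "Obj C \<noteq> {}"
    and D: "locally_small_category TYPE('v) D"
    and embedding: "full_embedding C D \<iota>"
    and u: "u \<in> Obj D" "ultrahomogeneous_object C D \<iota> u" "universal_object C D \<iota> u"
    and a: "\<And>a b \<xi> \<chi>. \<lbrakk>a \<in> Obj C; b \<in> Obj C;
              \<xi> \<in> hom_set D (Fobj \<iota> a) u; \<chi> \<in> hom_set D (Fobj \<iota> b) u\<rbrakk> \<Longrightarrow>
              \<exists>c\<in>Obj C. \<exists>f\<in>hom_set C a c. \<exists>g\<in>hom_set C b c. \<exists>\<epsilon>\<in>hom_set D (Fobj \<iota> c) u.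
                \<epsilon> \<cdot>\<^bsub>D\<^esub> Farr \<iota> f = \<xi> \<and> \<epsilon> \<cdot>\<^bsub>D\<^esub> Farr \<iota> g = \<chi>"
    and b: "\<And>a b f g \<chi>. \<lbrakk>a \<in> Obj C; b \<in> Obj C; f \<in> hom_set C a b; g \<in> hom_set C a b;
              \<chi> \<in> hom_set D (Fobj \<iota> b) u; \<chi> \<cdot>\<^bsub>D\<^esub> Farr \<iota> f = \<chi> \<cdot>\<^bsub>D\<^esub> Farr \<iota> g\<rbrakk> \<Longrightarrow> f = g"
  shows "amalgamation_property C \<and>
    joint_embedding_property C \<and>
    algebraic_base (Aut_group D u) (fixing_subgroups C D \<iota> u) \<and>
    cat_functor (op_cat C) (Cont_Aut C D \<iota> u) (hom_functor C D \<iota> u) \<and>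
    cat_functor (op_cat C)
      (full_subcat (Cont_Aut C D \<iota> u) {X. transitive_gset (Aut_group D u) X})
      (hom_functor C D \<iota> u) \<and>
    ((\<forall>f\<in>Arr C. strict_monomorphism C f) \<longleftrightarrow>
       full_functor (op_cat C) (Cont_Aut C D \<iota> u) (hom_functor C D \<iota> u) \<and>
       faithful_functor (op_cat C) (hom_functor C D \<iota> u) \<and>
       induces_sheaf_equivalence TYPE('v) (op_cat C) (atomic_topology (op_cat C))
         (Cont_Aut C D \<iota> u) (hom_functor C D \<iota> u))"
proof -
  interpret galois_object C D \<iota> u
  proof (intro galois_object.intro galois_object_axioms.intro)
    show "cat_functor C D \<iota>" using embedding by (simp add: full_embedding_def)
    then interpret cat_functor C D \<iota> .
    show "small TYPE('v) (hom_set D (Fobj \<iota> c) u)" if "c \<in> Obj C" for c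
      using D u(1) Fobj_in[OF that] by (simp add: locally_small_category_def)
  qed (fact C(2) u a b)+
  have "small TYPE('v) (Obj C)" using C(1) by (simp add: small_category_def)
  then show ?thesis
    using amalgamation joint_embedding algebraic_base F_functor F_functor_transitive
      full_iff_strict faithful sheaf_equivalence[OF universe] by blast
qed

end
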